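(* Let $\mathfrak g=\mathfrak{gl}(m,n)$ with its distinguished Borel subalgebra, let $\lambda\in\mathfrak h^*$ and let $\gamma\in B(\lambda)$. Then the isotropic root $\gamma$ is independent at $\lambda$ if and only if $\gamma$ is $\lambda$-minimal.
   Context: Ground field $\mathbb C$. $\mathfrak g=\mathfrak{gl}(m,n)$ has matrix units $e_{i,j}$, even iff $i,j$ are both $\le m$ or both $>m$. $\mathfrak h$ is the diagonal subalgebra; $\epsilon_i,\delta_j\in\mathfrak h^*$ are dual to $e_{i,i}$ ($i\le m$), $e_{m+j,m+j}$; $(\epsilon_i,\epsilon_j)=\delta_{ij}=-(\delta_i,\delta_j)$, $(\epsilon_i,\delta_j)=0$; $h_\alpha$ satisfies $\beta(h_\alpha)=(\alpha,\beta)$. The distinguished Borel is the upper triangular one; $\mathfrak n^\pm$ strictly upper/lower triangular, $\mathfrak b^-=\mathfrak h\oplus\mathfrak n^-$; $\Delta^+=\Delta^+_0\cup\Delta^+_1$ with odd positive roots $\Delta_1^+=\{\epsilon_r-\delta_s\}$ (all isotropic), $\Pi$ the simple roots, $\rho=\frac12\sum_{\Delta_0^+}\alpha-\frac12\sum_{\Delta_1^+}\alpha$. For even roots $\alpha$, $\alpha^\vee=2\alpha/(\alpha,\alpha)$ and $s_\alpha$ is the reflection. $v_\lambda$ is a highest weight vector of the Verma module $M(\lambda)$. $B(\lambda)=\{\gamma\in\Delta_1^+:(\lambda+\rho,\gamma)=0\}$. For $\gamma,\gamma'\in B(\lambda)$ write $\gamma'\triangleleft\gamma$ if $\gamma-\gamma'$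 is a positive even root $\alpha$ with $(\lambda+\rho,\alpha^\vee)=0$ and $s_\alpha\gamma=\gamma'$; $\le$ is the reflexive-transitive closure of $\triangleleft$ on $B(\lambda)$. $\gamma$ is $\lambda$-minimal if $\gamma'\le\gamma$ with $\gamma'\in B(\lambda)$ implies $\gamma'=\gamma$. For $\gamma\in\Delta_1^+$, $\theta_\gamma$ denotes a Šapovalov element for $(\gamma,1)$: an element of $U(\mathfrak b^-)$ of weight $-\gamma$ of the form $\sum_\pi e_{-\pi}H_\pi$, $H_\pi\in U(\mathfrak h)$, where $\pi$ runs over partitions of $\gamma$ (functions $\pi:\Delta^+\to\mathbb Z_{\ge0}$ with $\sum\pi(\alpha)\alpha=\gamma$, $\pi(\alpha)\le1$ for $\alpha$ odd), $e_{-\pi}$ is the ordered product of the $e_{-\alpha}^{\pi(\alpha)}$ for a fixed order on $\Delta^+$, with $H_{\pi^0}=1$ for the partition $\pi^0$ vanishing off $\Pi$, and $e_\alpha\theta_\gamma\in U(\mathfrak g)(h_\gamma+\rho(h_\gamma))+U(\mathfrak g)\mathfrak n^+$ for all $\alpha\in\Delta^+$. For $\gamma\in B(\lambda)$ the vector $\theta_\gamma v_\lambda$ does not depend on the choice of $\theta_\gamma$. $\gamma\in B(\lambda)$ is independent at $\lambda$ if $\theta_\gamma v_\lambda\notin\sum_{\gamma'\in B(\lambda)\setminus\{\gamma\}}U(\mathfrak g)\theta_{\gamma'}v_\lambda$. *)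

theory Defs
  imports Complex_Main "HOL-Library.Poly_Mapping"
begin

section \<open>The enveloping algebra of gl(m,n)\<close>

text \<open>
  The row and column indices of gl(m,n) form the disjoint union of two finite linearly ordered
  types \<open>'m\<close> and \<open>'n\<close> with \<open>m = CARD('m)\<close> and \<open>n = CARD('n)\<close>: the index \<open>Inl r\<close> belongs to
  \<open>\<epsilon>\<^sub>r\<close> and \<open>Inr s\<close> to \<open>\<delta>\<^sub>s\<close>. All of the first block precedes all of the second one.
\<close>

fun prec :: "'m::linorder + 'n::linorder \<Rightarrow> 'm + 'n \<Rightarrow> bool" (infix \<open>\<prec>\<close> 50) where
  "Inl a \<prec> Inl b \<longleftrightarrow> a < b"
| "Inl a \<prec> Inr b \<longleftrightarrow> True"
| "Inr a \<prec> Inl b \<longleftrightarrow> False"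
| "Inr a \<prec> Inr b \<longleftrightarrow> a < b"

text \<open>
  Lists under concatenation are the free monoid, so \<open>'a list \<Rightarrow>\<^sub>0 complex\<close>, with its convolution
  product, is the free associative algebra on \<open>'a\<close>. With \<open>'a\<close> the set of matrix units it is the
  tensor algebra of gl(m,n).
\<close>

instantiation list :: (type) monoid_add
begin
definition "(0 :: 'a list) = []"
definition "(xs :: 'a list) + ys = xs @ ys"
instance by standard (simp_all add: zero_list_def plus_list_def)
end

type_synonym ('m, 'n) tensor = "(('m + 'n) \<times> ('m + 'n)) list \<Rightarrow>\<^sub>0 complex"

definition tgen :: "'m + 'n \<Rightarrow> 'm + 'n \<Rightarrow> ('m, 'n) tensor" where
  "tgen i j = Poly_Mapping.single [(i, j)] 1"

definition even_pair :: "('m + 'n) \<times> ('m + 'n) \<Rightarrow> bool" where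
  "even_pair \<alpha> \<longleftrightarrow> isl (fst \<alpha>) = isl (snd \<alpha>)"

text \<open>The sign $(-1)^{|x||y|}$ for the matrix units $x = e_{i,j}$ and $y = e_{k,l}$.\<close>

definition super_sign ::
    "'m + 'n \<Rightarrow> 'm + 'n \<Rightarrow> 'm + 'n \<Rightarrow> 'm + 'n \<Rightarrow> 'a::ring_1" where
  "super_sign i j k l = (if \<not> even_pair (i, j) \<and> \<not> even_pair (k, l) then - 1 else 1)"

text \<open>
  The relation $xy - (-1)^{|x||y|} yx - [x,y]$ for $x = e_{i,j}$ and $y = e_{k,l}$, where
  $[x,y] = \delta_{jk} e_{i,l} - (-1)^{|x||y|} \delta_{il} e_{k,j}$ is the supercommutator of
  matrices.
\<close>

definition uea_relator ::
    "'m + 'n \<Rightarrow> 'm + 'n \<Rightarrow> 'm + 'n \<Rightarrow> 'm + 'n \<Rightarrow> ('m, 'n) tensor" where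
  "uea_relator i j k l =
     tgen i j * tgen k l - super_sign i j k l * (tgen k l * tgen i j)
     - ((if j = k then tgen i l else 0)
        - super_sign i j k l * (if i = l then tgen k j else 0))"

inductive_set uea_ideal :: "('m, 'n) tensor set" where
  zero: "0 \<in> uea_ideal"
| step: "x \<in> uea_ideal \<Longrightarrow> a * uea_relator i j k l * b + x \<in> uea_ideal"

definition uea_cong :: "('m, 'n) tensor \<Rightarrow> ('m, 'n) tensor \<Rightarrow> bool" where
  "uea_cong x y \<longleftrightarrow> x - y \<in> uea_ideal"

lemma uea_ideal_add: "x \<in> uea_ideal \<Longrightarrow> y \<in> uea_ideal \<Longrightarrow> x + y \<in> uea_ideal"
proof (induction rule: uea_ideal.induct)
  case (step x a i j k l b)
  then have "a * uea_relator i j k l * b + (x + y) \<in> uea_ideal"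
    by (intro uea_ideal.step)
  then show ?case by (simp add: add.assoc)
qed simp

lemma uea_ideal_mult_left: "x \<in> uea_ideal \<Longrightarrow> c * x \<in> uea_ideal"
proof (induction rule: uea_ideal.induct)
  case (step x a i j k l b)
  then have "(c * a) * uea_relator i j k l * b + c * x \<in> uea_ideal"
    by (intro uea_ideal.step)
  then show ?case by (simp add: algebra_simps)
qed (simp add: uea_ideal.zero)

lemma uea_ideal_mult_right: "x \<in> uea_ideal \<Longrightarrow> x * c \<in> uea_ideal"
proof (induction rule: uea_ideal.induct)
  case (step x a i j k l b)
  then have "a * uea_relator i j k l * (b * c) + x * c \<in> uea_ideal"
    by (intro uea_ideal.step)
  then show ?case by (simp add: algebra_simps)
qed (simp add: uea_ideal.zero)

lemma uea_ideal_uminus: "x \<in> uea_ideal \<Longrightarrow> - x \<in> uea_ideal"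
  using uea_ideal_mult_left[of x "- 1"] by simp

lemma lookup_mult_Nil:
  fixes x y :: "'a list \<Rightarrow>\<^sub>0 'b::semiring_0"
  shows "Poly_Mapping.lookup (x * y) [] = Poly_Mapping.lookup x [] * Poly_Mapping.lookup y []"
proof -
  have *: "Sum_any (\<lambda>q. Poly_Mapping.lookup y q when [] = l + q) = (Poly_Mapping.lookup y [] when l = [])" for l :: "'a list"
    by (cases l) (simp_all add: plus_list_def)
  have "Poly_Mapping.lookup (x * y) [] = Sum_any (\<lambda>l. Poly_Mapping.lookup x l * (Poly_Mapping.lookup y [] when l = []))"
    unfolding lookup_mult * ..
  also have "\<dots> = Sum_any (\<lambda>l. Poly_Mapping.lookup x l * Poly_Mapping.lookup y [] when l = [])"
    by (simp add: mult_when)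
  finally show ?thesis by simp
qed

lemma lookup_uea_relator_Nil: "Poly_Mapping.lookup (uea_relator i j k l) [] = 0"
  by (simp add: uea_relator_def lookup_minus lookup_mult_Nil tgen_def lookup_single)

lemma lookup_uea_ideal_Nil: "x \<in> uea_ideal \<Longrightarrow> Poly_Mapping.lookup x [] = 0"
  by (induction rule: uea_ideal.induct)
     (simp_all add: lookup_add lookup_mult_Nil lookup_uea_relator_Nil)

lemma equivp_uea_cong: "equivp (uea_cong :: ('a, 'b) tensor \<Rightarrow> _)"
proof (rule equivpI)
  show "reflp (uea_cong :: ('a, 'b) tensor \<Rightarrow> _)"
    by (simp add: reflp_def uea_cong_def uea_ideal.zero)
  show "symp (uea_cong :: ('a, 'b) tensor \<Rightarrow> _)"
    unfolding symp_def uea_cong_def by (metis minus_diff_eq uea_ideal_uminus)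
  show "transp (uea_cong :: ('a, 'b) tensor \<Rightarrow> _)"
  proof (rule transpI)
    fix x y z :: "('a, 'b) tensor" assume "uea_cong x y" "uea_cong y z"
    then have "(x - y) + (y - z) \<in> uea_ideal"
      unfolding uea_cong_def by (rule uea_ideal_add)
    then show "uea_cong x z"
      by (simp add: uea_cong_def)
  qed
qed

quotient_type ('m, 'n) uea = "('m, 'n) tensor" / uea_cong
  by (rule equivp_uea_cong)

instantiation uea :: (type, type) ring_1
begin

lift_definition zero_uea :: "('a, 'b) uea" is 0 .
lift_definition one_uea :: "('a, 'b) uea" is 1 .
lift_definition plus_uea :: "('a, 'b) uea \<Rightarrow> ('a, 'b) uea \<Rightarrow> ('a, 'b) uea" is "(+)"
  unfolding uea_cong_def add_diff_add by (rule uea_ideal_add)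
lift_definition uminus_uea :: "('a, 'b) uea \<Rightarrow> ('a, 'b) uea" is uminus
  unfolding uea_cong_def minus_diff_minus by (rule uea_ideal_uminus)
lift_definition minus_uea :: "('a, 'b) uea \<Rightarrow> ('a, 'b) uea \<Rightarrow> ('a, 'b) uea" is "(-)"
proof -
  fix x x' y y' :: "('a, 'b) tensor"
  assume "uea_cong x x'" "uea_cong y y'"
  then have "(x - x') + - (y - y') \<in> uea_ideal"
    unfolding uea_cong_def by (intro uea_ideal_add uea_ideal_uminus)
  moreover have "(x - x') + - (y - y') = (x - y) - (x' - y')"
    by simp
  ultimately show "uea_cong (x - y) (x' - y')"
    unfolding uea_cong_def by (simp only:)
qed
lift_definition times_uea :: "('a, 'b) uea \<Rightarrow> ('a, 'b) uea \<Rightarrow> ('a, 'b) uea" is "(*)"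
proof -
  fix x x' y y' :: "('a, 'b) tensor"
  assume "uea_cong x x'" "uea_cong y y'"
  then have "(x - x') * y + x' * (y - y') \<in> uea_ideal"
    unfolding uea_cong_def
    by (intro uea_ideal_add uea_ideal_mult_left uea_ideal_mult_right)
  moreover have "(x - x') * y + x' * (y - y') = x * y - x' * y'"
    by (simp add: algebra_simps)
  ultimately show "uea_cong (x * y) (x' * y')"
    unfolding uea_cong_def by (simp only:)
qed

instance
proof
  show "(0 :: ('a, 'b) uea) \<noteq> 1"
  proof (transfer, unfold uea_cong_def, rule notI)
    assume "(0 :: ('a, 'b) tensor) - 1 \<in> uea_ideal"
    from lookup_uea_ideal_Nil[OF this] show False
      by (simp add: lookup_minus lookup_one zero_list_def)
  qed
qed (transfer; simp add: uea_cong_def uea_ideal.zero algebra_simps)+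

end

lift_definition e_unit :: "'m + 'n \<Rightarrow> 'm + 'n \<Rightarrow> ('m, 'n) uea" is tgen .

text \<open>The structure map of the complex algebra U(g): \<open>scal c\<close> is \<open>c \<cdot> 1\<close>.\<close>

lift_definition scal :: "complex \<Rightarrow> ('m, 'n) uea" is "\<lambda>c. Poly_Mapping.single 0 c" .

lemma e_unit_relation:
  "e_unit i j * e_unit k l - super_sign i j k l * (e_unit k l * e_unit i j) =
     (if j = k then e_unit i l else 0) - super_sign i j k l * (if i = l then e_unit k j else 0)"
proof -
  have *: "abs_uea (super_sign i j k l) = super_sign i j k l"
    by (simp add: super_sign_def flip: one_uea.abs_eq uminus_uea.abs_eq)
  have "uea_cong (tgen i j * tgen k l - super_sign i j k l * (tgen k l * tgen i j))
    ((if j = k then tgen i l else 0) - super_sign i j k l * (if i = l then tgen k j else 0))"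
    using uea_ideal.step[OF uea_ideal.zero, of 1 i j k l 1]
    by (simp add: uea_cong_def uea_relator_def)
  then have "abs_uea (tgen i j * tgen k l - super_sign i j k l * (tgen k l * tgen i j)) =
    abs_uea ((if j = k then tgen i l else 0) - super_sign i j k l * (if i = l then tgen k j else 0))"
    by (simp only: uea.abs_eq_iff)
  then show ?thesis
    by (simp only: e_unit.abs_eq zero_uea.abs_eq if_distrib[of abs_uea] *
        flip: minus_uea.abs_eq times_uea.abs_eq)
qed

inductive_set subalgebra :: "('m, 'n) uea set \<Rightarrow> ('m, 'n) uea set" for S where
  gen: "x \<in> S \<Longrightarrow> x \<in> subalgebra S"
| scal: "scal c \<in> subalgebra S"
| add: "x \<in> subalgebra S \<Longrightarrow> y \<in> subalgebra S \<Longrightarrow> x + y \<in> subalgebra S"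
| mult: "x \<in> subalgebra S \<Longrightarrow> y \<in> subalgebra S \<Longrightarrow> x * y \<in> subalgebra S"

text \<open>The left ideal \<open>U(g) S\<close> generated by \<open>S\<close>.\<close>

inductive_set left_ideal :: "('m, 'n) uea set \<Rightarrow> ('m, 'n) uea set" for S where
  zero: "0 \<in> left_ideal S"
| step: "s \<in> S \<Longrightarrow> x \<in> left_ideal S \<Longrightarrow> u * s + x \<in> left_ideal S"

definition U_h :: "('m, 'n) uea set" where
  "U_h = subalgebra {e_unit i i |i. True}"

definition U_b_minus :: "('m::linorder, 'n::linorder) uea set" where
  "U_b_minus = subalgebra {e_unit i j |i j. i = j \<or> j \<prec> i}"

definition n_plus_units :: "('m::linorder, 'n::linorder) uea set" where
  "n_plus_units = {e_unit i j |i j. i \<prec> j}"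


section \<open>Weights and roots\<close>

text \<open>
  A functional \<open>\<lambda>\<close> on the diagonal subalgebra is given by its values \<open>\<lambda> i\<close> on $e_{i,i}$.
  The root of the matrix unit $e_{i,j}$ is represented by the pair \<open>(i, j)\<close>; \<open>wt (i, j)\<close> is the
  root itself, as a functional.
\<close>

type_synonym ('m, 'n) weight = "'m + 'n \<Rightarrow> complex"
type_synonym ('m, 'n) root = "('m + 'n) \<times> ('m + 'n)"

definition wt :: "('m, 'n) root \<Rightarrow> ('m, 'n) weight" where
  "wt \<alpha> = (\<lambda>k. of_bool (k = fst \<alpha>) - of_bool (k = snd \<alpha>))"

definition form :: "('m::finite, 'n::finite) weight \<Rightarrow> ('m, 'n) weight \<Rightarrow> complex" where
  "form \<mu> \<nu> = (\<Sum>r\<in>UNIV. \<mu> (Inl r) * \<nu> (Inl r)) - (\<Sum>s\<in>UNIV. \<mu> (Inr s) * \<nu> (Inr s))"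

definition pos_roots :: "('m::linorder, 'n::linorder) root set" where
  "pos_roots = {(i, j). i \<prec> j}"

definition even_pos_roots :: "('m::linorder, 'n::linorder) root set" where
  "even_pos_roots = {\<alpha> \<in> pos_roots. even_pair \<alpha>}"

definition odd_pos_roots :: "('m::linorder, 'n::linorder) root set" where
  "odd_pos_roots = {\<alpha> \<in> pos_roots. \<not> even_pair \<alpha>}"

definition simple_roots :: "('m::linorder, 'n::linorder) root set" where
  "simple_roots = {\<alpha> \<in> pos_roots. \<not> (\<exists>\<beta>\<in>pos_roots. \<exists>\<gamma>\<in>pos_roots. \<forall>k. wt \<alpha> k = wt \<beta> k + wt \<gamma> k)}"

definition rho :: "('m::{finite,linorder}, 'n::{finite,linorder}) weight" where
  "rho k = (\<Sum>\<alpha>\<in>even_pos_roots. wt \<alpha> k) / 2 - (\<Sum>\<alpha>\<in>odd_pos_roots. wt \<alpha> k) / 2"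

definition coroot :: "('m::finite, 'n::finite) root \<Rightarrow> ('m, 'n) weight" where
  "coroot \<alpha> = (\<lambda>k. 2 * wt \<alpha> k / form (wt \<alpha>) (wt \<alpha>))"

definition reflection ::
    "('m::finite, 'n::finite) root \<Rightarrow> ('m, 'n) weight \<Rightarrow> ('m, 'n) weight" where
  "reflection \<alpha> \<mu> = (\<lambda>k. \<mu> k - form \<mu> (coroot \<alpha>) * wt \<alpha> k)"

text \<open>
  The element $h_\mu$ of the diagonal subalgebra with $\nu(h_\mu) = (\mu,\nu)$ for all $\nu$; the
  minus sign in the second block comes from the form.
\<close>

definition h_elem :: "('m::finite, 'n::finite) weight \<Rightarrow> ('m, 'n) uea" where
  "h_elem \<mu> = (\<Sum>r\<in>UNIV. scal (\<mu> (Inl r)) * e_unit (Inl r) (Inl r))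
              - (\<Sum>s\<in>UNIV. scal (\<mu> (Inr s)) * e_unit (Inr s) (Inr s))"


section \<open>Isotropic roots orthogonal to a weight\<close>

definition B_set ::
    "('m::{finite,linorder}, 'n::{finite,linorder}) weight \<Rightarrow> ('m, 'n) root set" where
  "B_set lam = {\<gamma> \<in> odd_pos_roots. form (\<lambda>k. lam k + rho k) (wt \<gamma>) = 0}"

text \<open>\<open>tri lam \<gamma>' \<gamma>\<close> is the relation $\gamma' \triangleleft \gamma$ on $B(\lambda)$.\<close>

definition tri ::
    "('m::{finite,linorder}, 'n::{finite,linorder}) weight \<Rightarrow> ('m, 'n) root \<Rightarrow> ('m, 'n) root \<Rightarrow> bool"
  where
  "tri lam \<gamma>' \<gamma> \<longleftrightarrow> \<gamma>' \<in> B_set lam \<and> \<gamma> \<in> B_set lam \<and>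
     (\<exists>\<alpha>\<in>even_pos_roots. (\<forall>k. wt \<gamma> k - wt \<gamma>' k = wt \<alpha> k) \<and>
        form (\<lambda>k. lam k + rho k) (coroot \<alpha>) = 0 \<and> reflection \<alpha> (wt \<gamma>) = wt \<gamma>')"

definition lambda_minimal ::
    "('m::{finite,linorder}, 'n::{finite,linorder}) weight \<Rightarrow> ('m, 'n) root \<Rightarrow> bool" where
  "lambda_minimal lam \<gamma> \<longleftrightarrow> (\<forall>\<gamma>'\<in>B_set lam. (tri lam)\<^sup>*\<^sup>* \<gamma>' \<gamma> \<longrightarrow> \<gamma>' = \<gamma>)"


section \<open>Shapovalov elements\<close>

definition partitions ::
    "('m::linorder, 'n::linorder) root \<Rightarrow> (('m, 'n) root \<Rightarrow> nat) set" where
  "partitions \<gamma> = {\<pi>. (\<forall>\<alpha>. \<alpha> \<notin> pos_roots \<longrightarrow> \<pi> \<alpha> = 0) \<and> (\<forall>\<alpha>\<in>odd_pos_roots. \<pi> \<alpha> \<le> 1) \<and>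
     (\<forall>k. (\<Sum>\<alpha>\<in>pos_roots. of_nat (\<pi> \<alpha>) * wt \<alpha> k) = wt \<gamma> k)}"

lemma prec_trans: "i \<prec> j \<Longrightarrow> j \<prec> k \<Longrightarrow> i \<prec> k"
  by (cases i; cases j; cases k) auto

lemma prec_irrefl: "\<not> i \<prec> i"
  by (cases i) auto

lemma finite_partitions:
  fixes \<gamma> :: "('m::{finite,linorder}, 'n::{finite,linorder}) root"
  shows "finite (partitions \<gamma>)"
proof -
  define rank :: "'m + 'n \<Rightarrow> nat" where "rank k = card {l. l \<prec> k}" for k
  have rank: "rank i < rank j" if "i \<prec> j" for i j
  proof -
    have "{l. l \<prec> i} \<subseteq> {l. l \<prec> j}"
      using that prec_trans by blast
    moreover have "i \<in> {l. l \<prec> j} - {l. l \<prec> i}"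
      using that prec_irrefl by blast
    ultimately have "{l. l \<prec> i} \<subset> {l. l \<prec> j}"
      by blast
    then show ?thesis
      unfolding rank_def by (intro psubset_card_mono) simp_all
  qed
  define ht :: "('m, 'n) root \<Rightarrow> real" where "ht \<alpha> = real (rank (snd \<alpha>)) - real (rank (fst \<alpha>))" for \<alpha>
  have ht1: "ht \<alpha> \<ge> 1" if "\<alpha> \<in> pos_roots" for \<alpha>
    using that rank[of "fst \<alpha>" "snd \<alpha>"] by (auto simp: ht_def pos_roots_def)
  have ht_wt: "(\<Sum>k\<in>UNIV. wt \<alpha> k * of_nat (rank k)) = - complex_of_real (ht \<alpha>)" for \<alpha> :: "('m, 'n) root"
  proof -
    have "wt \<alpha> k * of_nat (rank k) = (if k = fst \<alpha> then of_nat (rank k) else 0)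
        - (if k = snd \<alpha> then of_nat (rank k) else 0)" for k
      by (simp add: wt_def)
    then show ?thesis
      by (simp add: sum_subtractf ht_def)
  qed
  have bound: "real (\<pi> \<alpha>) \<le> ht \<gamma>" if \<pi>: "\<pi> \<in> partitions \<gamma>" and \<alpha>: "\<alpha> \<in> pos_roots" for \<pi> \<alpha>
  proof -
    have "- complex_of_real (ht \<gamma>)
        = (\<Sum>k\<in>UNIV. (\<Sum>\<beta>\<in>pos_roots. of_nat (\<pi> \<beta>) * wt \<beta> k) * of_nat (rank k))"
      using \<pi> by (simp add: partitions_def flip: ht_wt)
    also have "\<dots> = (\<Sum>\<beta>\<in>pos_roots. of_nat (\<pi> \<beta>) * (\<Sum>k\<in>UNIV. wt \<beta> k * of_nat (rank k)))"
      unfolding sum_distrib_left sum_distrib_right by (subst sum.swap) (simp add: mult.assoc)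
    also have "\<dots> = - complex_of_real (\<Sum>\<beta>\<in>pos_roots. real (\<pi> \<beta>) * ht \<beta>)"
      by (simp add: ht_wt sum_negf)
    finally have "ht \<gamma> = (\<Sum>\<beta>\<in>pos_roots. real (\<pi> \<beta>) * ht \<beta>)"
      by (simp only: neg_equal_iff_equal of_real_eq_iff)
    moreover have "real (\<pi> \<alpha>) * ht \<alpha> \<le> (\<Sum>\<beta>\<in>pos_roots. real (\<pi> \<beta>) * ht \<beta>)"
      using \<alpha> by (intro member_le_sum) (auto dest: ht1)
    moreover have "real (\<pi> \<alpha>) * 1 \<le> real (\<pi> \<alpha>) * ht \<alpha>"
      using ht1[OF \<alpha>] by (intro mult_left_mono) auto
    ultimately show ?thesis by simp
  qed
  have "\<pi> \<alpha> \<le> nat \<lceil>ht \<gamma>\<rceil>" if "\<pi> \<in> partitions \<gamma>" for \<pi> \<alpha>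
  proof (cases "\<alpha> \<in> pos_roots")
    case True
    from bound[OF that this] show ?thesis by linarith
  next
    case False
    with that have "\<pi> \<alpha> = 0" unfolding partitions_def by blast
    then show ?thesis by simp
  qed
  then have "partitions \<gamma> \<subseteq> {\<pi>. \<forall>\<alpha>. (\<alpha> \<in> UNIV \<longrightarrow> \<pi> \<alpha> \<in> {..nat \<lceil>ht \<gamma>\<rceil>}) \<and> (\<alpha> \<notin> UNIV \<longrightarrow> \<pi> \<alpha> = 0)}"
    by auto
  then show ?thesis
    by (rule finite_subset) (intro finite_set_of_finite_funs; simp)
qed

text \<open>The list \<open>rs\<close> enumerates the positive roots in the chosen order.\<close>

definition e_neg :: "('m, 'n) root list \<Rightarrow> (('m, 'n) root \<Rightarrow> nat) \<Rightarrow> ('m, 'n) uea" where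
  "e_neg rs \<pi> = prod_list (map (\<lambda>\<alpha>. e_unit (snd \<alpha>) (fst \<alpha>) ^ \<pi> \<alpha>) rs)"

definition shapovalov ::
    "('m::{finite,linorder}, 'n::{finite,linorder}) root list \<Rightarrow> ('m, 'n) root \<Rightarrow> ('m, 'n) uea \<Rightarrow> bool"
  where
  "shapovalov rs \<gamma> \<theta> \<longleftrightarrow>
     \<theta> \<in> U_b_minus \<and>
     (\<forall>i. e_unit i i * \<theta> - \<theta> * e_unit i i = scal (- wt \<gamma> i) * \<theta>) \<and>
     (\<exists>H. (\<forall>\<pi>\<in>partitions \<gamma>. H \<pi> \<in> U_h) \<and>
          (\<forall>\<pi>\<in>partitions \<gamma>. (\<forall>\<alpha>. \<alpha> \<notin> simple_roots \<longrightarrow> \<pi> \<alpha> = 0) \<longrightarrow> H \<pi> = 1) \<and>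
          \<theta> = (\<Sum>\<pi>\<in>partitions \<gamma>. e_neg rs \<pi> * H \<pi>)) \<and>
     (\<forall>(i, j)\<in>pos_roots. \<exists>u. \<exists>y\<in>left_ideal n_plus_units.
          e_unit i j * \<theta> = u * (h_elem (wt \<gamma>) + scal (form rho (wt \<gamma>))) + y)"


section \<open>Verma modules\<close>

text \<open>
  $M(\lambda) = U(g) / J(\lambda)$ with $J(\lambda)$ the left ideal generated by $n^+$ and all
  $h - \lambda(h)$. Its elements are the cosets \<open>vcoset lam x\<close> of $J(\lambda)$, and $v_\lambda$ is
  the coset of 1.
\<close>

definition verma_ideal :: "('m::linorder, 'n::linorder) weight \<Rightarrow> ('m, 'n) uea set" where
  "verma_ideal lam = left_ideal (n_plus_units \<union> {e_unit i i - scal (lam i) |i. True})"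

definition vcoset :: "('m::linorder, 'n::linorder) weight \<Rightarrow> ('m, 'n) uea \<Rightarrow> ('m, 'n) uea set" where
  "vcoset lam x = {x + j |j. j \<in> verma_ideal lam}"

definition verma :: "('m::linorder, 'n::linorder) weight \<Rightarrow> ('m, 'n) uea set set" where
  "verma lam = range (vcoset lam)"

definition vadd :: "('m, 'n) uea set \<Rightarrow> ('m, 'n) uea set \<Rightarrow> ('m, 'n) uea set" where
  "vadd X Y = {x + y |x y. x \<in> X \<and> y \<in> Y}"

definition vact ::
    "('m::linorder, 'n::linorder) weight \<Rightarrow> ('m, 'n) uea \<Rightarrow> ('m, 'n) uea set \<Rightarrow> ('m, 'n) uea set" where
  "vact lam u X = {u * x + j |x j. x \<in> X \<and> j \<in> verma_ideal lam}"

definition hwv :: "('m::linorder, 'n::linorder) weight \<Rightarrow> ('m, 'n) uea set" where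
  "hwv lam = vcoset lam 1"

lemma left_ideal_add: "x \<in> left_ideal S \<Longrightarrow> y \<in> left_ideal S \<Longrightarrow> x + y \<in> left_ideal S"
proof (induction rule: left_ideal.induct)
  case (step s x u)
  then have "u * s + (x + y) \<in> left_ideal S"
    by (intro left_ideal.step)
  then show ?case by (simp only: add.assoc)
qed simp

lemma left_ideal_mult: "x \<in> left_ideal S \<Longrightarrow> u * x \<in> left_ideal S"
proof (induction rule: left_ideal.induct)
  case (step s x v)
  then show ?case
    using left_ideal.step[of s S "u * x" "u * v"] by (simp add: algebra_simps)
qed (simp add: left_ideal.zero)

lemma left_ideal_uminus: "x \<in> left_ideal S \<Longrightarrow> - x \<in> left_ideal S"
  using left_ideal_mult[of x S "- 1"] by simp

lemma vcoset_eq_iff: "vcoset lam x = vcoset lam y \<longleftrightarrow> x - y \<in> verma_ideal lam"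
proof
  assume "vcoset lam x = vcoset lam y"
  moreover have "x \<in> vcoset lam x"
    unfolding vcoset_def verma_ideal_def
    by (auto intro!: exI[of _ 0] left_ideal.zero)
  ultimately show "x - y \<in> verma_ideal lam"
    by (auto simp: vcoset_def)
next
  have *: "vcoset lam x \<subseteq> vcoset lam y" if "x - y \<in> verma_ideal lam" for x y
  proof
    fix z assume "z \<in> vcoset lam x"
    then obtain j where "z = x + j" "j \<in> verma_ideal lam"
      by (auto simp: vcoset_def)
    then have "z = y + ((x - y) + j)" "(x - y) + j \<in> verma_ideal lam"
      using that unfolding verma_ideal_def by (simp_all add: left_ideal_add)
    then show "z \<in> vcoset lam y"
      unfolding vcoset_def by blast
  qed
  assume "x - y \<in> verma_ideal lam"
  moreover from this have "y - x \<in> verma_ideal lam"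
    using left_ideal_uminus[of "x - y"] by (simp add: verma_ideal_def)
  ultimately show "vcoset lam x = vcoset lam y"
    using * by blast
qed

lemma vact_vcoset: "vact lam u (vcoset lam x) = vcoset lam (u * x)"
proof (rule set_eqI, rule iffI)
  fix z assume "z \<in> vact lam u (vcoset lam x)"
  then obtain j k where "z = u * (x + j) + k" "j \<in> verma_ideal lam" "k \<in> verma_ideal lam"
    by (auto simp: vact_def vcoset_def)
  then have "z = u * x + (u * j + k)" "u * j + k \<in> verma_ideal lam"
    unfolding verma_ideal_def
    by (simp_all only: distrib_left add.assoc left_ideal_add left_ideal_mult)
  then show "z \<in> vcoset lam (u * x)"
    unfolding vcoset_def by blast
next
  fix z assume "z \<in> vcoset lam (u * x)"
  then obtain k where "z = u * (x + 0) + k" "k \<in> verma_ideal lam"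
    by (auto simp: vcoset_def)
  moreover have "0 \<in> verma_ideal lam"
    by (simp add: verma_ideal_def left_ideal.zero)
  ultimately show "z \<in> vact lam u (vcoset lam x)"
    unfolding vact_def vcoset_def by blast
qed

lemma vadd_vcoset: "vadd (vcoset lam x) (vcoset lam y) = vcoset lam (x + y)"
proof (rule set_eqI, rule iffI)
  fix z assume "z \<in> vadd (vcoset lam x) (vcoset lam y)"
  then obtain j k where "z = (x + j) + (y + k)" "j \<in> verma_ideal lam" "k \<in> verma_ideal lam"
    by (auto simp: vadd_def vcoset_def)
  then have "z = (x + y) + (j + k)" "j + k \<in> verma_ideal lam"
    unfolding verma_ideal_def by (simp_all add: left_ideal_add)
  then show "z \<in> vcoset lam (x + y)"
    unfolding vcoset_def by blast
next
  fix z assume "z \<in> vcoset lam (x + y)"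
  then obtain k where "z = (x + 0) + (y + k)" "k \<in> verma_ideal lam"
    by (auto simp: vcoset_def algebra_simps)
  moreover have "0 \<in> verma_ideal lam"
    by (simp add: verma_ideal_def left_ideal.zero)
  ultimately show "z \<in> vadd (vcoset lam x) (vcoset lam y)"
    unfolding vadd_def vcoset_def by blast
qed

text \<open>The submodule $\sum_{X \in S} U(g) X$ of $M(\lambda)$.\<close>

inductive_set vspan ::
    "('m::linorder, 'n::linorder) weight \<Rightarrow> ('m, 'n) uea set set \<Rightarrow> ('m, 'n) uea set set"
  for lam S where
  zero: "vcoset lam 0 \<in> vspan lam S"
| step: "X \<in> S \<Longrightarrow> Y \<in> vspan lam S \<Longrightarrow> vadd (vact lam u X) Y \<in> vspan lam S"

text \<open>Independence of \<open>\<gamma>\<close> at \<open>lam\<close>, for a given choice \<open>\<theta>\<close> of Shapovalov elements.\<close>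

definition independent_at ::
    "(('m::{finite,linorder}, 'n::{finite,linorder}) root \<Rightarrow> ('m, 'n) uea) \<Rightarrow>
     ('m, 'n) weight \<Rightarrow> ('m, 'n) root \<Rightarrow> bool" where
  "independent_at \<theta> lam \<gamma> \<longleftrightarrow>
     vact lam (\<theta> \<gamma>) (hwv lam) \<notin>
       vspan lam ((\<lambda>\<gamma>'. vact lam (\<theta> \<gamma>') (hwv lam)) ` (B_set lam - {\<gamma>}))"

end

theory Submission
  imports Defs "HOL-Library.Nat_Bijection"
begin

text \<open>
  Number the indices by \<open>0, \<dots>, m + n - 1\<close>. For \<open>\<gamma> = (j, N)\<close> the vector $\theta_\gamma v_\lambda$ is a
  ``chain'': $\sum_{k > j} e_{k,j} y_k$ with each $y_k$ again a chain from \<open>k\<close> to \<open>N\<close>. In a module where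
  $\sum_k e_{k,j} u_k v = 0$ with $u_k \in U(gl_{>j})$ forces $u_k v = 0$, a chain killed by all $e_{i,l}$ with
  \<open>j < i < l\<close> is determined by the coefficient of the product of the simple root vectors, because
  $y_l = \pm e_{i,l} y_i$. Applied to the pieces $y_k$ themselves, this uniqueness shows that the chain of
  $\theta_\gamma$ factors through that of $\theta_{\gamma'}$ whenever \<open>\<gamma>' = (r, N)\<close> with \<open>j < r\<close> lies in
  $B(\lambda)$; the other kind of $\gamma' \triangleleft \gamma$ is reduced to this one by the negative supertranspose
  combined with reversal of the order. So non-minimal roots are dependent.

  A module with the required freeness and with highest weight \<open>\<lambda>\<close> is found in the Fock space of \<open>m + n\<close>
  copies of the natural representation, where $e_{i,j}$ acts as $\sum_p x_{i,p} \partial_{j,p}$.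

  If \<open>\<gamma>\<close> is minimal, then $U(g) \theta_{\gamma'} v_\lambda$ is spanned by products of lowering operators applied to
  $\theta_{\gamma'} v_\lambda$. Those of weight $\lambda - \gamma$ only involve even root vectors, and by minimality the
  quadratic Casimir element of $gl_m$ has on them an eigenvalue different from that on $\theta_\gamma v_\lambda$.
  As $\theta_\gamma v_\lambda \neq 0$, it cannot be a sum of such vectors.
\<close>

section \<open>Chains of lowering operators\<close>

text \<open>The delicate point is the return from the Fock module to M(\<lambda>). The Fock module
  only yields a left ideal \<open>J\<close> that contains the Verma ideal and is free in the stated
  sense; no PBW basis of U(g) enters. But a chain lying in \<open>J\<close> is already zero in U(g):
  freeness applies layer by layer until only scalars are left, and \<open>J\<close> contains no
  nonzero scalar. So a factorisation of chains found modulo \<open>J\<close> is an identity in U(g)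
  and holds in M(\<lambda>) too. The same fact shows that \<theta>_\<gamma> v_\<lambda> is nonzero,
  because the coefficient of the simple word is. The Casimir element has to be that of gl_m, since
  central elements of U(g) act on all of M(\<lambda>) by one scalar. The price is that it commutes
  with even root vectors only, so weights must first exclude words with odd letters. For \<gamma> =
  \<epsilon>_r - \<delta>_s its eigenvalue on \<theta>_\<gamma> v_\<lambda> is -2 (\<lambda> +
  \<rho>)(e_{r,r}) plus a constant that does not depend on \<gamma>; this is how minimality, a
  condition on values of \<lambda> + \<rho>, enters.\<close>

definition ssign :: "(nat \<Rightarrow> bool) \<Rightarrow> nat \<Rightarrow> nat \<Rightarrow> nat \<Rightarrow> nat \<Rightarrow> 'r::ring_1" where
  "ssign par i j k l = (if par i \<noteq> par j \<and> par k \<noteq> par l then - 1 else 1)"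

definition gl_relations :: "nat \<Rightarrow> (nat \<Rightarrow> bool) \<Rightarrow> (nat \<Rightarrow> nat \<Rightarrow> 'r::ring_1) \<Rightarrow> bool" where
  "gl_relations n par E \<longleftrightarrow> (\<forall>i<n. \<forall>j<n. \<forall>k<n. \<forall>l<n.
     E i j * E k l = ssign par i j k l * (E k l * E i j)
       + ((if j = k then E i l else 0) - ssign par i j k l * (if i = l then E k j else 0)))"

lemma gl_relationsD:
  "gl_relations n par E \<Longrightarrow> i < n \<Longrightarrow> j < n \<Longrightarrow> k < n \<Longrightarrow> l < n \<Longrightarrow>
     E i j * E k l = ssign par i j k l * (E k l * E i j)
       + ((if j = k then E i l else 0) - ssign par i j k l * (if i = l then E k j else 0))"
  unfolding gl_relations_def by blast

text \<open>The complex structure of a ring is encoded as a central ring homomorphism, so that the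
  same lemmas serve U(g) with \<open>scal\<close> and operators on Fock space with
  \<open>esc\<close>.\<close>

locale scalars =
  fixes sc :: "complex \<Rightarrow> 'r::ring_1"
  assumes sc_1: "sc 1 = 1"
    and sc_add: "sc (a + b) = sc a + sc b"
    and sc_mult: "sc (a * b) = sc a * sc b"
    and sc_central: "sc a * x = x * sc a"
begin

lemma sc_0: "sc 0 = 0"
  using sc_add[of 0 0] by simp

lemma sc_uminus: "sc (- a) = - sc a"
  using sc_add[of a "- a"] by (simp add: sc_0 eq_neg_iff_add_eq_0 add.commute)

lemma sc_diff: "sc (a - b) = sc a - sc b"
  using sc_add[of a "- b"] by (simp add: sc_uminus)

lemma sc_sum: "sc (sum f A) = (\<Sum>x\<in>A. sc (f x))"
  by (induction A rule: infinite_finite_induct) (simp_all add: sc_0 sc_add)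

lemma sc_left_commute: "x * (sc a * y) = sc a * (x * y)"
  by (metis mult.assoc sc_central)

lemma ssign_eq_sc: "ssign par i j k l = sc (ssign par i j k l)"
  by (simp add: ssign_def sc_1 sc_uminus)

lemma ssign_left_commute: "x * (ssign par i j k l * y) = ssign par i j k l * (x * y)"
  by (simp add: ssign_def)

lemma ssign_ssign: "ssign par i j k l * (ssign par i j k l * y) = y"
  by (simp add: ssign_def)

end

text \<open>The image of U(gl) on the indices above \<open>j\<close>. It is generated by left
  multiplication with one generator at a time, so that an induction can peel off the leftmost factor
  acting on a vector.\<close>

inductive_set upper_subalgebra ::
    "(complex \<Rightarrow> 'r) \<Rightarrow> (nat \<Rightarrow> nat \<Rightarrow> 'r::ring_1) \<Rightarrow> nat \<Rightarrow> nat \<Rightarrow> 'r set" for sc E n j where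
  sc: "sc c \<in> upper_subalgebra sc E n j"
| add: "x \<in> upper_subalgebra sc E n j \<Longrightarrow> y \<in> upper_subalgebra sc E n j \<Longrightarrow> x + y \<in> upper_subalgebra sc E n j"
| mult: "j < a \<Longrightarrow> j < b \<Longrightarrow> a < n \<Longrightarrow> b < n \<Longrightarrow> x \<in> upper_subalgebra sc E n j \<Longrightarrow>
    E a b * x \<in> upper_subalgebra sc E n j"

text \<open>In \<open>chain sc E N j x c\<close> the scalar \<open>c\<close> is the coefficient of
  \<open>E (j + 1) j * E (j + 2) (j + 1) * \<dots> * E N (N - 1)\<close> in \<open>x\<close>.\<close>

inductive chain ::
    "(complex \<Rightarrow> 'r) \<Rightarrow> (nat \<Rightarrow> nat \<Rightarrow> 'r::ring_1) \<Rightarrow> nat \<Rightarrow> nat \<Rightarrow> 'r \<Rightarrow> complex \<Rightarrow> bool"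
  for sc E N where
  base: "chain sc E N N (sc c) c"
| step: "j < N \<Longrightarrow> (\<And>k. j < k \<Longrightarrow> k \<le> N \<Longrightarrow> chain sc E N k (y k) (c k)) \<Longrightarrow>
    chain sc E N j (\<Sum>k\<in>{j<..N}. E k j * y k) (c (Suc j))"

definition word :: "(nat \<Rightarrow> nat \<Rightarrow> 'r::ring_1) \<Rightarrow> (nat \<times> nat) list \<Rightarrow> 'r" where
  "word E ws = prod_list (map (\<lambda>(a, b). E a b) ws)"

definition lower_word :: "nat \<Rightarrow> (nat \<times> nat) list \<Rightarrow> bool" where
  "lower_word n ws \<longleftrightarrow> (\<forall>(a, b)\<in>set ws. b < a \<and> a < n)"

definition simple_word :: "(nat \<times> nat) list \<Rightarrow> bool" where
  "simple_word ws \<longleftrightarrow> (\<forall>(a, b)\<in>set ws. a = Suc b)"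

text \<open>Lowering weights: \<open>wt_word ws\<close> is minus the weight of \<open>word E ws\<close>.\<close>

definition wt_word :: "(nat \<times> nat) list \<Rightarrow> nat \<Rightarrow> int" where
  "wt_word ws k = (\<Sum>(a, b)\<leftarrow>ws. of_bool (k = b) - of_bool (k = a))"

definition path_wt :: "nat \<Rightarrow> nat \<Rightarrow> nat \<Rightarrow> int" where
  "path_wt j N k = of_bool (k = j) - of_bool (k = N)"

text \<open>No letter has the least lower index as its upper index, so nothing cancels there. This
  locates and counts the letters that start at \<open>j\<close>.\<close>

lemma wt_word_least:
  "\<forall>(a, b)\<in>set ws. b < a \<and> j \<le> b \<Longrightarrow> wt_word ws j = int (length (filter (\<lambda>(a, b). b = j) ws))"
  by (induction ws) (auto simp: wt_word_def)

text \<open>\<open>J\<close> plays the role of the annihilator of a highest weight vector. For a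
  Verma module \<open>free\<close> would follow from the PBW theorem; \<open>J_proper\<close> ends
  the induction in \<open>chain_in_J\<close>.\<close>

locale free_gl = scalars sc
  for sc :: "complex \<Rightarrow> 'r::ring_1" +
  fixes E :: "nat \<Rightarrow> nat \<Rightarrow> 'r" and n :: nat and par :: "nat \<Rightarrow> bool" and J :: "'r set"
  assumes rel: "gl_relations n par E"
    and J_0: "0 \<in> J"
    and J_add: "x \<in> J \<Longrightarrow> y \<in> J \<Longrightarrow> x + y \<in> J"
    and J_mult: "x \<in> J \<Longrightarrow> z * x \<in> J"
    and J_proper: "sc c \<in> J \<Longrightarrow> c = 0"
    and free: "j < n \<Longrightarrow> (\<And>k. u k \<in> upper_subalgebra sc E n j) \<Longrightarrow>
      (\<Sum>k\<in>{j<..<n}. E k j * u k) \<in> J \<Longrightarrow> j < k \<Longrightarrow> k < n \<Longrightarrow> u k \<in> J"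
begin

lemma sc_upper: "x \<in> upper_subalgebra sc E n j \<Longrightarrow> sc c * x \<in> upper_subalgebra sc E n j"
  by (induction rule: upper_subalgebra.induct)
     (auto simp: distrib_left sc_left_commute[symmetric] sc_mult[symmetric]
       intro: upper_subalgebra.intros)

lemma ssign_upper:
  "x \<in> upper_subalgebra sc E n j \<Longrightarrow> ssign par a b k l * x \<in> upper_subalgebra sc E n j"
  using sc_upper[of x j "ssign par a b k l"] by (simp flip: ssign_eq_sc)

lemma zero_upper: "0 \<in> upper_subalgebra sc E n j"
  using upper_subalgebra.sc[of sc 0] by (simp add: sc_0)

lemma sum_upper:
  "(\<And>k. k \<in> A \<Longrightarrow> u k \<in> upper_subalgebra sc E n j) \<Longrightarrow> sum u A \<in> upper_subalgebra sc E n j"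
  by (induction A rule: infinite_finite_induct) (auto intro: zero_upper upper_subalgebra.add)

lemma J_uminus: "x \<in> J \<Longrightarrow> - x \<in> J"
  using J_mult[of x "- 1"] by simp

lemma J_diff: "x \<in> J \<Longrightarrow> y \<in> J \<Longrightarrow> x - y \<in> J"
  using J_add[of x "- y"] by (simp add: J_uminus)

lemma J_sum: "(\<And>k. k \<in> A \<Longrightarrow> f k \<in> J) \<Longrightarrow> sum f A \<in> J"
  by (induction A rule: infinite_finite_induct) (auto intro: J_0 J_add)

context
  fixes N :: nat
  assumes N: "N < n"
begin

lemma free_upto:
  assumes "j < N" "\<And>k. j < k \<Longrightarrow> k \<le> N \<Longrightarrow> u k \<in> upper_subalgebra sc E n j"
    "(\<Sum>k\<in>{j<..N}. E k j * u k) \<in> J" "j < k" "k \<le> N"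
  shows "u k \<in> J"
proof -
  let ?u = "\<lambda>k. if j < k \<and> k \<le> N then u k else 0"
  have "(\<Sum>k\<in>{j<..<n}. E k j * ?u k) = (\<Sum>k\<in>{j<..N}. E k j * ?u k)"
    using N by (intro sum.mono_neutral_right) auto
  also have "\<dots> = (\<Sum>k\<in>{j<..N}. E k j * u k)"
    by (intro sum.cong) auto
  finally have "?u k \<in> J"
    using assms N by (intro free[of j ?u k]) (auto intro: zero_upper)
  then show ?thesis using assms by simp
qed

lemma chain_le: "chain sc E N j x c \<Longrightarrow> j \<le> N"
  by (induction rule: chain.induct) auto

lemma chain_NE:
  assumes "chain sc E N N x c" shows "x = sc c"
  using assms by cases auto

lemma chain_stepD:
  assumes "chain sc E N j x c" "j < N"
  shows "\<exists>y d. (\<forall>k. j < k \<longrightarrow> k \<le> N \<longrightarrow> chain sc E N k (y k) (d k)) \<and>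
    x = (\<Sum>k\<in>{j<..N}. E k j * y k) \<and> c = d (Suc j)"
  using assms by cases blast+

lemma chain_upper: "chain sc E N j x c \<Longrightarrow> i < j \<Longrightarrow> x \<in> upper_subalgebra sc E n i"
proof (induction rule: chain.induct)
  case (step j y c)
  show ?case
    using step N by (intro sum_upper upper_subalgebra.mult) auto
qed (auto intro: upper_subalgebra.intros)

lemma chain_add:
  "chain sc E N j x c \<Longrightarrow> chain sc E N j x' c' \<Longrightarrow> chain sc E N j (x + x') (c + c')"
proof (induction arbitrary: x' c' rule: chain.induct)
  case (base c)
  from chain_NE[OF this] have "sc c + x' = sc (c + c')"
    by (simp add: sc_add)
  then show ?case by (simp only: chain.base)
next
  case (step j y c)
  obtain y' d where y': "\<And>k. j < k \<Longrightarrow> k \<le> N \<Longrightarrow> chain sc E N k (y' k) (d k)"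
    "x' = (\<Sum>k\<in>{j<..N}. E k j * y' k)" "c' = d (Suc j)"
    using chain_stepD[OF step.prems step.hyps(1)] by blast
  have "chain sc E N j (\<Sum>k\<in>{j<..N}. E k j * (y k + y' k)) (c (Suc j) + d (Suc j))"
    using step y' by (intro chain.step[where c = "\<lambda>k. c k + d k"]) auto
  then show ?case by (simp add: y' distrib_left sum.distrib)
qed

lemma chain_sc: "chain sc E N j x c \<Longrightarrow> chain sc E N j (sc a * x) (a * c)"
proof (induction rule: chain.induct)
  case (base c)
  then show ?case
    using chain.base[of sc E N "a * c"] by (simp add: sc_mult)
next
  case (step j y c)
  have "chain sc E N j (\<Sum>k\<in>{j<..N}. E k j * (sc a * y k)) (a * c (Suc j))"
    using step by (intro chain.step[where c = "\<lambda>k. a * c k"]) auto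
  then show ?case by (simp add: sum_distrib_left sc_left_commute)
qed

lemma chain_zero: "j \<le> N \<Longrightarrow> chain sc E N j 0 0"
proof (induction "N - j" arbitrary: j rule: less_induct)
  case less
  show ?case
  proof (cases "j = N")
    case True
    then show ?thesis using chain.base[of sc E N 0] by (simp add: sc_0)
  next
    case False
    then have "chain sc E N j (\<Sum>k\<in>{j<..N}. E k j * 0) 0"
      using less by (intro chain.step[where c = "\<lambda>_. 0"]) auto
    then show ?thesis by simp
  qed
qed

lemma chain_sum:
  "finite A \<Longrightarrow> j \<le> N \<Longrightarrow> (\<And>a. a \<in> A \<Longrightarrow> chain sc E N j (f a) (c a)) \<Longrightarrow>
     chain sc E N j (sum f A) (sum c A)"
  by (induction A rule: finite_induct) (auto intro: chain_zero chain_add)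

text \<open>Freeness moves membership in \<open>J\<close> from the sum to every \<open>y k\<close>,
  and at the end of the chain only a scalar remains. The conclusion is an equality in the ring and
  not a congruence: all later identities between chains come from here.\<close>

lemma chain_in_J: "chain sc E N j x c \<Longrightarrow> x \<in> J \<Longrightarrow> x = 0 \<and> c = 0"
proof (induction rule: chain.induct)
  case (base c)
  then show ?case using J_proper sc_0 by auto
next
  case (step j y c)
  have "y k = 0 \<and> c k = 0" if "j < k" "k \<le> N" for k
    using step.IH[OF that] free_upto[OF step.hyps(1) _ step.prems that] chain_upper[OF step.hyps(2)]
    by blast
  then show ?case using step.hyps by (auto intro!: sum.neutral)
qed

text \<open>Moving \<open>E i l\<close> to the right past \<open>E k j\<close> leaves a single extra
  term, \<open>E i j * y l\<close> for k = l, because i differs from \<open>j\<close>. Collecting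
  the coefficient of each \<open>E k j\<close> and using freeness, every \<open>E i l * y k\<close>
  with k \<noteq> i lies in \<open>J\<close>, whereas k = i gives the relation y_l = \<plusminus> E
  i l y_i modulo \<open>J\<close>.\<close>

lemma raise_chain:
  assumes y: "\<And>k. j < k \<Longrightarrow> k \<le> N \<Longrightarrow> chain sc E N k (y k) (c k)"
    and il: "j < i" "i < l" "l \<le> N"
    and J: "E i l * (\<Sum>k\<in>{j<..N}. E k j * y k) \<in> J"
  shows "j < k \<Longrightarrow> k \<le> N \<Longrightarrow> k \<noteq> i \<Longrightarrow> E i l * y k \<in> J"
    and "E i l * y i \<in> J \<Longrightarrow> y l = 0"
proof -
  \<comment> \<open>The coefficient of \<open>E k j\<close> on the left once \<open>E i l\<close>
    has been moved through; its sign is the one from the supercommutator.\<close>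
  define u where "u k = ssign par i l k j * (E i l * y k) + (if k = i then y l else 0)" for k
  have u_up: "u k \<in> upper_subalgebra sc E n j" if "j < k" "k \<le> N" for k
    unfolding u_def
    using that il N chain_upper[OF y[OF that] that(1)] chain_upper[OF y[of l], of j]
    by (auto intro!: upper_subalgebra.intros(2,3) ssign_upper zero_upper)
  have "E i l * (E k j * y k) = E k j * (ssign par i l k j * (E i l * y k)) + (if k = l then E i j * y l else 0)"
    if "j < k" "k \<le> N" for k
  proof -
    have "E i l * E k j = ssign par i l k j * (E k j * E i l) + (if k = l then E i j else 0)"
      using gl_relationsD[OF rel, of i l k j] that il N by auto
    then have "E i l * (E k j * y k) = (ssign par i l k j * (E k j * E i l) + (if k = l then E i j else 0)) * y k"
      by (simp add: mult.assoc[symmetric])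
    also have "\<dots> = E k j * (ssign par i l k j * (E i l * y k)) + (if k = l then E i j * y l else 0)"
      by (simp add: distrib_right mult.assoc ssign_left_commute)
    finally show ?thesis .
  qed
  then have "E i l * (\<Sum>k\<in>{j<..N}. E k j * y k) =
    (\<Sum>k\<in>{j<..N}. E k j * (ssign par i l k j * (E i l * y k)) + (if k = l then E i j * y l else 0))"
    unfolding sum_distrib_left by (intro sum.cong) auto
  also have "\<dots> =
    (\<Sum>k\<in>{j<..N}. E k j * (ssign par i l k j * (E i l * y k))) + (\<Sum>k\<in>{j<..N}. if k = l then E i j * y l else 0)"
    by (rule sum.distrib)
  \<comment> \<open>The extra term arises in the summand k = l but has the left factor
    \<open>E i j\<close>, so it is booked under k = i.\<close>
  also have "(\<Sum>k\<in>{j<..N}. if k = l then E i j * y l else 0) = (\<Sum>k\<in>{j<..N}. if k = i then E i j * y l else 0)"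
    using il by simp
  also have "\<dots> = (\<Sum>k\<in>{j<..N}. E k j * (if k = i then y l else 0))"
    by (intro sum.cong) auto
  also have "(\<Sum>k\<in>{j<..N}. E k j * (ssign par i l k j * (E i l * y k))) + (\<Sum>k\<in>{j<..N}. E k j * (if k = i then y l else 0))
    = (\<Sum>k\<in>{j<..N}. E k j * u k)"
    by (simp add: u_def sum.distrib[symmetric] distrib_left)
  finally have "(\<Sum>k\<in>{j<..N}. E k j * u k) \<in> J"
    using J by simp
  then have u_J: "u k \<in> J" if "j < k" "k \<le> N" for k
    using free_upto[of j u k] that u_up il by auto
  show "E i l * y k \<in> J" if k: "j < k" "k \<le> N" "k \<noteq> i"
    using J_mult[OF u_J[OF k(1,2)], of "ssign par i l k j"] k by (simp add: u_def ssign_ssign)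
  show "y l = 0" if "E i l * y i \<in> J"
  proof -
    have "u i - ssign par i l i j * (E i l * y i) \<in> J"
      using il by (intro J_diff u_J J_mult[OF that]) auto
    then have "y l \<in> J" by (simp add: u_def)
    then show ?thesis using chain_in_J[OF y[of l]] il by auto
  qed
qed

lemma chain_unique:
  "chain sc E N j x c \<Longrightarrow> c = 0 \<Longrightarrow> (\<And>i l. j < i \<Longrightarrow> i < l \<Longrightarrow> l \<le> N \<Longrightarrow> E i l * x \<in> J) \<Longrightarrow> x = 0"
proof (induction rule: chain.induct)
  case (base c)
  then show ?case by (simp add: sc_0)
next
  case (step j y c)
  have raise: "E i l * y k \<in> J" if "j < i" "i < l" "l \<le> N" "j < k" "k \<le> N" "k \<noteq> i" for i l k
    using raise_chain(1)[OF step.hyps(2)] step.prems(2) that by blast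
  \<comment> \<open>The induction hypothesis for \<open>Suc j\<close> asks for raising operators
    with i > j + 1 only, so the exception k = i of \<open>raise\<close> does not occur.\<close>
  have y0: "y (Suc j) = 0"
    using step.hyps step.prems by (intro step.IH) (auto intro: raise)
  have "y k = 0" if "j < k" "k \<le> N" for k
  proof (cases "k = Suc j")
    case False
    with that raise_chain(2)[OF step.hyps(2), where i = "Suc j" and l = k] step.prems(2) y0 J_0 show ?thesis
      by auto
  qed (use y0 in simp)
  then show ?case by (auto intro!: sum.neutral)
qed

lemma chain_proportional:
  assumes "chain sc E N j x c" "chain sc E N j w d" "d \<noteq> 0"
    and "\<And>i l. j < i \<Longrightarrow> i < l \<Longrightarrow> l \<le> N \<Longrightarrow> E i l * x \<in> J"
    and "\<And>i l. j < i \<Longrightarrow> i < l \<Longrightarrow> l \<le> N \<Longrightarrow> E i l * w \<in> J"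
  shows "x = sc (c / d) * w"
proof -
  have "chain sc E N j (x + sc (- (c / d)) * w) (c + - (c / d) * d)"
    using assms by (intro chain_add chain_sc)
  then have "x + sc (- (c / d)) * w = 0"
    by (rule chain_unique)
       (use assms(3) in \<open>auto simp: distrib_left sc_left_commute intro!: J_add J_mult[OF assms(5)] assms(4)\<close>)
  then show ?thesis by (simp add: sc_uminus)
qed

text \<open>Pieces y_k with k < r factor by induction, and y_r is proportional to \<open>w\<close>
  by uniqueness. For k > r the relation y_k = \<plusminus> E r k y_r forces y_k = 0, since
  \<open>w\<close> is also killed by the operators with first index \<open>r\<close>; uniqueness
  alone would only need i > r.\<close>

theorem chain_factor:
  assumes w: "chain sc E N r w d" "d \<noteq> 0" "\<And>i l. r \<le> i \<Longrightarrow> i < l \<Longrightarrow> l \<le> N \<Longrightarrow> E i l * w \<in> J"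
  shows "chain sc E N j x c \<Longrightarrow> j \<le> r \<Longrightarrow>
    (\<And>i l. j < i \<Longrightarrow> i < l \<Longrightarrow> l \<le> N \<Longrightarrow> E i l * x \<in> J) \<Longrightarrow> \<exists>u. x = u * w"
proof (induction rule: chain.induct)
  case (base c)
  then have "sc c = sc (c / d) * w"
    using w chain_le[OF w(1)] by (intro chain_proportional[of N]) (auto intro: chain.base)
  then show ?case by blast
next
  case (step j y c)
  show ?case
  proof (cases "j = r")
    case True
    have "(\<Sum>k\<in>{j<..N}. E k j * y k) = sc (c (Suc j) / d) * w"
      using w step.prems True by (intro chain_proportional[of j] chain.step step.hyps) auto
    then show ?thesis by blast
  next
    case False
    with step.prems have jr: "j < r" by simp
    have rN: "r \<le> N" using chain_le[OF w(1)] .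
    have raise: "E i l * y k \<in> J" if "j < i" "i < l" "l \<le> N" "j < k" "k \<le> N" "k \<noteq> i" for i l k
      using raise_chain(1)[OF step.hyps(2)] step.prems(2) that by blast
    have yr: "y r = sc (c r / d) * w"
      using w jr rN by (intro chain_proportional[of r] step.hyps raise) auto
    have "\<exists>u. y k = u * w" if "j < k" "k \<le> N" for k
    proof (cases "k \<le> r")
      case True
      then show ?thesis using that by (intro step.IH raise) auto
    next
      case False
      have "E r k * y r \<in> J"
        using w(3)[of r k] False that by (simp add: yr sc_left_commute J_mult)
      with raise_chain(2)[OF step.hyps(2), where i = r and l = k] step.prems(2) jr False that have "y k = 0"
        by auto
      then show ?thesis by (auto intro: exI[of _ 0])
    qed
    then have "\<forall>k. \<exists>u. j < k \<longrightarrow> k \<le> N \<longrightarrow> y k = u * w"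
      by blast
    then obtain u where "\<And>k. j < k \<Longrightarrow> k \<le> N \<Longrightarrow> y k = u k * w"
      using choice[of "\<lambda>k u. j < k \<longrightarrow> k \<le> N \<longrightarrow> y k = u * w"] by blast
    then have "(\<Sum>k\<in>{j<..N}. E k j * y k) = (\<Sum>k\<in>{j<..N}. E k j * u k) * w"
      by (simp add: sum_distrib_right mult.assoc)
    then show ?thesis by blast
  qed
qed

text \<open>The letter \<open>(k, j)\<close> is commuted to the front past the letters of
  \<open>ws1\<close>, none of which starts at \<open>j\<close>. In front it is the first layer of a
  chain, and the rest of the word is a chain from \<open>k\<close> by \<open>IH\<close>.\<close>

lemma word_chain_move:
  assumes IH: "\<And>k ws. j < k \<Longrightarrow> k < n \<Longrightarrow> lower_word n ws \<Longrightarrow> wt_word ws = path_wt k N \<Longrightarrow>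
      \<exists>c. chain sc E N k (word E ws) c \<and> (c \<noteq> 0 \<longleftrightarrow> simple_word ws)"
  shows "lower_word n ws1 \<Longrightarrow> lower_word n ws2 \<Longrightarrow> \<forall>(a, b)\<in>set ws1. j < b \<Longrightarrow> j < k \<Longrightarrow> k < n \<Longrightarrow>
    wt_word (ws1 @ (k, j) # ws2) = path_wt j N \<Longrightarrow>
    \<exists>c. chain sc E N j (word E (ws1 @ (k, j) # ws2)) c \<and> (c \<noteq> 0 \<longleftrightarrow> simple_word (ws1 @ (k, j) # ws2))"
proof (induction ws1 arbitrary: k ws2 rule: rev_induct)
  case Nil
  have "wt_word ws2 = path_wt k N"
  proof
    fix l show "wt_word ws2 l = path_wt k N l"
      using fun_cong[OF Nil.prems(6), of l] by (simp add: wt_word_def path_wt_def)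
  qed
  from IH[OF Nil.prems(4,5,2) this] obtain c where
    c: "chain sc E N k (word E ws2) c" "c \<noteq> 0 \<longleftrightarrow> simple_word ws2" by blast
  have kN: "k \<le> N" using chain_le[OF c(1)] .
  \<comment> \<open>A chain with one nonzero entry, at \<open>k\<close>. Its coefficient is read off
    at \<open>Suc j\<close>, hence it vanishes unless the letter \<open>(k, j)\<close> is
    simple.\<close>
  define y where "y l = (if l = k then word E ws2 else 0)" for l
  define d where "d l = (if l = k then c else 0)" for l
  have "chain sc E N j (\<Sum>l\<in>{j<..N}. E l j * y l) (d (Suc j))"
    using kN Nil.prems(4) c(1) by (intro chain.step) (auto simp: y_def d_def intro: chain_zero)
  also have "(\<Sum>l\<in>{j<..N}. E l j * y l) = (\<Sum>l\<in>{j<..N}. if l = k then E k j * word E ws2 else 0)"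
    by (intro sum.cong) (auto simp: y_def)
  also have "\<dots> = word E ([] @ (k, j) # ws2)"
    using kN Nil.prems(4) by (simp add: word_def)
  finally show ?case
    using c(2) by (intro exI[of _ "d (Suc j)"]) (auto simp: d_def simple_word_def)
next
  case (snoc x ws1)
  obtain a b where x: "x = (a, b)" by (cases x)
  have ab: "j < b" "b < a" "a < n" and ws1: "lower_word n ws1" "\<forall>(a, b)\<in>set ws1. j < b"
    using snoc.prems x by (auto simp: lower_word_def)
  obtain c where c: "chain sc E N j (word E (ws1 @ (k, j) # (a, b) # ws2)) c"
      "c \<noteq> 0 \<longleftrightarrow> simple_word (ws1 @ (k, j) # (a, b) # ws2)"
    using snoc.IH[of "(a, b) # ws2" k] snoc.prems ws1 ab x
    by (auto simp: lower_word_def wt_word_def algebra_simps)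
  have "E a b * E k j = ssign par a b k j * (E k j * E a b) + (if b = k then E a j else 0)"
    using gl_relationsD[OF rel, of a b k j] snoc.prems ab by auto
  then have "word E ws1 * (E a b * E k j) * word E ws2 =
    word E ws1 * (ssign par a b k j * (E k j * E a b) + (if b = k then E a j else 0)) * word E ws2"
    by simp
  then have eq: "word E ((ws1 @ [x]) @ (k, j) # ws2) =
      sc (ssign par a b k j) * word E (ws1 @ (k, j) # (a, b) # ws2)
      + (if b = k then word E (ws1 @ (a, j) # ws2) else 0)"
    unfolding ssign_eq_sc[of par a b k j, symmetric]
    by (simp add: word_def x mult.assoc distrib_left distrib_right ssign_left_commute)
  \<comment> \<open>The merged letter \<open>(a, j)\<close> has a > b > j, so it is never simple and
    the shorter word contributes 0 to the coefficient.\<close>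
  have "chain sc E N j (if b = k then word E (ws1 @ (a, j) # ws2) else 0) 0"
  proof (cases "b = k")
    case True
    have "wt_word (ws1 @ (a, j) # ws2) = wt_word ((ws1 @ [x]) @ (k, j) # ws2)"
      using True by (simp add: fun_eq_iff wt_word_def x)
    then obtain c' where "chain sc E N j (word E (ws1 @ (a, j) # ws2)) c'"
        "c' \<noteq> 0 \<longleftrightarrow> simple_word (ws1 @ (a, j) # ws2)"
      using snoc.IH[of ws2 a] snoc.prems ws1 ab by auto
    then show ?thesis
      using True ab by (auto simp: simple_word_def)
  qed (use chain_le[OF c(1)] chain_zero in simp)
  from chain_add[OF chain_sc[OF c(1), of "ssign par a b k j"] this]
  have "chain sc E N j (word E ((ws1 @ [x]) @ (k, j) # ws2)) (ssign par a b k j * c)"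
    unfolding eq by simp
  moreover have "ssign par a b k j * c \<noteq> 0 \<longleftrightarrow> simple_word ((ws1 @ [x]) @ (k, j) # ws2)"
    using c(2) by (auto simp: ssign_def simple_word_def x)
  ultimately show ?case by blast
qed

text \<open>The least lower index in the word has positive weight, so it must be \<open>j\<close>;
  as the weight there is 1, exactly one letter starts at \<open>j\<close>, and the letters to its
  left start strictly above \<open>j\<close>.\<close>

theorem word_chain:
  "j < n \<Longrightarrow> lower_word n ws \<Longrightarrow> wt_word ws = path_wt j N \<Longrightarrow>
    \<exists>c. chain sc E N j (word E ws) c \<and> (c \<noteq> 0 \<longleftrightarrow> simple_word ws)"
proof (induction "n - j" arbitrary: j ws rule: less_induct)
  case less
  have wt: "wt_word ws k = path_wt j N k" for k
    using less.prems by simp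
  show ?case
  proof (cases "ws = []")
    case True
    then have "j = N"
      using wt[of j] by (auto simp: wt_word_def path_wt_def split: if_splits)
    then show ?thesis
      using True chain.base[of sc E N 1] by (auto simp: sc_1 word_def simple_word_def)
  next
    case False
    define b0 where "b0 = Min (snd ` set ws)"
    have "b0 \<le> b" if "(a, b) \<in> set ws" for a b
      unfolding b0_def using that by (intro Min_le) force+
    then have b0: "b0 \<in> snd ` set ws" "\<forall>(a, b)\<in>set ws. b0 \<le> b"
      using False by (auto simp: b0_def intro!: Min_in)
    have lower: "\<forall>(a, b)\<in>set ws. b < a" using less.prems by (auto simp: lower_word_def)
    have cnt: "wt_word ws b0 = int (length (filter (\<lambda>(a, b). b = b0) ws))"
      using lower b0(2) by (intro wt_word_least) fastforce
    moreover have "filter (\<lambda>(a, b). b = b0) ws \<noteq> []"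
      using b0(1) by (auto simp: filter_empty_conv)
    ultimately have "wt_word ws b0 > 0" by simp
    then have b0j: "b0 = j" and jN: "j \<noteq> N"
      using wt[of b0] by (auto simp: path_wt_def split: if_splits)
    from b0(1) b0j obtain k where "(k, j) \<in> set ws" by force
    then obtain ws1 ws2 where ws: "ws = ws1 @ (k, j) # ws2"
      by (meson split_list)
    have len: "length (filter (\<lambda>(a, b). b = j) ws) = 1"
      using cnt wt[of j] jN by (simp add: b0j path_wt_def)
    then have "filter (\<lambda>(a, b). b = j) ws1 = []" "filter (\<lambda>(a, b). b = j) ws2 = []"
      by (simp_all add: ws)
    then have "b \<noteq> j" if "(a, b) \<in> set ws1" for a b
      using that by (auto simp: filter_empty_conv)
    moreover have "j \<le> b" if "(a, b) \<in> set ws1" for a b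
      using that b0(2) unfolding b0j ws by auto
    ultimately have above: "\<forall>(a, b)\<in>set ws1. j < b"
      by (auto simp: order_less_le)
    show ?thesis
      unfolding ws
    proof (rule word_chain_move)
      fix k' ws' assume "j < k'" "k' < n" "lower_word n ws'" "wt_word ws' = path_wt k' N"
      then show "\<exists>c. chain sc E N k' (word E ws') c \<and> (c \<noteq> 0 \<longleftrightarrow> simple_word ws')"
        using less.prems(1) by (intro less.hyps) auto
    qed (use less.prems above in \<open>auto simp: ws lower_word_def\<close>)
  qed
qed

end

end

section \<open>A Fock space representation of gl(m,n)\<close>

text \<open>Vectors are arbitrary coefficient functions on the set of basis states, without a
  finiteness condition: only operators and the vacuum matter. An operator is therefore given by the
  value of its result at each state.\<close>

typedef 's endo = "{T :: ('s \<Rightarrow> complex) \<Rightarrow> 's \<Rightarrow> complex.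
    (\<forall>f g. T (\<lambda>s. f s + g s) = (\<lambda>s. T f s + T g s)) \<and> (\<forall>c f. T (\<lambda>s. c * f s) = (\<lambda>s. c * T f s))}"
  by (rule exI[of _ "\<lambda>f. f"]) auto

setup_lifting type_definition_endo

lift_definition app :: "'s endo \<Rightarrow> ('s \<Rightarrow> complex) \<Rightarrow> 's \<Rightarrow> complex" is "\<lambda>T. T" .

lemma app_add: "app T (\<lambda>s. f s + g s) = (\<lambda>s. app T f s + app T g s)"
  and app_scale: "app T (\<lambda>s. c * f s) = (\<lambda>s. c * app T f s)"
  by (transfer; simp)+

lemma endo_eqI: "(\<And>f s. app S f s = app T f s) \<Longrightarrow> S = T"
  by transfer (auto simp: fun_eq_iff)

lemma app_zero: "app T (\<lambda>_. 0) = (\<lambda>_. 0)"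
  using app_scale[of T 0 "\<lambda>_. 0"] by simp

instantiation endo :: (type) ring_1
begin

lift_definition zero_endo :: "'a endo" is "\<lambda>f s. 0" by simp
lift_definition one_endo :: "'a endo" is "\<lambda>f. f" by simp
lift_definition plus_endo :: "'a endo \<Rightarrow> 'a endo \<Rightarrow> 'a endo" is "\<lambda>S T f s. S f s + T f s"
  by (simp add: algebra_simps)
lift_definition minus_endo :: "'a endo \<Rightarrow> 'a endo \<Rightarrow> 'a endo" is "\<lambda>S T f s. S f s - T f s"
  by (simp add: algebra_simps)
lift_definition uminus_endo :: "'a endo \<Rightarrow> 'a endo" is "\<lambda>T f s. - T f s"
  by (simp add: algebra_simps)
lift_definition times_endo :: "'a endo \<Rightarrow> 'a endo \<Rightarrow> 'a endo" is "\<lambda>S T f. S (T f)"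
  by simp

instance
proof
  fix a b c :: "'a endo"
  show "a * (b + c) = a * b + a * c"
    by transfer auto
  show "(0 :: 'a endo) \<noteq> 1"
    by transfer (auto simp: fun_eq_iff intro: exI[of _ "\<lambda>_. 1"])
qed (transfer; simp add: fun_eq_iff algebra_simps; fail)+

end

lemma app_ring [simp]:
  "app 0 f = (\<lambda>_. 0)" "app 1 f = f" "app (S + T) f = (\<lambda>s. app S f s + app T f s)"
  "app (S - T) f = (\<lambda>s. app S f s - app T f s)" "app (- T) f = (\<lambda>s. - app T f s)"
  "app (S * T) f = app S (app T f)"
  by (transfer; simp)+

lemma app_sum: "app (sum T A) f = (\<lambda>s. \<Sum>a\<in>A. app (T a) f s)"
  by (induction A rule: infinite_finite_induct) auto

lift_definition esc :: "complex \<Rightarrow> 's endo" is "\<lambda>c f s. c * f s"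
  by (simp add: algebra_simps)

lemma app_esc [simp]: "app (esc c) f = (\<lambda>s. c * f s)"
  by transfer simp

lemma scalars_esc: "scalars esc"
  by standard (auto intro!: endo_eqI simp: algebra_simps app_scale)

text \<open>A basis state: integer exponents of the even variables relative to the vacuum, and the
  set of odd variables whose occupation differs from that in the vacuum.\<close>

type_synonym fock = "((nat \<times> nat) \<Rightarrow> int) \<times> (nat \<times> nat) set"

text \<open>Bosonic ladder operators change one exponent by \<open>d\<close>; fermionic ones toggle one occupation
  number, with the Jordan--Wigner sign that makes them anticommute.\<close>

lift_definition bose :: "(int \<Rightarrow> complex) \<Rightarrow> int \<Rightarrow> nat \<times> nat \<Rightarrow> fock endo" is
  "\<lambda>g d a f (e, S). g (e a) * f (e(a := e a + d), S)"
  by (auto simp: fun_eq_iff algebra_simps)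

definition toggle :: "'a \<Rightarrow> 'a set \<Rightarrow> 'a set" where
  "toggle a S = (if a \<in> S then S - {a} else insert a S)"

text \<open>Ordering the modes by \<open>prod_encode\<close> leaves finitely many below each one, so
  the count is meaningful for every \<open>S\<close>, finite or not.\<close>

definition jw_sign :: "nat \<times> nat \<Rightarrow> (nat \<times> nat) set \<Rightarrow> complex" where
  "jw_sign a S = (- 1) ^ card {b \<in> S. prod_encode b < prod_encode a}"

text \<open>With \<open>c\<close> true the operator inserts \<open>a\<close> into the set of the
  state, with \<open>c\<close> false it removes it.\<close>

lift_definition fermi :: "bool \<Rightarrow> nat \<times> nat \<Rightarrow> fock endo" is
  "\<lambda>c a f (e, S). if (a \<in> S) = c then jw_sign a S * f (e, toggle a S) else 0"
  by (auto simp: fun_eq_iff algebra_simps)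

lemma app_bose: "app (bose g d a) f (e, S) = g (e a) * f (e(a := e a + d), S)"
  by transfer simp

lemma app_fermi: "app (fermi c a) f (e, S) = (if (a \<in> S) = c then jw_sign a S * f (e, toggle a S) else 0)"
  by transfer simp

lemma toggle_simps:
  "toggle a (toggle a S) = S" "a \<in> toggle a S \<longleftrightarrow> a \<notin> S" "a \<noteq> b \<Longrightarrow> a \<in> toggle b S \<longleftrightarrow> a \<in> S"
  "toggle a (toggle b S) = toggle b (toggle a S)" "toggle a S = {} \<longleftrightarrow> S = {a}"
  by (auto simp: toggle_def)

lemma finite_prod_encode_less: "finite {b. prod_encode b < m}"
  using finite_imageD[of prod_encode "{b. prod_encode b < m}"]
    finite_subset[of "prod_encode ` {b. prod_encode b < m}" "{..<m}"]
  by (auto intro: inj_on_subset[OF inj_prod_encode])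

lemma jw_sign_square: "jw_sign a S * jw_sign a S = 1"
  by (simp add: jw_sign_def flip: power_add mult_2)

lemma jw_sign_toggle:
  "jw_sign a (toggle b S) = (if prod_encode b < prod_encode a then - jw_sign a S else jw_sign a S)"
proof -
  let ?A = "\<lambda>S. {b \<in> S. prod_encode b < prod_encode a}"
  have fin: "finite (?A S)" for S
    by (rule finite_subset[OF _ finite_prod_encode_less]) auto
  show ?thesis
  proof (cases "prod_encode b < prod_encode a")
    case True
    then have *: "?A (toggle b S) = (if b \<in> S then ?A S - {b} else insert b (?A S))"
      by (auto simp: toggle_def)
    show ?thesis
    proof (cases "b \<in> S")
      case True
      then have c: "card (?A S) = Suc (card (?A S - {b}))"
        using card.remove[OF fin[of S], of b] \<open>prod_encode b < _\<close> by simp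
      have "jw_sign a S = - ((- 1) ^ card (?A S - {b}))"
        unfolding jw_sign_def c by simp
      moreover have "jw_sign a (toggle b S) = (- 1) ^ card (?A S - {b})"
        unfolding jw_sign_def * using True by simp
      ultimately show ?thesis
        using \<open>prod_encode b < _\<close> by simp
    next
      case False
      then have c: "card (insert b (?A S)) = Suc (card (?A S))"
        using fin[of S] by simp
      have "jw_sign a (toggle b S) = (- 1) ^ Suc (card (?A S))"
        unfolding jw_sign_def * c[symmetric] using False by simp
      then show ?thesis
        using \<open>prod_encode b < _\<close> by (simp add: jw_sign_def)
    qed
  next
    case False
    then have "?A (toggle b S) = ?A S"
      by (auto simp: toggle_def)
    with False show ?thesis by (simp add: jw_sign_def)
  qed
qed

lemma fermi_square: "fermi c a * fermi c a = 0"
proof (rule endo_eqI)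
  fix f :: "fock \<Rightarrow> complex" and s :: fock
  obtain e S where "s = (e, S)" by (cases s)
  then show "app (fermi c a * fermi c a) f s = app 0 f s"
    by (simp add: app_fermi toggle_simps)
qed

lemma fermi_anticommute:
  assumes "a \<noteq> b"
  shows "fermi c a * fermi c' b = - (fermi c' b * fermi c a)"
proof (rule endo_eqI)
  fix f :: "fock \<Rightarrow> complex" and s :: fock
  obtain e S where s: "s = (e, S)" by (cases s)
  have "prod_encode a \<noteq> prod_encode b" using assms by simp
  then show "app (fermi c a * fermi c' b) f s = app (- (fermi c' b * fermi c a)) f s"
    using assms by (auto simp: s app_fermi toggle_simps jw_sign_toggle)
qed

lemma fermi_canonical: "c \<noteq> c' \<Longrightarrow> fermi c a * fermi c' a = - (fermi c' a * fermi c a) + 1"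
proof (rule endo_eqI)
  fix f :: "fock \<Rightarrow> complex" and s :: fock assume "c \<noteq> c'"
  obtain e S where s: "s = (e, S)" by (cases s)
  show "app (fermi c a * fermi c' a) f s = app (- (fermi c' a * fermi c a) + 1) f s"
    using \<open>c \<noteq> c'\<close>
    by (auto simp: s app_fermi toggle_simps jw_sign_toggle jw_sign_square mult.assoc[symmetric])
qed

lemma bose_fermi: "bose g d a * fermi c b = fermi c b * bose g d a"
proof (rule endo_eqI)
  fix f :: "fock \<Rightarrow> complex" and s :: fock
  obtain e S where s: "s = (e, S)" by (cases s)
  show "app (bose g d a * fermi c b) f s = app (fermi c b * bose g d a) f s"
    by (simp add: s app_fermi app_bose)
qed

lemma bose_bose: "a \<noteq> b \<Longrightarrow> bose g d a * bose h k b = bose h k b * bose g d a"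
proof (rule endo_eqI)
  fix f :: "fock \<Rightarrow> complex" and s :: fock assume ab: "a \<noteq> b"
  obtain e S where s: "s = (e, S)" by (cases s)
  show "app (bose g d a * bose h k b) f s = app (bose h k b * bose g d a) f s"
    using ab by (simp add: s app_bose fun_upd_twist)
qed

text \<open>\<open>X a\<close> and \<open>D a\<close> are multiplication by and differentiation with respect to the \<open>i\<close>-th
  coordinate in the \<open>p\<close>-th copy of the natural module, where \<open>a = (i, p)\<close>; this variable is odd iff
  \<open>i\<close> and \<open>p\<close> have different parity. Exponents are counted relative to those of the vacuum, which is
  the product over \<open>p\<close> of $x_{p,p}^{\alpha_p} \prod_{i<p} x_{i,p}^{-1}$: for \<open>i < p\<close> nonnegative powers of
  even variables are set to zero and odd variables start out occupied. For \<open>i \<le> p\<close> the even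
  monomials are normalised so that \<open>D a\<close> is a pure shift; in particular \<open>D (p, p)\<close> is injective.\<close>

definition fermionic :: "(nat \<Rightarrow> bool) \<Rightarrow> nat \<times> nat \<Rightarrow> bool" where
  "fermionic par a \<longleftrightarrow> par (fst a) \<noteq> par (snd a)"

definition fockX :: "(nat \<Rightarrow> bool) \<Rightarrow> (nat \<Rightarrow> complex) \<Rightarrow> nat \<times> nat \<Rightarrow> fock endo" where
  "fockX par \<alpha> a = (if fermionic par a then fermi (snd a < fst a) a
     else bose (\<lambda>e. if fst a < snd a then of_int e - 1 else if fst a = snd a then \<alpha> (fst a) + of_int e else 1) (- 1) a)"

definition fockD :: "(nat \<Rightarrow> bool) \<Rightarrow> nat \<times> nat \<Rightarrow> fock endo" where
  "fockD par a = (if fermionic par a then fermi (\<not> snd a < fst a) a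
     else bose (\<lambda>e. if fst a \<le> snd a then 1 else of_int e + 1) 1 a)"

definition fsign :: "(nat \<Rightarrow> bool) \<Rightarrow> nat \<times> nat \<Rightarrow> nat \<times> nat \<Rightarrow> 'r::ring_1" where
  "fsign par a b = (if fermionic par a \<and> fermionic par b then - 1 else 1)"

lemma fock_XX: "fockX par \<alpha> a * fockX par \<alpha> b = fsign par a b * (fockX par \<alpha> b * fockX par \<alpha> a)"
  by (cases "a = b")
     (auto simp: fockX_def fsign_def bose_fermi bose_bose fermi_anticommute[of a b] fermi_square)

lemma fock_DD: "fockD par a * fockD par b = fsign par a b * (fockD par b * fockD par a)"
  by (cases "a = b")
     (auto simp: fockD_def fsign_def bose_fermi bose_bose fermi_anticommute[of a b] fermi_square)

lemma fock_DX:
  "fockD par a * fockX par \<alpha> b = fsign par a b * (fockX par \<alpha> b * fockD par a) + (if a = b then 1 else 0)"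
proof (cases "a = b")
  case False
  then show ?thesis
    by (auto simp: fockX_def fockD_def fsign_def bose_fermi bose_bose fermi_anticommute[of a b])
next
  case True
  show ?thesis
  proof (cases "fermionic par a")
    case True
    with \<open>a = b\<close> show ?thesis
      using fermi_canonical[of "\<not> snd b < fst b" "snd b < fst b" b]
      by (simp add: fockX_def fockD_def fsign_def)
  next
    case False
    show ?thesis
    proof (rule endo_eqI)
      fix f :: "fock \<Rightarrow> complex" and s :: fock
      obtain e S where s: "s = (e, S)" by (cases s)
      show "app (fockD par a * fockX par \<alpha> b) f s
        = app (fsign par a b * (fockX par \<alpha> b * fockD par a) + (if a = b then 1 else 0)) f s"
        using \<open>a = b\<close> False by (auto simp: s fockX_def fockD_def fsign_def app_bose algebra_simps)
    qed
  qed
qed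

definition fockE :: "nat \<Rightarrow> (nat \<Rightarrow> bool) \<Rightarrow> (nat \<Rightarrow> complex) \<Rightarrow> nat \<Rightarrow> nat \<Rightarrow> fock endo" where
  "fockE n par \<alpha> i j = (\<Sum>p<n. fockX par \<alpha> (i, p) * fockD par (j, p))"

text \<open>\<open>A * B\<close> and \<open>C * F\<close> stand for x_{i,p} \<partial>_{j,p} and
  x_{k,q} \<partial>_{l,q}. Each of the four swaps contributes a sign; the two that bring a
  derivative past a variable may also leave a contraction.\<close>

lemma quadratic_supercommutator:
  fixes A B C F :: "'r::ring_1"
  assumes s: "s1 \<in> {1, - 1}" "s2 \<in> {1, - 1}" "s3 \<in> {1, - 1}" "s4 \<in> {1, - 1}"
    and d: "d1 \<in> {0, 1}" "d4 \<in> {0, 1}"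
    and BC: "B * C = s1 * (C * B) + d1" and AC: "A * C = s2 * (C * A)"
    and BF: "B * F = s3 * (F * B)" and FA: "F * A = s4 * (A * F) + d4"
  shows "A * B * (C * F) = s1 * s2 * s3 * s4 * (C * F * (A * B)) + (d1 * (A * F) - s1 * s2 * s3 * s4 * (d4 * (C * B)))"
proof -
  \<comment> \<open>\<open>s4\<close> squares to 1, so the relation for \<open>F * A\<close> can be
    inverted.\<close>
  have AF: "A * F = s4 * (F * A) - s4 * d4"
    unfolding FA using s(4) by auto
  have "A * B * (C * F) = A * (B * C) * F" by (simp add: mult.assoc)
  also have "\<dots> = s1 * (A * C * (B * F)) + d1 * (A * F)"
    unfolding BC using s(1) d(1) by (auto simp: algebra_simps)
  also have "A * C * (B * F) = s2 * s3 * (C * (A * F) * B)"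
    unfolding AC BF using s(2,3) by (auto simp: algebra_simps)
  also have "s1 * \<dots> = s1 * s2 * s3 * s4 * (C * F * (A * B)) - s1 * s2 * s3 * s4 * (d4 * (C * B))"
    unfolding AF using s(4) d(2) by (auto simp: algebra_simps)
  finally show ?thesis by simp
qed

lemma fsign_values: "fsign par a b \<in> {1, - 1}"
  by (simp add: fsign_def)

text \<open>The parity of x_{i,p} is that of i plus that of p, so p cancels in x_{i,p}
  \<partial>_{j,p}, which has the parity of e_{i,j}.\<close>

lemma fsign_prod:
  "fsign par (j, p) (k, q) * fsign par (i, p) (k, q) * fsign par (j, p) (l, q) * fsign par (l, q) (i, p)
    = (ssign par i j k l :: 'r::ring_1)"
  by (simp add: fsign_def ssign_def fermionic_def)

lemma gl_relations_fockE: "gl_relations n par (fockE n par \<alpha>)"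
  unfolding gl_relations_def
proof (intro allI impI)
  fix i j k l assume "i < n" "j < n" "k < n" "l < n"
  let ?X = "fockX par \<alpha>" and ?D = "fockD par" and ?s = "ssign par i j k l :: fock endo"
  have pq: "?X (i, p) * ?D (j, p) * (?X (k, q) * ?D (l, q)) =
      ?s * (?X (k, q) * ?D (l, q) * (?X (i, p) * ?D (j, p)))
      + ((if q = p then (if j = k then ?X (i, p) * ?D (l, p) else 0) else 0)
         - ?s * (if q = p then (if i = l then ?X (k, p) * ?D (j, p) else 0) else 0))" for p q
    using quadratic_supercommutator[OF fsign_values fsign_values fsign_values fsign_values _ _
        fock_DX[of par "(j, p)" \<alpha> "(k, q)"] fock_XX[of par \<alpha> "(i, p)" "(k, q)"]
        fock_DD[of par "(j, p)" "(l, q)"] fock_DX[of par "(l, q)" \<alpha> "(i, p)"]]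
    unfolding fsign_prod by auto
  have "fockE n par \<alpha> i j * fockE n par \<alpha> k l =
      (\<Sum>p<n. \<Sum>q<n. ?X (i, p) * ?D (j, p) * (?X (k, q) * ?D (l, q)))"
    by (simp add: fockE_def sum_product)
  also have "\<dots> = ?s * (\<Sum>p<n. \<Sum>q<n. ?X (k, q) * ?D (l, q) * (?X (i, p) * ?D (j, p)))
      + ((\<Sum>p<n. if j = k then ?X (i, p) * ?D (l, p) else 0) - ?s * (\<Sum>p<n. if i = l then ?X (k, p) * ?D (j, p) else 0))"
    unfolding pq by (simp add: sum.distrib sum_subtractf sum_distrib_left[symmetric])
  also have "(\<Sum>p<n. \<Sum>q<n. ?X (k, q) * ?D (l, q) * (?X (i, p) * ?D (j, p))) = fockE n par \<alpha> k l * fockE n par \<alpha> i j"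
    unfolding fockE_def sum_product by (rule sum.swap)
  also have "(\<Sum>p<n. if j = k then ?X (i, p) * ?D (l, p) else 0) = (if j = k then fockE n par \<alpha> i l else 0)"
    by (simp add: fockE_def)
  also have "(\<Sum>p<n. if i = l then ?X (k, p) * ?D (j, p) else 0) = (if i = l then fockE n par \<alpha> k j else 0)"
    by (simp add: fockE_def)
  finally show "fockE n par \<alpha> i j * fockE n par \<alpha> k l = ?s * (fockE n par \<alpha> k l * fockE n par \<alpha> i j)
      + ((if j = k then fockE n par \<alpha> i l else 0) - ?s * (if i = l then fockE n par \<alpha> k j else 0))" .
qed

section \<open>The vacuum as a highest weight vector, and freeness over it\<close>

definition vac :: "fock \<Rightarrow> complex" where
  "vac s = of_bool (s = (\<lambda>_. 0, {}))"

lemma fockD_vac: "p < i \<Longrightarrow> app (fockD par (i, p)) vac = (\<lambda>_. 0)"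
proof
  fix s :: fock assume "p < i"
  obtain e S where s: "s = (e, S)" by (cases s)
  have "e (i, p) = - 1" if "e((i, p) := e (i, p) + 1) = (\<lambda>_. 0)"
    using fun_cong[OF that, of "(i, p)"] by simp
  with \<open>p < i\<close> show "app (fockD par (i, p)) vac s = 0"
    by (auto simp: s fockD_def app_bose app_fermi vac_def toggle_simps)
qed

lemma fockX_vac: "i < p \<Longrightarrow> app (fockX par \<alpha> (i, p)) vac = (\<lambda>_. 0)"
proof
  fix s :: fock assume "i < p"
  obtain e S where s: "s = (e, S)" by (cases s)
  have "e (i, p) = 1" if "e((i, p) := e (i, p) - 1) = (\<lambda>_. 0)"
    using fun_cong[OF that, of "(i, p)"] by simp
  with \<open>i < p\<close> show "app (fockX par \<alpha> (i, p)) vac s = 0"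
    by (auto simp: s fockX_def app_bose app_fermi vac_def toggle_simps)
qed

lemma fockXD_vac_diagonal: "app (fockX par \<alpha> (i, i) * fockD par (i, i)) vac = (\<lambda>s. \<alpha> i * vac s)"
proof
  fix s :: fock
  obtain e S where s: "s = (e, S)" by (cases s)
  show "app (fockX par \<alpha> (i, i) * fockD par (i, i)) vac s = \<alpha> i * vac s"
    by (auto simp: s fockX_def fockD_def app_bose vac_def fermionic_def)
qed

text \<open>X D measures the exponent in the vacuum, which is -1 for an even variable and 1 for an
  occupied odd one. The proof reverses the order, because X annihilates the vacuum here.\<close>

lemma fockXD_vac_right:
  assumes "i < p"
  shows "app (fockX par \<alpha> (i, p) * fockD par (i, p)) vac = (\<lambda>s. (if fermionic par (i, p) then 1 else - 1) * vac s)"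
proof -
  have "fockX par \<alpha> (i, p) * fockD par (i, p)
      = (if fermionic par (i, p) then 1 - fockD par (i, p) * fockX par \<alpha> (i, p)
         else fockD par (i, p) * fockX par \<alpha> (i, p) - 1)"
    unfolding fock_DX by (simp add: fsign_def)
  then show ?thesis
    by (auto simp: fockX_vac[OF assms] app_zero)
qed

text \<open>For p < j the derivative in the p-th summand kills the vacuum; for p \<ge> j > i the
  multiplication does, and the two supercommute. The special filling of the variables with i < p
  serves this purpose.\<close>

lemma fockE_vac_upper: "i < j \<Longrightarrow> app (fockE n par \<alpha> i j) vac = (\<lambda>_. 0)"
proof -
  assume "i < j"
  have "app (fockX par \<alpha> (i, p) * fockD par (j, p)) vac = (\<lambda>_. 0)" for p
  proof (cases "p < j")
    case True
    then show ?thesis by (simp add: fockD_vac app_zero)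
  next
    case False
    have "fockX par \<alpha> (i, p) * fockD par (j, p) = fsign par (j, p) (i, p) * (fockD par (j, p) * fockX par \<alpha> (i, p))"
      unfolding fock_DX using \<open>i < j\<close> by (simp add: fsign_def)
    then show ?thesis
      using False \<open>i < j\<close> by (simp add: fockX_vac app_zero)
  qed
  then show ?thesis
    by (simp add: fockE_def app_sum del: app_ring(6))
qed

text \<open>The contribution of the variables x_{i,p} with p > i to the weight of the vacuum; the
  exponents \<open>\<alpha>\<close> are later chosen to compensate it.\<close>

definition vac_shift :: "nat \<Rightarrow> (nat \<Rightarrow> bool) \<Rightarrow> nat \<Rightarrow> complex" where
  "vac_shift n par i = (\<Sum>p\<in>{i<..<n}. if fermionic par (i, p) then 1 else - 1)"

lemma fockE_vac_diagonal:
  assumes "i < n"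
  shows "app (fockE n par \<alpha> i i) vac = (\<lambda>s. (\<alpha> i + vac_shift n par i) * vac s)"
proof
  fix s
  have "app (fockE n par \<alpha> i i) vac s = (\<Sum>p<n. app (fockX par \<alpha> (i, p) * fockD par (i, p)) vac s)"
    by (simp add: fockE_def app_sum)
  also have "\<dots> = (\<Sum>p<n. ((if p = i then \<alpha> i else 0)
      + (if i < p then if fermionic par (i, p) then 1 else - 1 else 0)) * vac s)"
  proof (intro sum.cong refl)
    fix p
    consider "p < i" | "p = i" | "i < p" by linarith
    then show "app (fockX par \<alpha> (i, p) * fockD par (i, p)) vac s
      = ((if p = i then \<alpha> i else 0) + (if i < p then if fermionic par (i, p) then 1 else - 1 else 0)) * vac s"
      by cases (simp_all add: fockXD_vac_diagonal fockXD_vac_right fockD_vac app_zero del: app_ring(6),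
          simp add: fockD_vac app_zero)
  qed
  also have "\<dots> = (\<alpha> i + (\<Sum>p<n. if i < p then if fermionic par (i, p) then 1 else - 1 else 0)) * vac s"
    using assms by (simp add: sum_distrib_right[symmetric] sum.distrib)
  also have "(\<Sum>p<n. if i < p then if fermionic par (i, p) then 1 else - 1 else (0::complex)) = vac_shift n par i"
    unfolding vac_shift_def by (intro sum.mono_neutral_cong_right) auto
  finally show "app (fockE n par \<alpha> i i) vac s = (\<alpha> i + vac_shift n par i) * vac s" .
qed

text \<open>D supercommutes with every summand of E except for its contraction with x_{a,q}. On a
  vector killed by D only this contraction survives.\<close>

lemma fockD_fockE:
  assumes f: "app (fockD par (l, q)) f = (\<lambda>_. 0)" and q: "q < n"
  shows "app (fockD par (l, q)) (app (fockE n par \<alpha> a b) f) = (if l = a then app (fockD par (b, q)) f else (\<lambda>_. 0))"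
proof
  fix s
  have "fockD par (l, q) * (fockX par \<alpha> (a, p) * fockD par (b, p))
    = fsign par (l, q) (a, p) * fsign par (l, q) (b, p) * (fockX par \<alpha> (a, p) * fockD par (b, p) * fockD par (l, q))
      + (if (l, q) = (a, p) then fockD par (b, p) else 0)" for p
  proof -
    have "fockD par (l, q) * (fockX par \<alpha> (a, p) * fockD par (b, p))
      = fsign par (l, q) (a, p) * (fockX par \<alpha> (a, p) * (fockD par (l, q) * fockD par (b, p)))
      + (if (l, q) = (a, p) then 1 else 0) * fockD par (b, p)"
      unfolding mult.assoc[symmetric] fock_DX[of par "(l, q)"] by (simp add: distrib_right)
    also have "fockD par (l, q) * fockD par (b, p) = fsign par (l, q) (b, p) * (fockD par (b, p) * fockD par (l, q))"
      by (rule fock_DD)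
    finally show ?thesis by (auto simp: fsign_def mult.assoc)
  qed
  then have *: "app (fockD par (l, q) * (fockX par \<alpha> (a, p) * fockD par (b, p))) f s
      = (if p = q then if l = a then app (fockD par (b, q)) f s else 0 else 0)" for p
    by (simp only: app_ring(3,6) f app_zero) (simp add: app_ring)
  have "app (fockD par (l, q)) (app (fockE n par \<alpha> a b) f) s = app (fockD par (l, q) * fockE n par \<alpha> a b) f s"
    by simp
  also have "\<dots> = (\<Sum>p<n. app (fockD par (l, q) * (fockX par \<alpha> (a, p) * fockD par (b, p))) f s)"
    unfolding fockE_def sum_distrib_left app_sum ..
  also have "\<dots> = (if l = a then app (fockD par (b, q)) f s else 0)"
    unfolding * using q by simp
  finally show "app (fockD par (l, q)) (app (fockE n par \<alpha> a b) f) s = (if l = a then app (fockD par (b, q)) f else (\<lambda>_. 0)) s"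
    by simp
qed

text \<open>Acting with indices above \<open>j\<close> never brings in a variable x_{k,j} with k >
  j. In the induction D (k, j) may turn into D (b, j) with another b > j, hence \<open>k\<close> is
  kept arbitrary.\<close>

lemma fockD_upper_vac:
  "x \<in> upper_subalgebra esc (fockE n par \<alpha>) n j \<Longrightarrow> j < k \<Longrightarrow> k < n \<Longrightarrow>
    app (fockD par (k, j)) (app x vac) = (\<lambda>_. 0)"
proof (induction arbitrary: k rule: upper_subalgebra.induct)
  case (mult a b x)
  then show ?case by (simp add: fockD_fockE)
qed (simp_all add: app_scale app_add fockD_vac)

lemma fockD_diagonal_inj: "app (fockD par (j, j)) f = (\<lambda>_. 0) \<Longrightarrow> f = (\<lambda>_. 0)"
proof
  fix s :: fock assume *: "app (fockD par (j, j)) f = (\<lambda>_. 0)"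
  obtain e S where s: "s = (e, S)" by (cases s)
  show "f s = 0"
    using fun_cong[OF *, of "(e((j, j) := e (j, j) - 1), S)"]
    by (simp add: s fockD_def app_bose fermionic_def)
qed

text \<open>D (l, j) annihilates every u_k vac, so applied to the sum it only sees the x_{l,j} in
  the summand k = l and leaves D (j, j) u_l vac. Injectivity of D (j, j) finishes the
  argument.\<close>

theorem fock_free:
  assumes j: "j < n" and u: "\<And>k. u k \<in> upper_subalgebra esc (fockE n par \<alpha>) n j"
    and sum: "app (\<Sum>k\<in>{j<..<n}. fockE n par \<alpha> k j * u k) vac = (\<lambda>_. 0)"
    and l: "j < l" "l < n"
  shows "app (u l) vac = (\<lambda>_. 0)"
proof (rule fockD_diagonal_inj)
  show "app (fockD par (j, j)) (app (u l) vac) = (\<lambda>_. 0)"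
  proof
    fix s
    have "app (fockD par (l, j)) (app (fockE n par \<alpha> k j) (app (u k) vac)) s
      = (if k = l then app (fockD par (j, j)) (app (u l) vac) s else 0)" for k
      using fockD_fockE[OF fockD_upper_vac[OF u l] j] by simp
    then have "app (fockD par (j, j)) (app (u l) vac) s
      = (\<Sum>k\<in>{j<..<n}. app (fockD par (l, j)) (app (fockE n par \<alpha> k j) (app (u k) vac)) s)"
      using l by simp
    also have "\<dots> = app (fockD par (l, j) * (\<Sum>k\<in>{j<..<n}. fockE n par \<alpha> k j * u k)) vac s"
      unfolding sum_distrib_left by (simp add: app_sum)
    also have "\<dots> = 0"
      by (simp add: sum app_zero)
    finally show "app (fockD par (j, j)) (app (u l) vac) s = 0" .
  qed
qed

section \<open>Left ideals of the enveloping algebra from Fock space\<close>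

lemma tensor_induct [case_names single add]:
  fixes t :: "'a \<Rightarrow>\<^sub>0 complex"
  assumes single: "\<And>w c. P (Poly_Mapping.single w c)"
    and add: "\<And>s t. P s \<Longrightarrow> P t \<Longrightarrow> P (s + t)"
  shows "P t"
proof -
  have "P (\<Sum>w\<in>A. Poly_Mapping.single w (Poly_Mapping.lookup t w))" if "finite A" for A
    using that single[of undefined 0] by (induction A rule: finite_induct) (auto intro: single add)
  moreover have "(\<Sum>w\<in>Poly_Mapping.keys t. Poly_Mapping.single w (Poly_Mapping.lookup t w)) = t"
    by (rule poly_mapping_eqI) (simp add: lookup_sum lookup_single when_def in_keys_iff)
  ultimately show ?thesis
    using finite_keys[of t] by metis
qed

definition (in scalars) teval :: "('a \<Rightarrow> 'a \<Rightarrow> 'r) \<Rightarrow> (('a \<times> 'a) list \<Rightarrow>\<^sub>0 complex) \<Rightarrow> 'r" where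
  "teval G t = (\<Sum>w. sc (Poly_Mapping.lookup t w) * prod_list (map (\<lambda>(i, j). G i j) w))"

context scalars
begin

lemma teval_add: "teval G (s + t) = teval G s + teval G t"
proof -
  have "finite {w. sc (Poly_Mapping.lookup t w) * prod_list (map (\<lambda>(i, j). G i j) w) \<noteq> 0}" for t
    by (rule finite_subset[OF _ finite_keys[of t]]) (auto simp: in_keys_iff sc_0)
  then show ?thesis
    by (simp add: teval_def lookup_add sc_add distrib_right Sum_any.distrib)
qed

lemma teval_single: "teval G (Poly_Mapping.single w c) = sc c * prod_list (map (\<lambda>(i, j). G i j) w)"
proof -
  have "teval G (Poly_Mapping.single w c) = (\<Sum>v. if v = w then sc c * prod_list (map (\<lambda>(i, j). G i j) w) else 0)"
    unfolding teval_def by (rule arg_cong[where f = Sum_any]) (auto simp: fun_eq_iff lookup_single sc_0)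
  then show ?thesis by simp
qed

lemma teval_mult: "teval G (s * t) = teval G s * teval G t"
proof (induction s rule: tensor_induct)
  case (single w c)
  show ?case
  proof (induction t rule: tensor_induct)
    case (single v d)
    show ?case
      by (simp add: mult_single teval_single plus_list_def sc_mult mult.assoc sc_left_commute[of _ d])
  qed (simp add: distrib_left teval_add)
qed (simp add: distrib_right teval_add)

lemma teval_minus: "teval G (s - t) = teval G s - teval G t"
  using teval_add[of G "s - t" t] by simp

lemma teval_tgen: "teval G (tgen i j) = G i j"
  by (simp add: tgen_def teval_single sc_1)

lemma teval_ideal:
  assumes G: "\<And>i j k l. G i j * G k l - super_sign i j k l * (G k l * G i j) =
      (if j = k then G i l else 0) - super_sign i j k l * (if i = l then G k j else 0)"
  shows "t \<in> uea_ideal \<Longrightarrow> teval G t = 0"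
proof (induction rule: uea_ideal.induct)
  case zero
  show ?case using teval_minus[of G 0 0] by simp
next
  case (step x a i j k l b)
  have zero: "teval G 0 = 0" using teval_minus[of G 0 0] by simp
  have "teval G 1 = 1"
    using teval_single[of G 0 1] unfolding single_one by (simp add: zero_list_def sc_1)
  then have sign: "teval G (super_sign i j k l) = super_sign i j k l"
    using teval_minus[of G 0 1] by (auto simp: super_sign_def zero)
  have "teval G (uea_relator i j k l) = G i j * G k l - super_sign i j k l * (G k l * G i j)
      - ((if j = k then G i l else 0) - super_sign i j k l * (if i = l then G k j else 0))"
    unfolding uea_relator_def by (simp add: teval_minus sign teval_mult teval_tgen zero if_distrib[of "teval G"])
  also have "\<dots> = 0" unfolding G by simp
  finally show ?case using step by (simp add: teval_add teval_mult)
qed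

end

definition uea_hom :: "(complex \<Rightarrow> 'r) \<Rightarrow> (('m, 'n) uea \<Rightarrow> 'r::ring_1) \<Rightarrow> bool" where
  "uea_hom sc \<Phi> \<longleftrightarrow> (\<forall>x y. \<Phi> (x + y) = \<Phi> x + \<Phi> y) \<and> (\<forall>x y. \<Phi> (x * y) = \<Phi> x * \<Phi> y) \<and> (\<forall>c. \<Phi> (scal c) = sc c)"

theorem (in scalars) uea_hom_exists:
  fixes G :: "'m + 'n \<Rightarrow> 'm + 'n \<Rightarrow> 'r"
  assumes G: "\<And>i j k l. G i j * G k l - super_sign i j k l * (G k l * G i j) =
      (if j = k then G i l else 0) - super_sign i j k l * (if i = l then G k j else 0)"
  obtains \<Phi> :: "('m, 'n) uea \<Rightarrow> 'r" where "uea_hom sc \<Phi>" "\<And>i j. \<Phi> (e_unit i j) = G i j"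
proof -
  \<comment> \<open>Evaluation on a chosen representative; the choice is immaterial because two
    representatives differ by an element of the ideal, on which \<open>teval G\<close>
    vanishes.\<close>
  define \<Phi> :: "('m, 'n) uea \<Rightarrow> 'r" where "\<Phi> x = teval G (rep_uea x)" for x
  have abs: "\<Phi> (abs_uea t) = teval G t" for t
  proof -
    have "uea_cong (rep_uea (abs_uea t)) t"
      by (rule uea.abs_eq_iff[THEN iffD1, OF Quotient3_abs_rep[OF Quotient3_uea]])
    then have "teval G (rep_uea (abs_uea t) - t) = 0"
      unfolding uea_cong_def by (rule teval_ideal[OF G])
    then show ?thesis by (simp add: \<Phi>_def teval_minus)
  qed
  have ex: "\<exists>t. x = abs_uea t" for x :: "('m, 'n) uea"
    using Quotient3_abs_rep[OF Quotient3_uea, of x] by metis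
  show ?thesis
  proof
    show "\<Phi> (e_unit i j) = G i j" for i j
      by (simp add: e_unit.abs_eq abs teval_tgen)
    have "\<Phi> (x + y) = \<Phi> x + \<Phi> y" "\<Phi> (x * y) = \<Phi> x * \<Phi> y" for x y
    proof -
      obtain s t where "x = abs_uea s" "y = abs_uea t" using ex by metis
      then show "\<Phi> (x + y) = \<Phi> x + \<Phi> y" "\<Phi> (x * y) = \<Phi> x * \<Phi> y"
        by (simp_all add: plus_uea.abs_eq times_uea.abs_eq abs teval_add teval_mult)
    qed
    then show "uea_hom sc \<Phi>"
      by (simp add: uea_hom_def scal.abs_eq abs teval_single zero_list_def)
  qed
qed

lemma uea_induct [case_names scal mult add]:
  assumes scal: "\<And>c. P (scal c)" and mult: "\<And>i j x. P x \<Longrightarrow> P (e_unit i j * x)"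
    and add: "\<And>x y. P x \<Longrightarrow> P y \<Longrightarrow> P (x + y)"
  shows "P (x :: ('m, 'n) uea)"
proof -
  have "P (abs_uea t)" for t :: "('m, 'n) tensor"
  proof (induction t rule: tensor_induct)
    case (single w c)
    show ?case
    proof (induction w)
      case Nil
      then show ?case using scal[of c] by (simp add: scal.abs_eq zero_list_def)
    next
      case (Cons a w)
      have "Poly_Mapping.single (a # w) c = tgen (fst a) (snd a) * Poly_Mapping.single w c"
        by (simp add: tgen_def mult_single plus_list_def)
      then show ?case
        using mult[OF Cons, of "fst a" "snd a"] by (simp add: e_unit.abs_eq times_uea.abs_eq)
    qed
  qed (simp add: add flip: plus_uea.abs_eq)
  then show ?thesis using Quotient3_abs_rep[OF Quotient3_uea, of x] by metis
qed

lemma scalars_scal: "scalars (scal :: complex \<Rightarrow> ('m, 'n) uea)"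
proof -
  have c: "Poly_Mapping.single 0 a * t = t * Poly_Mapping.single 0 a" for a and t :: "('m, 'n) tensor"
    by (induction t rule: tensor_induct) (simp_all add: mult_single mult.commute distrib_left distrib_right)
  show ?thesis
  proof
    show "scal 1 = (1 :: ('m, 'n) uea)"
      by (simp add: scal.abs_eq one_uea.abs_eq)
    show "scal (a + b) = (scal a + scal b :: ('m, 'n) uea)" for a b
      by (simp add: scal.abs_eq plus_uea.abs_eq single_add)
    show "scal (a * b) = (scal a * scal b :: ('m, 'n) uea)" for a b
      by (simp add: scal.abs_eq times_uea.abs_eq mult_single)
    show "scal a * x = x * scal a" for a and x :: "('m, 'n) uea"
    proof -
      obtain t where "x = abs_uea t"
        using Quotient3_abs_rep[OF Quotient3_uea, of x] by metis
      then show ?thesis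
        by (simp add: scal.abs_eq times_uea.abs_eq c)
    qed
  qed
qed

lemma super_sign_eq: "super_sign i j k l = (if isl i \<noteq> isl j \<and> isl k \<noteq> isl l then - 1 else 1)"
  by (simp add: super_sign_def even_pair_def)

section \<open>The mirror automorphism\<close>

definition rev_index :: "nat \<Rightarrow> nat \<Rightarrow> nat" where
  "rev_index n i = n - 1 - i"

lemma rev_index_simps [simp]:
  "i < n \<Longrightarrow> rev_index n i < n" "i < n \<Longrightarrow> rev_index n (rev_index n i) = i"
  "i < n \<Longrightarrow> j < n \<Longrightarrow> rev_index n i = rev_index n j \<longleftrightarrow> i = j"
  "i < n \<Longrightarrow> j < n \<Longrightarrow> rev_index n i < rev_index n j \<longleftrightarrow> j < i"
  "i < n \<Longrightarrow> j < n \<Longrightarrow> rev_index n i \<le> rev_index n j \<longleftrightarrow> j \<le> i"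
  by (auto simp: rev_index_def)

text \<open>Minus the supertranspose, combined with reversing the order of the indices: an automorphism
  which preserves the upper triangular Borel subalgebra.\<close>

definition mirror :: "nat \<Rightarrow> (nat \<Rightarrow> bool) \<Rightarrow> (nat \<Rightarrow> nat \<Rightarrow> 'r::ring_1) \<Rightarrow> nat \<Rightarrow> nat \<Rightarrow> 'r" where
  "mirror n par E i j = (if par (rev_index n i) \<and> \<not> par (rev_index n j) then 1 else - 1)
     * E (rev_index n j) (rev_index n i)"

lemma gl_relations_mirror:
  assumes "gl_relations n par E"
  shows "gl_relations n (\<lambda>i. par (rev_index n i)) (mirror n par E)"
  unfolding gl_relations_def
proof (intro allI impI)
  fix i j k l assume ijkl: "i < n" "j < n" "k < n" "l < n"
  have eq: "E (rev_index n j) (rev_index n i) * E (rev_index n l) (rev_index n k) =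
      ssign par (rev_index n j) (rev_index n i) (rev_index n l) (rev_index n k)
        * (E (rev_index n l) (rev_index n k) * E (rev_index n j) (rev_index n i))
      + ((if i = l then E (rev_index n j) (rev_index n k) else 0)
        - ssign par (rev_index n j) (rev_index n i) (rev_index n l) (rev_index n k)
          * (if j = k then E (rev_index n l) (rev_index n i) else 0))"
    using gl_relationsD[OF assms, of "rev_index n j" "rev_index n i" "rev_index n l" "rev_index n k"] ijkl
    by (simp cong: if_cong)
  \<comment> \<open>With the two factors abstracted, only signs remain to be compared in the sixteen
    parity patterns.\<close>
  define A where "A = E (rev_index n j) (rev_index n i)"
  define B where "B = E (rev_index n l) (rev_index n k)"
  note eq = eq[folded A_def B_def]
  show "mirror n par E i j * mirror n par E k l =
      ssign (\<lambda>i. par (rev_index n i)) i j k l * (mirror n par E k l * mirror n par E i j)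
      + ((if j = k then mirror n par E i l else 0)
        - ssign (\<lambda>i. par (rev_index n i)) i j k l * (if i = l then mirror n par E k j else 0))"
    unfolding mirror_def A_def[symmetric] B_def[symmetric]
    using eq
    by (cases "par (rev_index n i)"; cases "par (rev_index n j)"; cases "par (rev_index n k)"; cases "par (rev_index n l)")
       (auto simp: ssign_def)
qed

text \<open>The supertranspose has order four: its square is -1 on odd elements. Negating the parity
  function puts the sign on the other odd block and so produces the inverse.\<close>

lemma mirror_mirror:
  assumes "i < n" "j < n"
  shows "mirror n par (mirror n (\<lambda>i. \<not> par (rev_index n i)) E) i j = E i j"
  using assms by (auto simp: mirror_def)

definition fock_kernel :: "(('m, 'n) uea \<Rightarrow> fock endo) \<Rightarrow> ('m, 'n) uea set" where
  "fock_kernel \<Phi> = {x. app (\<Phi> x) vac = (\<lambda>_. 0)}"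

lemma vac_nonzero: "(\<lambda>s. c * vac s) = (\<lambda>_. 0) \<Longrightarrow> c = 0"
  by (drule fun_cong[of _ _ "(\<lambda>_. 0, {})"]) (simp add: vac_def)

text \<open>The family \<open>E\<close> is left open since the lemma is applied both to the matrix
  units and to their mirror images.\<close>

lemma free_gl_fock:
  assumes hom: "uea_hom esc \<Phi>" and E: "gl_relations n par E"
    and \<Phi>: "\<And>i j. i < n \<Longrightarrow> j < n \<Longrightarrow> \<Phi> (E i j) = fockE n par \<alpha> i j"
  shows "free_gl scal E n par (fock_kernel \<Phi>)"
proof -
  interpret scalars "scal :: complex \<Rightarrow> ('a, 'b) uea" by (rule scalars_scal)
  interpret e: scalars "esc :: complex \<Rightarrow> fock endo" by (rule scalars_esc)
  have h: "\<Phi> (x + y) = \<Phi> x + \<Phi> y" "\<Phi> (x * y) = \<Phi> x * \<Phi> y" "\<Phi> (scal c) = esc c" for x y c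
    using hom by (auto simp: uea_hom_def)
  have h0: "\<Phi> 0 = 0" using h(1)[of 0 0] by simp
  have hsum: "\<Phi> (sum f A) = (\<Sum>a\<in>A. \<Phi> (f a))" for f :: "nat \<Rightarrow> _" and A
    by (induction A rule: infinite_finite_induct) (simp_all add: h h0)
  show ?thesis
  proof
    show "0 \<in> fock_kernel \<Phi>" by (simp add: fock_kernel_def h0)
    show "x + y \<in> fock_kernel \<Phi>" if "x \<in> fock_kernel \<Phi>" "y \<in> fock_kernel \<Phi>" for x y
      using that by (simp add: fock_kernel_def h)
    show "z * x \<in> fock_kernel \<Phi>" if "x \<in> fock_kernel \<Phi>" for x z
      using that by (simp add: fock_kernel_def h app_zero)
    show "c = 0" if "scal c \<in> fock_kernel \<Phi>" for c
      using that vac_nonzero by (simp add: fock_kernel_def h)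
    show "u k \<in> fock_kernel \<Phi>"
      if "j < n" and u: "\<And>k. u k \<in> upper_subalgebra scal E n j"
        and sum: "(\<Sum>k\<in>{j<..<n}. E k j * u k) \<in> fock_kernel \<Phi>" and k: "j < k" "k < n" for j u k
    proof -
      have up: "\<Phi> x \<in> upper_subalgebra esc (fockE n par \<alpha>) n j" if "x \<in> upper_subalgebra scal E n j" for x
        using that by induction (auto simp: h \<Phi> intro: upper_subalgebra.intros)
      have "app (\<Sum>k\<in>{j<..<n}. fockE n par \<alpha> k j * \<Phi> (u k)) vac = (\<lambda>_. 0)"
        using sum \<Phi> \<open>j < n\<close> by (simp add: fock_kernel_def hsum h)
      from fock_free[OF \<open>j < n\<close> up[OF u] this k] show ?thesis
        by (simp add: fock_kernel_def)
    qed
  qed (rule E)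
qed

lemma fock_kernel_upper:
  assumes "\<Phi> (E i j) = fockE n par \<alpha> i j" "i < j"
  shows "E i j \<in> fock_kernel \<Phi>"
  using assms by (simp add: fock_kernel_def fockE_vac_upper)

lemma fock_kernel_diagonal:
  assumes "uea_hom esc \<Phi>" "\<Phi> (E i i) = fockE n par \<alpha> i i" "i < n"
  shows "E i i + scal c \<in> fock_kernel \<Phi> \<longleftrightarrow> c = - (\<alpha> i + vac_shift n par i)"
proof -
  have h: "\<Phi> (x + y) = \<Phi> x + \<Phi> y" "\<Phi> (scal c) = esc c" for x y c
    using assms by (auto simp: uea_hom_def)
  have "app (\<Phi> (E i i + scal c)) vac = (\<lambda>s. (\<alpha> i + vac_shift n par i + c) * vac s)"
    by (simp add: h assms fockE_vac_diagonal algebra_simps)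
  then have "E i i + scal c \<in> fock_kernel \<Phi> \<longleftrightarrow> \<alpha> i + vac_shift n par i + c = 0"
    using vac_nonzero[of "\<alpha> i + vac_shift n par i + c"] by (auto simp: fock_kernel_def)
  then show ?thesis
    by (metis add.commute eq_neg_iff_add_eq_0)
qed

section \<open>Numbering the indices, and the free left ideals above the Verma ideal\<close>

lemma prec_total: "i \<prec> j \<or> i = j \<or> j \<prec> i"
  by (cases i; cases j) auto

definition rank :: "'m::{finite,linorder} + 'n::{finite,linorder} \<Rightarrow> nat" where
  "rank k = card {l. l \<prec> k}"

definition gl_dim :: "('m + 'n) itself \<Rightarrow> nat" where
  "gl_dim _ = card (UNIV :: ('m + 'n) set)"

definition ix :: "nat \<Rightarrow> 'm::{finite,linorder} + 'n::{finite,linorder}" where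
  "ix = inv rank"

lemma rank_mono: "i \<prec> j \<Longrightarrow> rank i < rank j"
  unfolding rank_def
  by (rule psubset_card_mono) (auto intro: prec_trans simp: psubset_eq set_eq_iff dest: prec_irrefl[THEN notE])

lemma rank_less_iff: "rank i < rank j \<longleftrightarrow> i \<prec> j"
  using prec_total[of i j] rank_mono[of i j] rank_mono[of j i] by (auto simp: prec_irrefl)

lemma inj_rank: "inj (rank :: 'm::{finite,linorder} + 'n::{finite,linorder} \<Rightarrow> nat)"
  by (rule injI) (metis less_irrefl prec_total rank_mono)

lemma rank_eq_iff [simp]: "rank i = rank j \<longleftrightarrow> i = j"
  using inj_rank by (auto dest: injD)

lemma rank_less [simp]: "rank (i :: 'm::{finite,linorder} + 'n::{finite,linorder}) < gl_dim TYPE('m + 'n)"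
  unfolding rank_def gl_dim_def by (rule psubset_card_mono) (use prec_irrefl[of i] in auto)

lemma ix_rank [simp]: "ix (rank i) = i"
  by (simp add: ix_def inv_f_f inj_rank)

lemma rank_ix [simp]:
  assumes "k < gl_dim TYPE('m::{finite,linorder} + 'n::{finite,linorder})"
  shows "rank (ix k :: 'm + 'n) = k"
proof -
  have "range (rank :: 'm + 'n \<Rightarrow> nat) = {..<gl_dim TYPE('m + 'n)}"
    by (rule card_subset_eq) (auto simp: card_image inj_rank gl_dim_def[symmetric])
  then show ?thesis
    using assms unfolding ix_def by (intro f_inv_into_f) auto
qed

lemma ix_eq_iff [simp]:
  "k < gl_dim TYPE('m::{finite,linorder} + 'n::{finite,linorder}) \<Longrightarrow> l < gl_dim TYPE('m + 'n) \<Longrightarrow>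
    (ix k :: 'm + 'n) = ix l \<longleftrightarrow> k = l"
  by (metis rank_ix)

lemma ix_prec_iff [simp]:
  "k < gl_dim TYPE('m::{finite,linorder} + 'n::{finite,linorder}) \<Longrightarrow> l < gl_dim TYPE('m + 'n) \<Longrightarrow>
    (ix k :: 'm + 'n) \<prec> ix l \<longleftrightarrow> k < l"
  by (metis rank_ix rank_less_iff)

definition eN :: "nat \<Rightarrow> nat \<Rightarrow> ('m::{finite,linorder}, 'n::{finite,linorder}) uea" where
  "eN k l = e_unit (ix k) (ix l)"

definition parN :: "('m::{finite,linorder} + 'n::{finite,linorder}) itself \<Rightarrow> nat \<Rightarrow> bool" where
  "parN _ k = isl (ix k :: 'm + 'n)"

lemma ssign_parN:
  "ssign (parN TYPE('m::{finite,linorder} + 'n::{finite,linorder})) i j k l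
    = super_sign (ix i :: 'm + 'n) (ix j) (ix k) (ix l)"
  by (simp add: ssign_def super_sign_eq parN_def)

lemma e_unit_swap:
  "e_unit i j * e_unit k l = super_sign i j k l * (e_unit k l * e_unit i j)
     + ((if j = k then e_unit i l else 0) - super_sign i j k l * (if i = l then e_unit k j else 0))"
  using e_unit_relation[of i j k l] by (simp add: diff_eq_eq add.commute)

lemma gl_relations_eN:
  "gl_relations (gl_dim TYPE('m + 'n)) (parN TYPE('m + 'n))
    (eN :: nat \<Rightarrow> nat \<Rightarrow> ('m::{finite,linorder}, 'n::{finite,linorder}) uea)"
  unfolding gl_relations_def ssign_parN eN_def
proof (intro allI impI)
  fix i j k l assume "i < gl_dim TYPE('m + 'n)" "j < gl_dim TYPE('m + 'n)" "k < gl_dim TYPE('m + 'n)" "l < gl_dim TYPE('m + 'n)"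
  then have eq: "j = k \<longleftrightarrow> (ix j :: 'm + 'n) = ix k" "i = l \<longleftrightarrow> (ix i :: 'm + 'n) = ix l"
    by simp_all
  show "(e_unit (ix i) (ix j) :: ('m, 'n) uea) * e_unit (ix k) (ix l) =
    super_sign (ix i :: 'm + 'n) (ix j) (ix k) (ix l) * (e_unit (ix k) (ix l) * e_unit (ix i) (ix j))
     + ((if j = k then e_unit (ix i) (ix l) else 0)
       - super_sign (ix i :: 'm + 'n) (ix j) (ix k) (ix l) * (if i = l then e_unit (ix k) (ix j) else 0))"
    unfolding eq by (rule e_unit_swap)
qed

lemma (in scalars) uea_hom_eN:
  fixes F :: "nat \<Rightarrow> nat \<Rightarrow> 'r"
  assumes F: "gl_relations (gl_dim TYPE('m::{finite,linorder} + 'n::{finite,linorder})) (parN TYPE('m + 'n)) F"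
  obtains \<Phi> :: "('m::{finite,linorder}, 'n::{finite,linorder}) uea \<Rightarrow> 'r"
  where "uea_hom sc \<Phi>" "\<And>i j. i < gl_dim TYPE('m + 'n) \<Longrightarrow> j < gl_dim TYPE('m + 'n) \<Longrightarrow> \<Phi> (eN i j) = F i j"
proof -
  have "F (rank i) (rank j) * F (rank k) (rank l) - super_sign i j k l * (F (rank k) (rank l) * F (rank i) (rank j)) =
      (if j = k then F (rank i) (rank l) else 0) - super_sign i j k l * (if i = l then F (rank k) (rank j) else 0)"
    for i j k l :: "'m + 'n"
    using gl_relationsD[OF F, of "rank i" "rank j" "rank k" "rank l"]
    by (simp add: ssign_parN)
  from uea_hom_exists[of "\<lambda>i j. F (rank i) (rank j)", OF this]
  obtain \<Phi> :: "('m, 'n) uea \<Rightarrow> 'r" where "uea_hom sc \<Phi>" "\<And>i j. \<Phi> (e_unit i j) = F (rank i) (rank j)"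
    by blast
  then have "\<Phi> (eN i j) = F i j" if "i < gl_dim TYPE('m + 'n)" "j < gl_dim TYPE('m + 'n)" for i j
    using that by (simp add: eN_def)
  with \<open>uea_hom sc \<Phi>\<close> show ?thesis by (rule that)
qed

lemma verma_ideal_subset:
  assumes J: "0 \<in> J" "\<And>x y. x \<in> J \<Longrightarrow> y \<in> J \<Longrightarrow> x + y \<in> J" "\<And>u x. x \<in> J \<Longrightarrow> u * x \<in> J"
    and up: "\<And>i j. i < j \<Longrightarrow> j < gl_dim TYPE('m + 'n) \<Longrightarrow> eN i j \<in> J"
    and diag: "\<And>i. i < gl_dim TYPE('m + 'n) \<Longrightarrow> eN i i - scal (lam (ix i)) \<in> J"
  shows "verma_ideal (lam :: ('m::{finite,linorder}, 'n::{finite,linorder}) weight) \<subseteq> J"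
proof
  fix x assume "x \<in> verma_ideal lam"
  then show "x \<in> J"
    unfolding verma_ideal_def
  proof (induction rule: left_ideal.induct)
    case (step s x u)
    from step.hyps(1) have "s \<in> J"
    proof
      assume "s \<in> n_plus_units"
      then obtain i j where s: "s = e_unit i j" "i \<prec> j" by (auto simp: n_plus_units_def)
      then show "s \<in> J"
        using up[of "rank i" "rank j"] by (simp add: eN_def rank_mono)
    next
      assume "s \<in> {e_unit i i - scal (lam i) |i. True}"
      then obtain i where "s = e_unit i i - scal (lam i)" by blast
      then show "s \<in> J" using diag[of "rank i"] by (simp add: eN_def)
    qed
    then show ?case using step.IH J by blast
  qed (rule J)
qed

lemma free_ideal:
  fixes lam :: "('m::{finite,linorder}, 'n::{finite,linorder}) weight"
  obtains J where "free_gl scal eN (gl_dim TYPE('m + 'n)) (parN TYPE('m + 'n)) J" "verma_ideal lam \<subseteq> J"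
proof -
  interpret e: scalars "esc :: complex \<Rightarrow> fock endo" by (rule scalars_esc)
  interpret s: scalars "scal :: complex \<Rightarrow> ('m, 'n) uea" by (rule scalars_scal)
  let ?n = "gl_dim TYPE('m + 'n)" and ?par = "parN TYPE('m + 'n)"
  \<comment> \<open>Chosen so that e_{k,k} acts on the vacuum by exactly \<lambda>_k.\<close>
  define \<alpha> where "\<alpha> k = lam (ix k) - vac_shift ?n ?par k" for k
  obtain \<Phi> :: "('m, 'n) uea \<Rightarrow> fock endo" where \<Phi>: "uea_hom esc \<Phi>"
    "\<And>i j. i < ?n \<Longrightarrow> j < ?n \<Longrightarrow> \<Phi> (eN i j) = fockE ?n ?par \<alpha> i j"
    using e.uea_hom_eN[OF gl_relations_fockE] by blast
  interpret free_gl scal eN ?n ?par "fock_kernel \<Phi>"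
    by (rule free_gl_fock[OF \<Phi>(1) gl_relations_eN \<Phi>(2)])
  show ?thesis
  proof
    show "free_gl scal eN ?n ?par (fock_kernel \<Phi>)" by unfold_locales
    show "verma_ideal lam \<subseteq> fock_kernel \<Phi>"
    proof (rule verma_ideal_subset)
      fix i j assume "i < j" "j < ?n"
      then show "eN i j \<in> fock_kernel \<Phi>"
        using fock_kernel_upper[of \<Phi> eN i j, OF \<Phi>(2)] by simp
    next
      fix i assume "i < ?n"
      then show "eN i i - scal (lam (ix i)) \<in> fock_kernel \<Phi>"
        using fock_kernel_diagonal[of \<Phi> eN i ?n ?par \<alpha> "- lam (ix i)"] \<Phi>
        by (simp add: s.sc_uminus \<alpha>_def)
    qed (auto intro: J_0 J_add J_mult)
  qed
qed

lemma gl_relations_uminus_parity: "gl_relations n (\<lambda>i. \<not> par i) E \<longleftrightarrow> gl_relations n par E"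
  by (simp add: gl_relations_def ssign_def)

lemma gl_relations_cong:
  "(\<And>i. i < n \<Longrightarrow> par i = par' i) \<Longrightarrow> gl_relations n par E \<Longrightarrow> gl_relations n par' E"
proof -
  assume par: "\<And>i. i < n \<Longrightarrow> par i = par' i" and E: "gl_relations n par E"
  show ?thesis
    unfolding gl_relations_def
  proof (intro allI impI)
    fix i j k l assume "i < n" "j < n" "k < n" "l < n"
    moreover from this have "(ssign par i j k l :: 'a) = ssign par' i j k l"
      by (simp add: ssign_def par)
    ultimately show "E i j * E k l = ssign par' i j k l * (E k l * E i j)
       + ((if j = k then E i l else 0) - ssign par' i j k l * (if i = l then E k j else 0))"
      using gl_relationsD[OF E, of i j k l] by simp
  qed
qed

lemma free_ideal_mirror:
  fixes lam :: "('m::{finite,linorder}, 'n::{finite,linorder}) weight"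
  obtains J where "free_gl scal (mirror (gl_dim TYPE('m + 'n)) (parN TYPE('m + 'n)) eN) (gl_dim TYPE('m + 'n))
      (\<lambda>i. parN TYPE('m + 'n) (rev_index (gl_dim TYPE('m + 'n)) i)) J" "verma_ideal lam \<subseteq> J"
proof -
  interpret e: scalars "esc :: complex \<Rightarrow> fock endo" by (rule scalars_esc)
  interpret s: scalars "scal :: complex \<Rightarrow> ('m, 'n) uea" by (rule scalars_scal)
  let ?n = "gl_dim TYPE('m + 'n)"
  let ?rev = "rev_index ?n" and ?par = "parN TYPE('m + 'n)"
  let ?par' = "\<lambda>i. ?par (?rev i)"
  let ?m = "mirror ?n ?par :: (nat \<Rightarrow> nat \<Rightarrow> ('m, 'n) uea) \<Rightarrow> nat \<Rightarrow> nat \<Rightarrow> ('m, 'n) uea"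
  \<comment> \<open>The mirror image of e_{k,k} is minus the unit at the reversed index, hence the
    sign of \<open>lam\<close>.\<close>
  define \<alpha> where "\<alpha> k = - lam (ix (?rev k)) - vac_shift ?n ?par' k" for k
  let ?F = "fockE ?n ?par' \<alpha>"
  have "gl_relations ?n (\<lambda>i. \<not> ?par' i) ?F"
    unfolding gl_relations_uminus_parity by (rule gl_relations_fockE)
  from gl_relations_mirror[OF this]
  have "gl_relations ?n (\<lambda>i. ?par (?rev (?rev i))) (mirror ?n (\<lambda>i. \<not> ?par' i) ?F)"
    by (simp add: gl_relations_uminus_parity)
  then have "gl_relations ?n ?par (mirror ?n (\<lambda>i. \<not> ?par' i) ?F)"
    by (rule gl_relations_cong[rotated]) simp
  \<comment> \<open>Since the mirrored generators are to act as \<open>fockE\<close>, the generators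
    themselves are sent to the inverse mirror image of these operators.\<close>
  then obtain \<Phi> :: "('m, 'n) uea \<Rightarrow> fock endo" where \<Phi>: "uea_hom esc \<Phi>"
    "\<And>i j. i < ?n \<Longrightarrow> j < ?n \<Longrightarrow> \<Phi> (eN i j) = mirror ?n (\<lambda>i. \<not> ?par' i) ?F i j"
    using e.uea_hom_eN by blast
  have h: "\<Phi> (x + y) = \<Phi> x + \<Phi> y" "\<Phi> (x * y) = \<Phi> x * \<Phi> y" "\<Phi> (scal c) = esc c" for x y c
    using \<Phi>(1) by (auto simp: uea_hom_def)
  have h1: "\<Phi> 1 = 1" "\<Phi> (- 1) = - 1"
    using h(3)[of 1] h(3)[of "- 1"] by (simp_all add: s.sc_1 e.sc_1 s.sc_uminus e.sc_uminus)
  have \<Phi>': "\<Phi> (?m eN i j) = ?F i j" if "i < ?n" "j < ?n" for i j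
  proof -
    have "\<Phi> (?m eN i j) = mirror ?n ?par (mirror ?n (\<lambda>i. \<not> ?par' i) ?F) i j"
      using that unfolding mirror_def[of ?n ?par] by (simp add: h h1 \<Phi>(2))
    also have "\<dots> = ?F i j" by (rule mirror_mirror[OF that])
    finally show ?thesis .
  qed
  interpret free_gl scal "?m eN" ?n ?par' "fock_kernel \<Phi>"
    by (rule free_gl_fock[OF \<Phi>(1) gl_relations_mirror[OF gl_relations_eN] \<Phi>'])
  show ?thesis
  proof
    show "free_gl scal (?m eN) ?n ?par' (fock_kernel \<Phi>)" by unfold_locales
    have eN: "eN i j = (if ?par j \<and> \<not> ?par i then 1 else - 1) * ?m eN (?rev j) (?rev i)"
      if "i < ?n" "j < ?n" for i j
      using that by (auto simp: mirror_def)
    show "verma_ideal lam \<subseteq> fock_kernel \<Phi>"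
    proof (rule verma_ideal_subset)
      fix i j assume "i < j" "j < ?n"
      then have "?m eN (?rev j) (?rev i) \<in> fock_kernel \<Phi>"
        using fock_kernel_upper[of \<Phi> "?m eN" "?rev j" "?rev i", OF \<Phi>'] by simp
      then show "eN i j \<in> fock_kernel \<Phi>"
        using \<open>i < j\<close> \<open>j < ?n\<close> eN[of i j] J_mult by simp
    next
      fix i assume i: "i < ?n"
      have "?m eN (?rev i) (?rev i) + scal (lam (ix i)) \<in> fock_kernel \<Phi>"
        using fock_kernel_diagonal[of \<Phi> "?m eN" "?rev i" ?n ?par' \<alpha> "lam (ix i)"] \<Phi>(1) \<Phi>' i
        by (simp add: \<alpha>_def)
      then have "- 1 * (?m eN (?rev i) (?rev i) + scal (lam (ix i))) \<in> fock_kernel \<Phi>"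
        by (rule J_mult)
      then show "eN i i - scal (lam (ix i)) \<in> fock_kernel \<Phi>"
        using eN[OF i i] by simp
    qed (auto intro: J_0 J_add J_mult)
  qed
qed

section \<open>Shapovalov elements as chains\<close>

text \<open>Only the word of \<open>a0\<close> is simple, so it alone contributes to the coefficient
  and no cancellation can occur.\<close>

lemma (in free_gl) chain_combination:
  assumes "N < n" "j < n" "finite A" "a0 \<in> A" "h a0 \<noteq> 0"
    and ws: "\<And>a. a \<in> A \<Longrightarrow> lower_word n (ws a) \<and> wt_word (ws a) = path_wt j N \<and> (simple_word (ws a) \<longleftrightarrow> a = a0)"
  shows "\<exists>c. c \<noteq> 0 \<and> chain sc E N j (\<Sum>a\<in>A. sc (h a) * word E (ws a)) c"
proof -
  have "\<exists>c. chain sc E N j (word E (ws a)) c \<and> (c \<noteq> 0 \<longleftrightarrow> a = a0)" if "a \<in> A" for a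
    using word_chain[OF \<open>N < n\<close> \<open>j < n\<close>] ws[OF that] by metis
  then obtain c where c: "\<And>a. a \<in> A \<Longrightarrow> chain sc E N j (word E (ws a)) (c a)"
      "\<And>a. a \<in> A \<Longrightarrow> c a \<noteq> 0 \<longleftrightarrow> a = a0"
    by metis
  have "j \<le> N" using chain_le[OF \<open>N < n\<close> c(1)[OF \<open>a0 \<in> A\<close>]] .
  then have "chain sc E N j (\<Sum>a\<in>A. sc (h a) * word E (ws a)) (\<Sum>a\<in>A. h a * c a)"
    using c(1) by (intro chain_sum \<open>N < n\<close> \<open>finite A\<close> chain_sc) auto
  moreover have "(\<Sum>a\<in>A. h a * c a) = (\<Sum>a\<in>{a0}. h a * c a)"
    using assms(3,4) c(2) by (intro sum.mono_neutral_right) auto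
  ultimately show ?thesis
    using c(2)[OF \<open>a0 \<in> A\<close>] \<open>h a0 \<noteq> 0\<close> by (intro exI[of _ "\<Sum>a\<in>A. h a * c a"]) simp
qed

section \<open>Words of lowering operators, their weights and Kostant partitions\<close>

lemma wt_word_append: "wt_word (xs @ ys) k = wt_word xs k + wt_word ys k"
  by (simp add: wt_word_def)

lemma wt_word_outside: "lower_word n ws \<Longrightarrow> n \<le> k \<Longrightarrow> wt_word ws k = 0"
  by (induction ws) (auto simp: wt_word_def lower_word_def)

lemma wt_word_replicate: "wt_word (replicate m (a, b)) k = int m * (of_bool (k = b) - of_bool (k = a))"
  by (induction m) (auto simp: wt_word_def algebra_simps)

text \<open>A simple letter \<open>(Suc b, b)\<close> has partial weight sums 0 except for a 1 at t
  = b. So the weight of a simple word determines its letters with multiplicity.\<close>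

lemma sum_wt_word_simple: "simple_word ws \<Longrightarrow> (\<Sum>k\<le>t. wt_word ws k) = int (count_list ws (Suc t, t))"
proof (induction ws)
  case (Cons x ws)
  then obtain b where x: "x = (Suc b, b)" by (cases x) (auto simp: simple_word_def)
  have "(\<Sum>k\<le>t. wt_word (x # ws) k) = (\<Sum>k\<le>t. (if k = b then 1 else 0) - (if k = Suc b then 1 else 0)) + (\<Sum>k\<le>t. wt_word ws k)"
    unfolding sum.distrib[symmetric] by (intro sum.cong) (auto simp: wt_word_def x)
  also have "(\<Sum>k\<le>t. (if k = b then 1 else 0) - (if k = Suc b then 1 else 0)) = (of_bool (b = t) :: int)"
    by (auto simp: sum_subtractf)
  finally show ?case
    using Cons by (auto simp: x simple_word_def)
qed (simp add: wt_word_def)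

text \<open>The same product expressed in the mirrored generators: letters are relabelled but keep
  their order.\<close>

definition mirror_word :: "nat \<Rightarrow> (nat \<times> nat) list \<Rightarrow> (nat \<times> nat) list" where
  "mirror_word n ws = map (\<lambda>(a, b). (rev_index n b, rev_index n a)) ws"

lemma (in scalars) word_mirror:
  "lower_word n ws \<Longrightarrow> \<exists>s. s \<noteq> 0 \<and> word E ws = sc s * word (mirror n par E) (mirror_word n ws)"
proof (induction ws)
  case Nil
  then show ?case by (auto simp: word_def mirror_word_def sc_1 intro: exI[of _ 1])
next
  case (Cons x ws)
  then obtain s where s: "s \<noteq> 0" "word E ws = sc s * word (mirror n par E) (mirror_word n ws)"
    by (auto simp: lower_word_def)
  obtain a b where x: "x = (a, b)" by (cases x)
  then have ab: "a < n" "b < n" using Cons.prems by (auto simp: lower_word_def)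
  define t :: complex where "t = (if par b \<and> \<not> par a then 1 else - 1)"
  have "E a b = sc t * mirror n par E (rev_index n b) (rev_index n a)"
    using ab by (auto simp: t_def mirror_def sc_1 sc_uminus)
  then have "word E (x # ws) = sc (t * s) * word (mirror n par E) (mirror_word n (x # ws))"
    using s(2) by (simp add: word_def mirror_word_def x sc_mult mult.assoc sc_left_commute[of _ s])
  moreover have "t * s \<noteq> 0" using s(1) by (simp add: t_def)
  ultimately show ?case by blast
qed

lemma lower_mirror_word: "lower_word n ws \<Longrightarrow> lower_word n (mirror_word n ws)"
  by (force simp: lower_word_def mirror_word_def)

lemma wt_mirror_word:
  assumes "lower_word n ws" "wt_word ws = path_wt j N" "j < n" "N < n"
  shows "wt_word (mirror_word n ws) = path_wt (rev_index n N) (rev_index n j)"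
proof
  fix k
  show "wt_word (mirror_word n ws) k = path_wt (rev_index n N) (rev_index n j) k"
  proof (cases "k < n")
    case True
    have iff: "k = rev_index n a \<longleftrightarrow> rev_index n k = a" if "a < n" for a
      using that True by (metis rev_index_simps(2))
    have "wt_word (mirror_word n ws) k = - wt_word ws (rev_index n k)"
      using assms(1) by (induction ws) (auto simp: wt_word_def mirror_word_def lower_word_def iff)
    then show ?thesis
      using assms by (simp add: path_wt_def iff)
  next
    case False
    moreover from False assms have "k \<noteq> rev_index n N" "k \<noteq> rev_index n j" by force+
    ultimately show ?thesis
      using wt_word_outside[OF lower_mirror_word[OF assms(1)]] by (simp add: path_wt_def)
  qed
qed

lemma simple_mirror_word: "lower_word n ws \<Longrightarrow> simple_word (mirror_word n ws) \<longleftrightarrow> simple_word ws"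
  by (fastforce simp: lower_word_def simple_word_def mirror_word_def rev_index_def)

definition root_word ::
    "('m::{finite,linorder}, 'n::{finite,linorder}) root list \<Rightarrow> (('m, 'n) root \<Rightarrow> nat) \<Rightarrow> (nat \<times> nat) list" where
  "root_word rs \<pi> = concat (map (\<lambda>\<alpha>. replicate (\<pi> \<alpha>) (rank (snd \<alpha>), rank (fst \<alpha>))) rs)"

lemma e_neg_root_word: "e_neg rs \<pi> = word eN (root_word rs \<pi>)"
proof (induction rs)
  case (Cons \<alpha> rs)
  have "word eN (replicate k (rank (snd \<alpha>), rank (fst \<alpha>)) @ ws) = e_unit (snd \<alpha>) (fst \<alpha>) ^ k * word eN ws" for k ws
    by (induction k) (simp_all add: word_def eN_def mult.assoc)
  with Cons show ?case by (simp add: root_word_def e_neg_def)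
qed (simp add: root_word_def e_neg_def word_def)

lemma set_root_word: "set (root_word rs \<pi>) = {(rank (snd \<alpha>), rank (fst \<alpha>)) |\<alpha>. \<alpha> \<in> set rs \<and> \<pi> \<alpha> \<noteq> 0}"
  by (auto simp: root_word_def)

lemma lower_root_word:
  fixes rs :: "('m::{finite,linorder}, 'n::{finite,linorder}) root list"
  assumes "set rs = pos_roots"
  shows "lower_word (gl_dim TYPE('m + 'n)) (root_word rs \<pi>)"
  using assms by (auto simp: lower_word_def set_root_word pos_roots_def rank_mono)

lemma wt_root_word: "of_int (wt_word (root_word rs \<pi>) (rank k)) = (\<Sum>\<alpha>\<leftarrow>rs. of_nat (\<pi> \<alpha>) * wt \<alpha> k)"
  by (induction rs) (auto simp: root_word_def wt_word_append wt_word_replicate wt_def, simp add: wt_word_def)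

lemma count_root_word:
  assumes "distinct rs" "\<alpha> \<in> set rs"
  shows "count_list (root_word rs \<pi>) (rank (snd \<alpha>), rank (fst \<alpha>)) = \<pi> \<alpha>"
proof -
  have rep: "count_list (replicate k x) y = (if x = y then k else 0)" for k and x y :: "nat \<times> nat"
    by (induction k) auto
  have out: "\<alpha> \<notin> set rs \<Longrightarrow> count_list (root_word rs \<pi>) (rank (snd \<alpha>), rank (fst \<alpha>)) = 0" for rs
    by (auto simp: count_list_0_iff set_root_word prod_eq_iff)
  show ?thesis
    using assms
  proof (induction rs)
    case (Cons \<beta> rs)
    have "root_word (\<beta> # rs) \<pi> = replicate (\<pi> \<beta>) (rank (snd \<beta>), rank (fst \<beta>)) @ root_word rs \<pi>"
      by (simp add: root_word_def)
    then have cnt: "count_list (root_word (\<beta> # rs) \<pi>) (rank (snd \<alpha>), rank (fst \<alpha>))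
      = (if \<beta> = \<alpha> then \<pi> \<beta> else 0) + count_list (root_word rs \<pi>) (rank (snd \<alpha>), rank (fst \<alpha>))"
      by (simp add: rep) (metis prod.expand)
    show ?case
    proof (cases "\<beta> = \<alpha>")
      case True
      then show ?thesis using Cons.prems out[of rs] unfolding cnt by simp
    next
      case False
      then show ?thesis using Cons.prems Cons.IH unfolding cnt by simp
    qed
  qed simp
qed

lemma simple_roots_iff:
  fixes \<alpha> :: "('m::{finite,linorder}, 'n::{finite,linorder}) root"
  shows "\<alpha> \<in> simple_roots \<longleftrightarrow> rank (snd \<alpha>) = Suc (rank (fst \<alpha>))"
proof
  assume simple: "\<alpha> \<in> simple_roots"
  then have pos: "rank (fst \<alpha>) < rank (snd \<alpha>)"
    by (auto simp: simple_roots_def pos_roots_def rank_mono)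
  show "rank (snd \<alpha>) = Suc (rank (fst \<alpha>))"
  proof (rule ccontr)
    assume "rank (snd \<alpha>) \<noteq> Suc (rank (fst \<alpha>))"
    with pos have lt: "Suc (rank (fst \<alpha>)) < rank (snd \<alpha>)" by simp
    define k :: "'m + 'n" where "k = ix (Suc (rank (fst \<alpha>)))"
    have "rank k = Suc (rank (fst \<alpha>))"
      using lt rank_less[of "snd \<alpha>"] unfolding k_def by (intro rank_ix) linarith
    then have "(fst \<alpha>, k) \<in> pos_roots" "(k, snd \<alpha>) \<in> pos_roots"
      using lt by (simp_all add: pos_roots_def flip: rank_less_iff)
    moreover have "\<forall>l. wt \<alpha> l = wt (fst \<alpha>, k) l + wt (k, snd \<alpha>) l"
      by (simp add: wt_def)
    ultimately show False
      using simple unfolding simple_roots_def by blast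
  qed
next
  assume adj: "rank (snd \<alpha>) = Suc (rank (fst \<alpha>))"
  \<comment> \<open>Pairing a root with \<open>rank\<close> gives minus its height. Height is
    additive, and a sum of two positive roots has height at least 2.\<close>
  have ht: "(\<Sum>k\<in>UNIV. wt \<beta> k * of_nat (rank k)) = of_nat (rank (fst \<beta>)) - of_nat (rank (snd \<beta>))"
    for \<beta> :: "('m, 'n) root"
  proof -
    have "wt \<beta> k * of_nat (rank k) = (if k = fst \<beta> then of_nat (rank k) else 0) - (if k = snd \<beta> then of_nat (rank k) else 0)" for k
      by (simp add: wt_def)
    then show ?thesis by (simp add: sum_subtractf)
  qed
  have "False" if \<beta>: "\<beta> \<in> pos_roots" "\<gamma> \<in> pos_roots" "\<forall>k. wt \<alpha> k = wt \<beta> k + wt \<gamma> k" for \<beta> \<gamma>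
  proof -
    have "(\<Sum>k\<in>UNIV. wt \<alpha> k * of_nat (rank k)) = (\<Sum>k\<in>UNIV. wt \<beta> k * of_nat (rank k)) + (\<Sum>k\<in>UNIV. wt \<gamma> k * of_nat (rank k))"
      using \<beta>(3) by (simp add: distrib_right sum.distrib)
    then have "of_nat (rank (fst \<alpha>) + rank (snd \<beta>) + rank (snd \<gamma>)) = (of_nat (rank (snd \<alpha>) + rank (fst \<beta>) + rank (fst \<gamma>)) :: complex)"
      unfolding ht by (simp add: algebra_simps)
    then have "rank (fst \<alpha>) + rank (snd \<beta>) + rank (snd \<gamma>) = rank (snd \<alpha>) + rank (fst \<beta>) + rank (fst \<gamma>)"
      by (simp only: of_nat_eq_iff)
    moreover have "rank (fst \<beta>) < rank (snd \<beta>)" "rank (fst \<gamma>) < rank (snd \<gamma>)"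
      using \<beta> by (auto simp: pos_roots_def rank_mono)
    ultimately show False using adj by linarith
  qed
  moreover have "\<alpha> \<in> pos_roots"
    using adj by (cases \<alpha>) (simp add: pos_roots_def flip: rank_less_iff)
  ultimately show "\<alpha> \<in> simple_roots"
    unfolding simple_roots_def by blast
qed

context
  fixes rs :: "('m::{finite,linorder}, 'n::{finite,linorder}) root list"
  assumes rs: "distinct rs" "set rs = pos_roots"
begin

lemma wt_partition:
  assumes "\<pi> \<in> partitions \<gamma>"
  shows "wt_word (root_word rs \<pi>) = path_wt (rank (fst \<gamma>)) (rank (snd \<gamma>))"
proof
  fix k
  show "wt_word (root_word rs \<pi>) k = path_wt (rank (fst \<gamma>)) (rank (snd \<gamma>)) k"
  proof (cases "k < gl_dim TYPE('m + 'n)")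
    case True
    define l :: "'m + 'n" where "l = ix k"
    have k: "k = rank l" using True by (simp add: l_def)
    have "of_int (wt_word (root_word rs \<pi>) k) = (\<Sum>\<alpha>\<in>pos_roots. of_nat (\<pi> \<alpha>) * wt \<alpha> l)"
      using rs by (simp add: k wt_root_word sum_list_distinct_conv_sum_set)
    also have "\<dots> = wt \<gamma> l" using assms by (simp add: partitions_def)
    also have "\<dots> = of_int (path_wt (rank (fst \<gamma>)) (rank (snd \<gamma>)) k)"
      by (simp add: wt_def path_wt_def k)
    finally show ?thesis by (simp only: of_int_eq_iff)
  next
    case False
    then show ?thesis
      using wt_word_outside[OF lower_root_word[OF rs(2)], of k \<pi>] rank_less[of "fst \<gamma>"] rank_less[of "snd \<gamma>"]
      by (auto simp: path_wt_def)
  qed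
qed

lemma simple_partition_iff:
  assumes "\<pi> \<in> partitions \<gamma>"
  shows "simple_word (root_word rs \<pi>) \<longleftrightarrow> (\<forall>\<alpha>. \<alpha> \<notin> simple_roots \<longrightarrow> \<pi> \<alpha> = 0)"
proof -
  have out: "\<pi> \<alpha> = 0" if "\<alpha> \<notin> set rs" for \<alpha>
    using assms that unfolding rs(2) by (cases \<alpha>) (simp add: partitions_def)
  have "simple_word (root_word rs \<pi>) \<longleftrightarrow>
      (\<forall>x. (\<exists>\<alpha>. x = (rank (snd \<alpha>), rank (fst \<alpha>)) \<and> \<alpha> \<in> set rs \<and> \<pi> \<alpha> \<noteq> 0) \<longrightarrow> fst x = Suc (snd x))"
    by (simp add: simple_word_def set_root_word case_prod_beta Ball_def)
  then have "simple_word (root_word rs \<pi>) \<longleftrightarrow> (\<forall>\<alpha>. \<alpha> \<in> set rs \<longrightarrow> \<pi> \<alpha> \<noteq> 0 \<longrightarrow> \<alpha> \<in> simple_roots)"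
    unfolding simple_roots_iff by (metis fst_conv snd_conv)
  then show ?thesis using out by auto
qed

text \<open>The partial sums of the common weight up to \<open>rank (fst \<alpha>)\<close> give the
  multiplicity of the simple root \<alpha> in both partitions.\<close>

lemma simple_partition_unique:
  assumes \<pi>: "\<pi> \<in> partitions \<gamma>" "simple_word (root_word rs \<pi>)" and \<pi>': "\<pi>' \<in> partitions \<gamma>" "simple_word (root_word rs \<pi>')"
  shows "\<pi> = \<pi>'"
proof
  fix \<alpha>
  show "\<pi> \<alpha> = \<pi>' \<alpha>"
  proof (cases "\<alpha> \<in> simple_roots")
    case True
    then have adj: "rank (snd \<alpha>) = Suc (rank (fst \<alpha>))" and mem: "\<alpha> \<in> set rs"
      by (simp_all add: simple_roots_iff rs(2)) (simp add: simple_roots_def flip: simple_roots_iff)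
    have "int (\<pi> \<alpha>) = int (\<pi>' \<alpha>)"
      using sum_wt_word_simple[OF \<pi>(2), of "rank (fst \<alpha>)"] sum_wt_word_simple[OF \<pi>'(2), of "rank (fst \<alpha>)"]
      unfolding adj[symmetric] count_root_word[OF rs(1) mem] wt_partition[OF \<pi>(1)] wt_partition[OF \<pi>'(1)]
      by simp
    then show ?thesis by simp
  next
    case False
    then show ?thesis
      using simple_partition_iff \<pi> \<pi>' by metis
  qed
qed

lemma simple_partition_exists:
  assumes "(\<gamma> :: ('m, 'n) root) \<in> pos_roots"
  shows "\<exists>\<pi>\<in>partitions \<gamma>. \<forall>\<alpha>. \<alpha> \<notin> simple_roots \<longrightarrow> \<pi> \<alpha> = 0"
proof -
  \<comment> \<open>All simple roots between the two indices, once each; their sum telescopes to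
    \<gamma>.\<close>
  define S where "S = (\<lambda>t. (ix t, ix (Suc t)) :: ('m, 'n) root) ` {rank (fst \<gamma>)..<rank (snd \<gamma>)}"
  define \<pi> :: "('m, 'n) root \<Rightarrow> nat" where "\<pi> \<alpha> = of_bool (\<alpha> \<in> S)" for \<alpha>
  have n: "t < gl_dim TYPE('m + 'n)" "Suc t < gl_dim TYPE('m + 'n)" if "t < rank (snd \<gamma>)" for t
    using rank_less[of "snd \<gamma>"] that by linarith+
  have S: "S \<subseteq> simple_roots"
    using n by (auto simp: S_def simple_roots_iff)
  then have pos: "S \<subseteq> pos_roots" by (auto simp: simple_roots_def)
  have "(\<Sum>\<alpha>\<in>pos_roots. of_nat (\<pi> \<alpha>) * wt \<alpha> k) = wt \<gamma> k" for k
  proof -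
    have "(\<Sum>\<alpha>\<in>pos_roots. of_nat (\<pi> \<alpha>) * wt \<alpha> k) = (\<Sum>\<alpha>\<in>S. wt \<alpha> k)"
      using pos rs by (intro sum.mono_neutral_cong_right) (auto simp: \<pi>_def finite_set[of rs, unfolded rs(2)])
    also have "\<dots> = (\<Sum>t\<in>{rank (fst \<gamma>)..<rank (snd \<gamma>)}. wt (ix t, ix (Suc t)) k)"
      unfolding S_def by (subst sum.reindex) (auto intro!: inj_onI simp: n)
    also have "\<dots> = - (\<Sum>t\<in>{rank (fst \<gamma>)..<rank (snd \<gamma>)}. of_bool (k = ix (Suc t)) - of_bool (k = ix t))"
      unfolding sum_negf[symmetric] by (simp add: wt_def)
    also have "(\<Sum>t\<in>{rank (fst \<gamma>)..<rank (snd \<gamma>)}. of_bool (k = ix (Suc t)) - of_bool (k = ix t))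
      = (of_bool (k = snd \<gamma>) - of_bool (k = fst \<gamma>) :: complex)"
      using assms by (subst sum_Suc_diff') (auto simp: pos_roots_def rank_mono less_imp_le)
    finally show ?thesis by (simp add: wt_def)
  qed
  then have "\<pi> \<in> partitions \<gamma>"
    using pos by (auto simp: partitions_def \<pi>_def)
  moreover have "\<forall>\<alpha>. \<alpha> \<notin> simple_roots \<longrightarrow> \<pi> \<alpha> = 0"
    using S by (auto simp: \<pi>_def)
  ultimately show ?thesis by blast
qed

end

section \<open>Shapovalov vectors in the Verma module\<close>

context
  fixes lam :: "('m::{finite,linorder}, 'n::{finite,linorder}) weight"
begin

interpretation s: scalars "scal :: complex \<Rightarrow> ('m, 'n) uea" by (rule scalars_scal)

lemma verma_ideal_add: "x \<in> verma_ideal lam \<Longrightarrow> y \<in> verma_ideal lam \<Longrightarrow> x + y \<in> verma_ideal lam"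
  and verma_ideal_mult: "x \<in> verma_ideal lam \<Longrightarrow> u * x \<in> verma_ideal lam"
  and verma_ideal_0: "0 \<in> verma_ideal lam"
  by (simp_all add: verma_ideal_def left_ideal_add left_ideal_mult left_ideal.zero)

lemma verma_ideal_diff: "x \<in> verma_ideal lam \<Longrightarrow> y \<in> verma_ideal lam \<Longrightarrow> x - y \<in> verma_ideal lam"
  using verma_ideal_add[of x "- y"] verma_ideal_mult[of y "- 1"] by simp

lemma verma_ideal_sum: "(\<And>a. a \<in> A \<Longrightarrow> f a \<in> verma_ideal lam) \<Longrightarrow> sum f A \<in> verma_ideal lam"
  by (induction A rule: infinite_finite_induct) (auto intro: verma_ideal_0 verma_ideal_add)

lemma left_ideal_gen: "s \<in> S \<Longrightarrow> s \<in> left_ideal S"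
  using left_ideal.step[of s S 0 1] by (simp add: left_ideal.zero)

lemma verma_ideal_diagonal: "e_unit i i - scal (lam i) \<in> verma_ideal lam"
  unfolding verma_ideal_def by (rule left_ideal_gen) blast

lemma U_h_scalar: "x \<in> U_h \<Longrightarrow> \<exists>c. x - scal c \<in> verma_ideal lam"
  unfolding U_h_def
proof (induction rule: subalgebra.induct)
  case (gen x)
  then show ?case using verma_ideal_diagonal by blast
next
  case (scal c)
  then show ?case using verma_ideal_0 by (intro exI[of _ c]) simp
next
  case (add x y)
  then obtain a b where "x - scal a \<in> verma_ideal lam" "y - scal b \<in> verma_ideal lam" by blast
  then have "(x - scal a) + (y - scal b) \<in> verma_ideal lam" by (rule verma_ideal_add)
  then show ?case by (intro exI[of _ "a + b"]) (simp add: s.sc_add algebra_simps)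
next
  case (mult x y)
  then obtain a b where "x - scal a \<in> verma_ideal lam" "y - scal b \<in> verma_ideal lam" by blast
  then have "x * (y - scal b) + scal b * (x - scal a) \<in> verma_ideal lam"
    by (intro verma_ideal_add verma_ideal_mult)
  also have "x * (y - scal b) + scal b * (x - scal a) = x * y - scal (b * a)"
    using s.sc_central[of b x] by (simp add: s.sc_mult right_diff_distrib)
  finally show ?case by blast
qed

lemma form_add: "form (\<lambda>k. \<mu> k + \<nu> k) \<kappa> = form \<mu> \<kappa> + form \<nu> \<kappa>"
  by (simp add: form_def distrib_right sum.distrib)

lemma h_elem_verma: "h_elem \<mu> - scal (form lam \<mu>) \<in> verma_ideal lam"
proof -
  have "h_elem \<mu> - scal (form lam \<mu>) =
    (\<Sum>r\<in>UNIV. scal (\<mu> (Inl r)) * (e_unit (Inl r) (Inl r) - scal (lam (Inl r))))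
    - (\<Sum>t\<in>UNIV. scal (\<mu> (Inr t)) * (e_unit (Inr t) (Inr t) - scal (lam (Inr t))))"
    by (simp add: h_elem_def form_def s.sc_diff s.sc_sum right_diff_distrib sum_subtractf mult.commute flip: s.sc_mult)
  then show ?thesis
    by (auto intro!: verma_ideal_diff verma_ideal_sum verma_ideal_mult verma_ideal_diagonal)
qed

text \<open>The factor h_\<gamma> + \<rho>(h_\<gamma>) acts on the highest weight vector by
  (\<lambda> + \<rho>, \<gamma>), which vanishes for \<gamma> in B(\<lambda>).\<close>

lemma shapovalov_singular:
  assumes "shapovalov rs \<gamma> \<theta>" "\<gamma> \<in> B_set lam" "i \<prec> j"
  shows "e_unit i j * \<theta> \<in> verma_ideal lam"
proof -
  obtain u y where eq: "e_unit i j * \<theta> = u * (h_elem (wt \<gamma>) + scal (form rho (wt \<gamma>))) + y"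
      and y: "y \<in> left_ideal n_plus_units"
    using assms(1,3) unfolding shapovalov_def pos_roots_def by blast
  have "y \<in> verma_ideal lam"
    using y unfolding verma_ideal_def by (induction rule: left_ideal.induct) (auto intro: left_ideal.intros)
  moreover have "form lam (wt \<gamma>) = - form rho (wt \<gamma>)"
    using assms(2) by (simp add: B_set_def form_add eq_neg_iff_add_eq_0)
  then have "h_elem (wt \<gamma>) + scal (form rho (wt \<gamma>)) \<in> verma_ideal lam"
    using h_elem_verma[of "wt \<gamma>"] by (simp add: s.sc_uminus)
  ultimately show ?thesis
    unfolding eq by (rule verma_ideal_add[OF verma_ideal_mult, rotated])
qed

lemma shapovalov_words:
  assumes rs: "distinct rs" "set rs = pos_roots" and \<theta>: "shapovalov rs \<gamma> \<theta>" and \<gamma>: "\<gamma> \<in> pos_roots"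
  obtains h \<pi>0 where "\<pi>0 \<in> partitions \<gamma>" "h \<pi>0 \<noteq> 0"
    "\<And>\<pi>. \<pi> \<in> partitions \<gamma> \<Longrightarrow> simple_word (root_word rs \<pi>) \<longleftrightarrow> \<pi> = \<pi>0"
    "\<theta> - (\<Sum>\<pi>\<in>partitions \<gamma>. scal (h \<pi>) * word eN (root_word rs \<pi>)) \<in> verma_ideal lam"
proof -
  obtain H where H: "\<And>\<pi>. \<pi> \<in> partitions \<gamma> \<Longrightarrow> H \<pi> \<in> U_h"
      "\<And>\<pi>. \<pi> \<in> partitions \<gamma> \<Longrightarrow> (\<forall>\<alpha>. \<alpha> \<notin> simple_roots \<longrightarrow> \<pi> \<alpha> = 0) \<Longrightarrow> H \<pi> = 1"
      and sum: "\<theta> = (\<Sum>\<pi>\<in>partitions \<gamma>. e_neg rs \<pi> * H \<pi>)"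
    using \<theta> unfolding shapovalov_def by blast
  obtain \<pi>0 where \<pi>0: "\<pi>0 \<in> partitions \<gamma>" "\<forall>\<alpha>. \<alpha> \<notin> simple_roots \<longrightarrow> \<pi>0 \<alpha> = 0"
    using simple_partition_exists[OF rs \<gamma>] by blast
  have "\<forall>\<pi>. \<exists>c. \<pi> \<in> partitions \<gamma> \<longrightarrow> H \<pi> - scal c \<in> verma_ideal lam"
    using U_h_scalar H(1) by blast
  then obtain h' where h': "\<And>\<pi>. \<pi> \<in> partitions \<gamma> \<Longrightarrow> H \<pi> - scal (h' \<pi>) \<in> verma_ideal lam"
    using choice[of "\<lambda>\<pi> c. \<pi> \<in> partitions \<gamma> \<longrightarrow> H \<pi> - scal c \<in> verma_ideal lam"] by blast
  \<comment> \<open>The scalars in \<open>h'\<close> are arbitrary choices, so at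
    \<open>\<pi>0\<close> the value 1 is put in by hand, which is justified by H = 1 there. This
    makes the coefficient visibly nonzero.\<close>
  define h where "h \<pi> = (if \<pi> = \<pi>0 then 1 else h' \<pi>)" for \<pi>
  have h: "H \<pi> - scal (h \<pi>) \<in> verma_ideal lam" if "\<pi> \<in> partitions \<gamma>" for \<pi>
    using h'[OF that] H(2)[OF \<pi>0] verma_ideal_0 by (auto simp: h_def s.sc_1)
  show ?thesis
  proof
    show "\<pi>0 \<in> partitions \<gamma>" "h \<pi>0 \<noteq> 0" using \<pi>0 by (simp_all add: h_def)
    show "simple_word (root_word rs \<pi>) \<longleftrightarrow> \<pi> = \<pi>0" if "\<pi> \<in> partitions \<gamma>" for \<pi>
      using simple_partition_unique[OF rs] simple_partition_iff[OF rs] that \<pi>0 by metis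
    have "\<theta> - (\<Sum>\<pi>\<in>partitions \<gamma>. scal (h \<pi>) * word eN (root_word rs \<pi>))
        = (\<Sum>\<pi>\<in>partitions \<gamma>. e_neg rs \<pi> * (H \<pi> - scal (h \<pi>)))"
      unfolding sum by (simp add: e_neg_root_word right_diff_distrib sum_subtractf flip: s.sc_central)
    also have "\<dots> \<in> verma_ideal lam"
      using h by (intro verma_ideal_sum verma_ideal_mult) auto
    finally show "\<theta> - (\<Sum>\<pi>\<in>partitions \<gamma>. scal (h \<pi>) * word eN (root_word rs \<pi>)) \<in> verma_ideal lam" .
  qed
qed

lemma shapovalov_chain:
  assumes rs: "distinct rs" "set rs = pos_roots" and \<theta>: "shapovalov rs \<gamma> \<theta>" and \<gamma>: "\<gamma> \<in> pos_roots"
    and free: "free_gl scal eN (gl_dim TYPE('m + 'n)) (parN TYPE('m + 'n)) (J :: ('m, 'n) uea set)"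
  shows "\<exists>x c. c \<noteq> 0 \<and> chain scal eN (rank (snd \<gamma>)) (rank (fst \<gamma>)) x c \<and> \<theta> - x \<in> verma_ideal lam"
proof -
  interpret free_gl scal eN "gl_dim TYPE('m + 'n)" "parN TYPE('m + 'n)" J by (rule free)
  obtain h \<pi>0 where h: "\<pi>0 \<in> partitions \<gamma>" "h \<pi>0 \<noteq> 0"
    "\<And>\<pi>. \<pi> \<in> partitions \<gamma> \<Longrightarrow> simple_word (root_word rs \<pi>) \<longleftrightarrow> \<pi> = \<pi>0"
    "\<theta> - (\<Sum>\<pi>\<in>partitions \<gamma>. scal (h \<pi>) * word eN (root_word rs \<pi>)) \<in> verma_ideal lam"
    using shapovalov_words[OF rs \<theta> \<gamma>] by blast
  have "\<exists>c. c \<noteq> 0 \<and> chain scal eN (rank (snd \<gamma>)) (rank (fst \<gamma>))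
      (\<Sum>\<pi>\<in>partitions \<gamma>. scal (h \<pi>) * word eN (root_word rs \<pi>) :: ('m, 'n) uea) c"
  proof (rule chain_combination[OF _ _ finite_partitions h(1)])
    fix \<pi> assume \<pi>: "\<pi> \<in> partitions \<gamma>"
    show "lower_word (gl_dim TYPE('m + 'n)) (root_word rs \<pi>) \<and>
      wt_word (root_word rs \<pi>) = path_wt (rank (fst \<gamma>)) (rank (snd \<gamma>)) \<and>
      (simple_word (root_word rs \<pi>) \<longleftrightarrow> \<pi> = \<pi>0)"
      using h(3)[OF \<pi>] lower_root_word[OF rs(2)] wt_partition[OF rs \<pi>] by blast
  qed (use h(2) in simp_all)
  with h(4) show ?thesis by blast
qed

text \<open>In the mirror image a chain ends at the reversed first index of its root, so that roots
  with a common first index have chains with a common end.\<close>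

lemma shapovalov_chain_mirror:
  assumes rs: "distinct rs" "set rs = pos_roots" and \<theta>: "shapovalov rs \<gamma> \<theta>" and \<gamma>: "\<gamma> \<in> pos_roots"
  defines "n \<equiv> gl_dim TYPE('m + 'n)" and "par \<equiv> parN TYPE('m + 'n)"
  assumes free: "free_gl scal (mirror n par eN) n (\<lambda>i. par (rev_index n i)) (J :: ('m, 'n) uea set)"
  shows "\<exists>x c. c \<noteq> 0 \<and> chain scal (mirror n par eN) (rev_index n (rank (fst \<gamma>))) (rev_index n (rank (snd \<gamma>))) x c
    \<and> \<theta> - x \<in> verma_ideal lam"
proof -
  interpret free_gl scal "mirror n par eN" n "\<lambda>i. par (rev_index n i)" J by (rule free)
  obtain h \<pi>0 where h: "\<pi>0 \<in> partitions \<gamma>" "h \<pi>0 \<noteq> 0"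
    "\<And>\<pi>. \<pi> \<in> partitions \<gamma> \<Longrightarrow> simple_word (root_word rs \<pi>) \<longleftrightarrow> \<pi> = \<pi>0"
    "\<theta> - (\<Sum>\<pi>\<in>partitions \<gamma>. scal (h \<pi>) * word eN (root_word rs \<pi>)) \<in> verma_ideal lam"
    using shapovalov_words[OF rs \<theta> \<gamma>] by blast
  have low: "lower_word n (root_word rs \<pi>)" for \<pi>
    unfolding n_def by (rule lower_root_word[OF rs(2)])
  have "\<forall>\<pi>. \<exists>s. s \<noteq> 0 \<and> (word eN (root_word rs \<pi>) :: ('m, 'n) uea) = scal s * word (mirror n par eN) (mirror_word n (root_word rs \<pi>))"
    using s.word_mirror[OF low] by blast
  then obtain \<sigma> where \<sigma>: "\<And>\<pi>. \<sigma> \<pi> \<noteq> 0"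
      "\<And>\<pi>. (word eN (root_word rs \<pi>) :: ('m, 'n) uea) = scal (\<sigma> \<pi>) * word (mirror n par eN) (mirror_word n (root_word rs \<pi>))"
    using choice by metis
  have "\<exists>c. c \<noteq> 0 \<and> chain scal (mirror n par eN) (rev_index n (rank (fst \<gamma>))) (rev_index n (rank (snd \<gamma>)))
      (\<Sum>\<pi>\<in>partitions \<gamma>. scal (h \<pi> * \<sigma> \<pi>) * word (mirror n par eN) (mirror_word n (root_word rs \<pi>)) :: ('m, 'n) uea) c"
  proof (rule chain_combination[OF _ _ finite_partitions h(1)])
    show "rev_index n (rank (fst \<gamma>)) < n" "rev_index n (rank (snd \<gamma>)) < n"
      by (simp_all add: n_def)
    fix \<pi> assume \<pi>: "\<pi> \<in> partitions \<gamma>"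
    show "lower_word n (mirror_word n (root_word rs \<pi>)) \<and>
      wt_word (mirror_word n (root_word rs \<pi>)) = path_wt (rev_index n (rank (snd \<gamma>))) (rev_index n (rank (fst \<gamma>))) \<and>
      (simple_word (mirror_word n (root_word rs \<pi>)) \<longleftrightarrow> \<pi> = \<pi>0)"
      using h(3)[OF \<pi>] lower_mirror_word[OF low] simple_mirror_word[OF low]
        wt_mirror_word[OF low wt_partition[OF rs \<pi>]] by (simp add: n_def)
  qed (use h(2) \<sigma>(1) in simp)
  moreover have "(\<Sum>\<pi>\<in>partitions \<gamma>. scal (h \<pi> * \<sigma> \<pi>) * word (mirror n par eN) (mirror_word n (root_word rs \<pi>)))
      = (\<Sum>\<pi>\<in>partitions \<gamma>. scal (h \<pi>) * word eN (root_word rs \<pi>) :: ('m, 'n) uea)"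
    unfolding \<sigma>(2) by (simp add: s.sc_mult mult.assoc)
  ultimately show ?thesis using h(4) by auto
qed

text \<open>\<open>chain_factor\<close> compares chains with the same end. A common second index
  gives this directly, a common first index after mirroring. The ideal \<open>J\<close> is used for
  raising conditions only; the factorisation itself is exact, so the result holds modulo the Verma
  ideal.\<close>

theorem shapovalov_dependent:
  assumes rs: "distinct rs" "set rs = pos_roots"
    and \<theta>: "shapovalov rs \<gamma> \<theta>" "shapovalov rs \<gamma>' \<theta>'" and B: "\<gamma> \<in> B_set lam" "\<gamma>' \<in> B_set lam"
    and cases: "snd \<gamma>' = snd \<gamma> \<and> fst \<gamma> \<prec> fst \<gamma>' \<or> fst \<gamma>' = fst \<gamma> \<and> snd \<gamma>' \<prec> snd \<gamma>"
  shows "\<exists>u. \<theta> - u * \<theta>' \<in> verma_ideal lam"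
proof -
  have pos: "\<gamma> \<in> pos_roots" "\<gamma>' \<in> pos_roots"
    using B by (auto simp: B_set_def odd_pos_roots_def)
  \<comment> \<open>A chain congruent to a Shapovalov element modulo the Verma ideal inherits its
    singularity.\<close>
  have sing: "eN i l * x \<in> verma_ideal lam"
    if "shapovalov rs \<beta> \<eta>" "\<beta> \<in> B_set lam" "\<eta> - x \<in> verma_ideal lam" "i < l" "l < gl_dim TYPE('m + 'n)" for \<beta> \<eta> x i l
  proof -
    have "eN i l * \<eta> - eN i l * (\<eta> - x) \<in> verma_ideal lam"
      using that by (intro verma_ideal_diff verma_ideal_mult[OF that(3)])
        (auto simp: eN_def intro!: shapovalov_singular)
    then show ?thesis by (simp add: right_diff_distrib)
  qed
  have *: ?thesis if "\<theta> - x \<in> verma_ideal lam" "\<theta>' - w \<in> verma_ideal lam" "x = u * w" for x w u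
  proof -
    have "(\<theta> - x) - u * (\<theta>' - w) \<in> verma_ideal lam"
      by (rule verma_ideal_diff[OF that(1) verma_ideal_mult[OF that(2)]])
    then show ?thesis using that(3) by (intro exI[of _ u]) (simp add: right_diff_distrib)
  qed
  from cases show ?thesis
  proof
    assume c: "snd \<gamma>' = snd \<gamma> \<and> fst \<gamma> \<prec> fst \<gamma>'"
    obtain J where J: "free_gl scal eN (gl_dim TYPE('m + 'n)) (parN TYPE('m + 'n)) J" "verma_ideal lam \<subseteq> J"
      by (rule free_ideal)
    interpret free_gl scal eN "gl_dim TYPE('m + 'n)" "parN TYPE('m + 'n)" J by (rule J)
    obtain x a where x: "chain scal eN (rank (snd \<gamma>)) (rank (fst \<gamma>)) x a" "\<theta> - x \<in> verma_ideal lam"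
      using shapovalov_chain[OF rs \<theta>(1) pos(1) J(1)] by blast
    obtain w d where w: "d \<noteq> 0" "chain scal eN (rank (snd \<gamma>)) (rank (fst \<gamma>')) w d" "\<theta>' - w \<in> verma_ideal lam"
      using shapovalov_chain[OF rs \<theta>(2) pos(2) J(1)] c by auto
    have "\<exists>u. x = u * w"
    proof (rule chain_factor[OF _ w(2,1) _ x(1)])
      show "rank (fst \<gamma>) \<le> rank (fst \<gamma>')" using c by (simp add: rank_mono less_imp_le)
    qed (use J(2) sing[OF \<theta>(1) B(1) x(2)] sing[OF \<theta>(2) B(2) w(3)] le_less_trans[OF _ rank_less[of "snd \<gamma>"]] in auto)
    with * x w show ?thesis by blast
  next
    assume c: "fst \<gamma>' = fst \<gamma> \<and> snd \<gamma>' \<prec> snd \<gamma>"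
    let ?n = "gl_dim TYPE('m + 'n)" and ?par = "parN TYPE('m + 'n)"
    let ?E = "mirror ?n ?par eN :: nat \<Rightarrow> nat \<Rightarrow> ('m, 'n) uea" and ?rev = "rev_index ?n"
    obtain J where J: "free_gl scal ?E ?n (\<lambda>i. ?par (?rev i)) J" "verma_ideal lam \<subseteq> J"
      by (rule free_ideal_mirror)
    interpret free_gl scal ?E ?n "\<lambda>i. ?par (?rev i)" J by (rule J)
    obtain x a where x: "chain scal ?E (?rev (rank (fst \<gamma>))) (?rev (rank (snd \<gamma>))) x a" "\<theta> - x \<in> verma_ideal lam"
      using shapovalov_chain_mirror[OF rs \<theta>(1) pos(1) J(1)] by blast
    obtain w d where w: "d \<noteq> 0" "chain scal ?E (?rev (rank (fst \<gamma>))) (?rev (rank (snd \<gamma>'))) w d" "\<theta>' - w \<in> verma_ideal lam"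
      using shapovalov_chain_mirror[OF rs \<theta>(2) pos(2) J(1)] c by auto
    have mirror_sing: "?E i l * y \<in> J"
      if "shapovalov rs \<beta> \<eta>" "\<beta> \<in> B_set lam" "\<eta> - y \<in> verma_ideal lam" "i < l" "l \<le> ?rev (rank (fst \<gamma>))" for \<beta> \<eta> y i l
    proof -
      have il: "i < ?n" "l < ?n"
        using that(4,5) rev_index_simps(1)[OF rank_less[of "fst \<gamma>"]] by linarith+
      then have "eN (?rev l) (?rev i) * y \<in> J"
        using sing[OF that(1-3), of "?rev l" "?rev i"] that(4) J(2) by auto
      then show ?thesis
        using J_mult[of "eN (?rev l) (?rev i) * y" "- 1"] by (simp add: mirror_def)
    qed
    have "\<exists>u. x = u * w"
    proof (rule chain_factor[OF _ w(2,1) _ x(1)])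
      show "?rev (rank (snd \<gamma>)) \<le> ?rev (rank (snd \<gamma>'))" using c by (simp add: rank_mono less_imp_le)
    qed (use mirror_sing[OF \<theta>(1) B(1) x(2)] mirror_sing[OF \<theta>(2) B(2) w(3)] in auto)
    with * x w show ?thesis by blast
  qed
qed

end

section \<open>Separation by weights and the Casimir element\<close>

text \<open>\<open>f\<close> represents a joint eigenvector, modulo the left ideal \<open>J\<close>,
  of the commuting family \<open>op\<close> with eigenvalues \<open>ev\<close>.\<close>

locale eigenvector = scalars sc for sc :: "complex \<Rightarrow> 'r::ring_1" +
  fixes J :: "'r set" and op :: "'a \<Rightarrow> 'r" and ev :: "'a \<Rightarrow> complex" and f :: 'r
  assumes J_add: "x \<in> J \<Longrightarrow> y \<in> J \<Longrightarrow> x + y \<in> J"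
    and J_mult: "x \<in> J \<Longrightarrow> z * x \<in> J"
    and op_commute: "op a * op b = op b * op a"
    and eigen: "op a * f - sc (ev a) * f \<in> J"
begin

text \<open>Products of factors that act invertibly on the class of \<open>f\<close>. The vectors
  killed by such a product, collected in \<open>separated\<close>, replace the sum of the
  generalised eigenspaces for other eigenvalues; commutativity makes this set additive.\<close>

inductive_set annihilators :: "'r set" where
  one: "1 \<in> annihilators"
| step: "p \<in> annihilators \<Longrightarrow> t \<noteq> ev a \<Longrightarrow> (op a - sc t) * p \<in> annihilators"

definition separated :: "'r set" where
  "separated = {x. \<exists>p\<in>annihilators. p * x \<in> J}"

lemma annihilator_op: "p \<in> annihilators \<Longrightarrow> p * op a = op a * p"
proof (induction rule: annihilators.induct)
  case (step p t b)
  have "(op b - sc t) * p * op a = (op b - sc t) * op a * p"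
    using step.IH by (simp add: mult.assoc)
  also have "(op b - sc t) * op a = op a * (op b - sc t)"
    by (simp add: left_diff_distrib right_diff_distrib op_commute sc_central[of t "op a"])
  finally show ?case by (simp add: mult.assoc)
qed simp

lemma annihilators_commute: "p \<in> annihilators \<Longrightarrow> q \<in> annihilators \<Longrightarrow> p * q = q * p"
proof (induction rule: annihilators.induct)
  case (step p t a)
  have "q * ((op a - sc t) * p) = (op a - sc t) * (q * p)"
    using annihilator_op[OF step.prems, of a]
    by (simp add: left_diff_distrib right_diff_distrib sc_left_commute mult.assoc[symmetric] flip: sc_central[of t q])
  then show ?case using step by (simp add: mult.assoc)
qed simp

lemma annihilators_mult: "p \<in> annihilators \<Longrightarrow> q \<in> annihilators \<Longrightarrow> p * q \<in> annihilators"
  by (induction rule: annihilators.induct) (auto simp: mult.assoc intro: annihilators.step)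

lemma separated_J: "x \<in> J \<Longrightarrow> x \<in> separated"
  using annihilators.one by (auto simp: separated_def intro!: bexI[of _ 1])

lemma separated_add: "x \<in> separated \<Longrightarrow> y \<in> separated \<Longrightarrow> x + y \<in> separated"
proof -
  assume "x \<in> separated" "y \<in> separated"
  then obtain p q where p: "p \<in> annihilators" "p * x \<in> J" and q: "q \<in> annihilators" "q * y \<in> J"
    by (auto simp: separated_def)
  have "(p * q) * (x + y) = q * (p * x) + p * (q * y)"
    using annihilators_commute[OF p(1) q(1)] by (simp add: distrib_left mult.assoc[symmetric])
  then have "(p * q) * (x + y) \<in> J"
    using p q by (simp add: J_add J_mult)
  then show ?thesis
    using annihilators_mult[OF p(1) q(1)] unfolding separated_def by blast
qed

lemma separated_sc: "x \<in> separated \<Longrightarrow> sc c * x \<in> separated"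
  unfolding separated_def by (auto simp: sc_left_commute intro: J_mult)

lemma separated_eigen: "op a * x - sc t * x \<in> J \<Longrightarrow> t \<noteq> ev a \<Longrightarrow> x \<in> separated"
  using annihilators.step[OF annihilators.one, of t a] unfolding separated_def
  by (auto intro!: bexI[of _ "op a - sc t"] simp: left_diff_distrib)

text \<open>A product of factors \<open>op a - sc t\<close> multiplies \<open>f\<close> by the
  product of the numbers \<open>ev a - t\<close>, none of which is zero.\<close>

theorem eigenvector_separated:
  assumes "f \<in> separated" shows "f \<in> J"
proof -
  have scale: "\<exists>c. c \<noteq> 0 \<and> p * f - sc c * f \<in> J" if "p \<in> annihilators" for p
    using that
  proof (induction rule: annihilators.induct)
    case one
    have "0 * f \<in> J" using J_mult[OF eigen, of 0] by simp
    then show ?case by (intro exI[of _ 1]) (simp add: sc_1)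
  next
    case (step p t a)
    then obtain c where c: "c \<noteq> 0" "p * f - sc c * f \<in> J" by blast
    have "(op a - sc t) * (p * f - sc c * f) + sc c * (op a * f - sc (ev a) * f) \<in> J"
      using c(2) eigen by (intro J_add J_mult)
    also have "(op a - sc t) * (p * f - sc c * f) + sc c * (op a * f - sc (ev a) * f)
        = (op a - sc t) * p * f - sc ((ev a - t) * c) * f"
      by (simp add: left_diff_distrib right_diff_distrib mult.assoc sc_left_commute[of _ c] sc_mult sc_diff)
    finally show ?case
      using c(1) step.hyps(2) by (intro exI[of _ "(ev a - t) * c"]) simp
  qed
  obtain p where p: "p \<in> annihilators" "p * f \<in> J"
    using assms by (auto simp: separated_def)
  then obtain c where c: "c \<noteq> 0" "p * f - sc c * f \<in> J" using scale by blast
  have "sc (- 1 / c) * ((p * f - sc c * f) + - 1 * (p * f)) \<in> J"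
    by (rule J_mult[OF J_add[OF c(2) J_mult[OF p(2)]]])
  also have "sc (- 1 / c) * ((p * f - sc c * f) + - 1 * (p * f)) = sc (- 1 / c) * sc (- c) * f"
    by (simp add: sc_uminus mult.assoc)
  also have "\<dots> = f"
    using c(1) by (simp add: sc_1 flip: sc_mult)
  finally show ?thesis .
qed

end

section \<open>Words of lowering units and the Casimir element of gl_m\<close>

definition lower_units :: "(('m::linorder + 'n::linorder) \<times> ('m + 'n)) list \<Rightarrow> bool" where
  "lower_units w \<longleftrightarrow> (\<forall>(a, b)\<in>set w. b \<prec> a)"

definition uword :: "(('m + 'n) \<times> ('m + 'n)) list \<Rightarrow> ('m, 'n) uea" where
  "uword w = prod_list (map (\<lambda>(a, b). e_unit a b) w)"

text \<open>The weight itself, with the sign opposite to that in \<open>wt_word\<close>.\<close>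

definition uword_wt :: "(('m + 'n) \<times> ('m + 'n)) list \<Rightarrow> 'm + 'n \<Rightarrow> int" where
  "uword_wt w i = (\<Sum>(a, b)\<leftarrow>w. of_bool (i = a) - of_bool (i = b))"

lemma uword_Cons: "uword (x # w) * y = e_unit (fst x) (snd x) * (uword w * y)"
  by (simp add: uword_def case_prod_beta mult.assoc)

lemma sum_uword_wt:
  fixes w :: "(('m::{finite,linorder} + 'n::{finite,linorder}) \<times> ('m + 'n)) list"
  shows "(\<Sum>i\<in>D. uword_wt w i) = (\<Sum>(a, b)\<leftarrow>w. of_bool (a \<in> D) - of_bool (b \<in> D))"
proof (induction w)
  case (Cons x w)
  have "(\<Sum>i\<in>D. of_bool (i = fst x) - of_bool (i = snd x)) = (of_bool (fst x \<in> D) - of_bool (snd x \<in> D) :: int)"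
    by (simp add: sum_subtractf of_bool_def)
  with Cons show ?case
    by (simp add: uword_wt_def case_prod_beta sum.distrib)
qed (simp add: uword_wt_def)

text \<open>Each letter changes the total weight on \<open>D\<close> by 0 or -1, the latter exactly
  when it leads out of \<open>D\<close>.\<close>

lemma sum_uword_wt_down:
  fixes w :: "(('m::{finite,linorder} + 'n::{finite,linorder}) \<times> ('m + 'n)) list"
  assumes "\<And>a b. (a, b) \<in> set w \<Longrightarrow> a \<in> D \<Longrightarrow> b \<in> D"
  shows "(\<Sum>i\<in>D. uword_wt w i) \<le> 0"
    and "(\<Sum>i\<in>D. uword_wt w i) = 0 \<Longrightarrow> (a, b) \<in> set w \<Longrightarrow> a \<in> D \<longleftrightarrow> b \<in> D"
proof -
  have *: "(\<Sum>(a, b)\<leftarrow>w. of_bool (a \<in> D) - of_bool (b \<in> D)) \<le> (0::int) \<and>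
    ((\<Sum>(a, b)\<leftarrow>w. of_bool (a \<in> D) - of_bool (b \<in> D)) = (0::int) \<longrightarrow> (\<forall>(a, b)\<in>set w. a \<in> D \<longleftrightarrow> b \<in> D))"
    using assms
  proof (induction w)
    case (Cons x w)
    obtain a b where x: "x = (a, b)" by (cases x)
    have ab: "a \<in> D \<Longrightarrow> b \<in> D" using Cons.prems[of a b] x by simp
    have "(\<Sum>(a, b)\<leftarrow>w. of_bool (a \<in> D) - of_bool (b \<in> D)) \<le> (0::int) \<and>
      ((\<Sum>(a, b)\<leftarrow>w. of_bool (a \<in> D) - of_bool (b \<in> D)) = (0::int) \<longrightarrow> (\<forall>(a, b)\<in>set w. a \<in> D \<longleftrightarrow> b \<in> D))"
      using Cons by (intro Cons.IH) auto
    with ab show ?case by (cases "a \<in> D"; cases "b \<in> D") (auto simp: x)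
  qed simp
  then show "(\<Sum>i\<in>D. uword_wt w i) \<le> 0" by (simp add: sum_uword_wt)
  show "(\<Sum>i\<in>D. uword_wt w i) = 0 \<Longrightarrow> (a, b) \<in> set w \<Longrightarrow> a \<in> D \<longleftrightarrow> b \<in> D"
    using * unfolding sum_uword_wt by blast
qed

definition casimir :: "('m::finite, 'n) uea" where
  "casimir = (\<Sum>r\<in>UNIV. \<Sum>s\<in>UNIV. e_unit (Inl r) (Inl s) * e_unit (Inl s) (Inl r))"

text \<open>This is (\<mu>, \<mu> + 2 \<rho>_0) for gl_m, with \<rho>_0 half the sum of its positive
  roots.\<close>

definition casimir_ev :: "('m::{finite,linorder}, 'n) weight \<Rightarrow> complex" where
  "casimir_ev \<mu> = (\<Sum>r\<in>UNIV. \<Sum>s\<in>UNIV. if r = s then \<mu> (Inl r) ^ 2 else if r < s then \<mu> (Inl r) - \<mu> (Inl s) else 0)"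

lemma even_commute:
  assumes "isl k = isl l"
  shows "e_unit k l * e_unit i j = e_unit i j * e_unit k l + ((if l = i then e_unit k j else 0) - (if k = j then e_unit i l else 0))"
  using e_unit_swap[of k l i j] assms by (simp add: super_sign_eq)

text \<open>The commutators with the two factors give four sums that cancel in pairs. Units inside
  the second block are included, those between the blocks are not.\<close>

lemma casimir_commute:
  assumes "isl k = isl l"
  shows "(casimir :: ('m::finite, 'n) uea) * e_unit k l = e_unit k l * casimir"
proof -
  let ?e = "\<lambda>r s. e_unit (Inl r) (Inl s) :: ('m, 'n) uea"
  have "e_unit k l * (?e r s * ?e s r) = ?e r s * ?e s r * e_unit k l
     + ((if l = Inl r then e_unit k (Inl s) * ?e s r else 0) - (if k = Inl s then e_unit (Inl r) l * ?e s r else 0))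
     + ((if l = Inl s then ?e r s * e_unit k (Inl r) else 0) - (if k = Inl r then ?e r s * e_unit (Inl s) l else 0))" for r s
  proof -
    have "e_unit k l * (?e r s * ?e s r) = (e_unit k l * ?e r s) * ?e s r" by (simp add: mult.assoc)
    also have "\<dots> = ?e r s * (e_unit k l * ?e s r)
      + ((if l = Inl r then e_unit k (Inl s) * ?e s r else 0) - (if k = Inl s then e_unit (Inl r) l * ?e s r else 0))"
      unfolding even_commute[OF assms, of "Inl r" "Inl s"] by (simp add: algebra_simps)
    also have "?e r s * (e_unit k l * ?e s r) = ?e r s * ?e s r * e_unit k l
      + ((if l = Inl s then ?e r s * e_unit k (Inl r) else 0) - (if k = Inl r then ?e r s * e_unit (Inl s) l else 0))"
      unfolding even_commute[OF assms, of "Inl s" "Inl r"] by (simp add: algebra_simps)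
    finally show ?thesis by (simp add: algebra_simps)
  qed
  then have "e_unit k l * (casimir :: ('m, 'n) uea) = casimir * e_unit k l
    + ((\<Sum>r\<in>UNIV. \<Sum>s\<in>UNIV. if l = Inl r then e_unit k (Inl s) * ?e s r else 0)
       - (\<Sum>r\<in>UNIV. \<Sum>s\<in>UNIV. if k = Inl s then e_unit (Inl r) l * ?e s r else 0))
    + ((\<Sum>r\<in>UNIV. \<Sum>s\<in>UNIV. if l = Inl s then ?e r s * e_unit k (Inl r) else 0)
       - (\<Sum>r\<in>UNIV. \<Sum>s\<in>UNIV. if k = Inl r then ?e r s * e_unit (Inl s) l else 0))"
    by (simp add: casimir_def sum_distrib_left sum_distrib_right sum.distrib sum_subtractf)
  also have "(\<Sum>r\<in>UNIV. \<Sum>s\<in>UNIV. if k = Inl s then e_unit (Inl r) l * ?e s r else 0)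
      = (\<Sum>r\<in>UNIV. \<Sum>s\<in>UNIV. if l = Inl s then ?e r s * e_unit k (Inl r) else 0)"
  proof (cases k; cases l)
    fix p q assume "k = Inl p" "l = Inl q"
    then show ?thesis by simp
  qed (use assms in auto)
  also have "(\<Sum>r\<in>UNIV. \<Sum>s\<in>UNIV. if l = Inl r then e_unit k (Inl s) * ?e s r else 0)
      = (\<Sum>r\<in>UNIV. \<Sum>s\<in>UNIV. if k = Inl r then ?e r s * e_unit (Inl s) l else 0)"
  proof (cases k; cases l)
    fix p q assume kl: "k = Inl p" "l = Inl q"
    have "(\<Sum>r\<in>UNIV. \<Sum>s\<in>UNIV. if l = Inl r then e_unit k (Inl s) * ?e s r else 0)
      = (\<Sum>r\<in>UNIV. if r = q then \<Sum>s\<in>UNIV. ?e p s * ?e s q else 0)"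
      by (intro sum.cong) (auto simp: kl)
    also have "\<dots> = (\<Sum>r\<in>UNIV. if r = p then \<Sum>s\<in>UNIV. ?e p s * ?e s q else 0)" by simp
    also have "\<dots> = (\<Sum>r\<in>UNIV. \<Sum>s\<in>UNIV. if k = Inl r then ?e r s * e_unit (Inl s) l else 0)"
      by (intro sum.cong) (auto simp: kl)
    finally show ?thesis .
  qed (use assms in auto)
  finally show ?thesis by simp
qed

lemma casimir_uword:
  "\<forall>(a, b)\<in>set w. isl a = isl b \<Longrightarrow> casimir * uword w = uword w * casimir"
proof (induction w)
  case (Cons x w)
  then have x: "isl (fst x) = isl (snd x)" and IH: "casimir * uword w = uword w * casimir" by auto
  have "uword (x # w) = e_unit (fst x) (snd x) * uword w"
    using uword_Cons[of x w 1] by simp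
  then have "casimir * uword (x # w) = (casimir * e_unit (fst x) (snd x)) * uword w"
    by (simp add: mult.assoc)
  also have "\<dots> = e_unit (fst x) (snd x) * (casimir * uword w)"
    unfolding casimir_commute[OF x] by (simp add: mult.assoc)
  also have "\<dots> = uword (x # w) * casimir"
    unfolding IH using uword_Cons[of x w casimir] by simp
  finally show ?case .
qed (simp add: uword_def)

locale singular_vector =
  fixes J :: "('m::{finite,linorder}, 'n::{finite,linorder}) uea set" and \<theta> :: "('m, 'n) uea" and \<mu> :: "('m, 'n) weight"
  assumes J_0: "0 \<in> J" and J_add: "x \<in> J \<Longrightarrow> y \<in> J \<Longrightarrow> x + y \<in> J"
    and J_mult: "x \<in> J \<Longrightarrow> z * x \<in> J"
    and raise: "i \<prec> j \<Longrightarrow> e_unit i j * \<theta> \<in> J"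
    and weight: "e_unit i i * \<theta> - scal (\<mu> i) * \<theta> \<in> J"
begin

sublocale scalars "scal :: complex \<Rightarrow> ('m, 'n) uea" by (rule scalars_scal)

text \<open>This takes the place of the triangular decomposition of U(g): it is shown directly to
  absorb multiplication by every matrix unit.\<close>

inductive_set lower_span :: "('m, 'n) uea set" where
  J: "x \<in> J \<Longrightarrow> x \<in> lower_span"
| word: "lower_units w \<Longrightarrow> scal c * (uword w * \<theta>) \<in> lower_span"
| add: "x \<in> lower_span \<Longrightarrow> y \<in> lower_span \<Longrightarrow> x + y \<in> lower_span"

lemma lower_span_scal: "x \<in> lower_span \<Longrightarrow> scal a * x \<in> lower_span"
proof (induction rule: lower_span.induct)
  case (word w c)
  then show ?case using lower_span.word[of w "a * c"] by (simp add: sc_mult mult.assoc)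
qed (auto simp: distrib_left intro: lower_span.intros J_mult)

lemma lower_span_uminus: "x \<in> lower_span \<Longrightarrow> - x \<in> lower_span"
  using lower_span_scal[of x "- 1"] by (simp add: sc_uminus sc_1)

lemma lower_span_lower: "x \<in> lower_span \<Longrightarrow> b \<prec> a \<Longrightarrow> e_unit a b * x \<in> lower_span"
proof (induction rule: lower_span.induct)
  case (word w c)
  then have "scal c * (uword ((a, b) # w) * \<theta>) \<in> lower_span"
    by (intro lower_span.word) (simp add: lower_units_def)
  then show ?case by (simp add: uword_Cons sc_left_commute)
qed (auto simp: distrib_left intro: lower_span.intros J_mult)

lemma lower_span_uword: "lower_units w \<Longrightarrow> uword w * \<theta> \<in> lower_span"
  using lower_span.word[of w 1] by (simp add: sc_1)

text \<open>Moving a unit past the first letter leaves single units applied to the shorter word.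
  They may be of any kind, so the induction runs over all \<open>i\<close> and
  \<open>j\<close>.\<close>

lemma unit_uword: "lower_units w \<Longrightarrow> e_unit i j * (uword w * \<theta>) \<in> lower_span"
proof (induction w arbitrary: i j)
  case Nil
  show ?case
  proof -
    consider "i \<prec> j" | "i = j" | "j \<prec> i" using prec_total by blast
    then show ?thesis
    proof cases
      case 1
      then show ?thesis using raise lower_span.J by (simp add: uword_def)
    next
      case 2
      have "(e_unit i i * \<theta> - scal (\<mu> i) * \<theta>) + scal (\<mu> i) * (uword [] * \<theta>) \<in> lower_span"
        using weight by (intro lower_span.intros) (auto simp: lower_units_def)
      then show ?thesis using 2 by (simp add: uword_def)
    next
      case 3
      then show ?thesis using lower_span_uword[OF Nil] by (rule lower_span_lower[rotated])
    qed
  qed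
next
  case (Cons x w)
  obtain a b where x: "x = (a, b)" by (cases x)
  have ab: "b \<prec> a" and w: "lower_units w" using Cons.prems by (auto simp: lower_units_def x)
  let ?v = "uword w * \<theta>" and ?s = "super_sign i j a b :: ('m, 'n) uea"
  have s: "?s * y \<in> lower_span" if "y \<in> lower_span" for y
    using that by (auto simp: super_sign_def intro: lower_span_uminus)
  have "e_unit i j * (uword (x # w) * \<theta>) = (e_unit i j * e_unit a b) * ?v"
    by (simp add: uword_Cons x mult.assoc)
  also have "\<dots> = ?s * (e_unit a b * (e_unit i j * ?v))
      + ((if j = a then e_unit i b * ?v else 0) + - (?s * (if i = b then e_unit a j * ?v else 0)))"
    unfolding e_unit_swap[of i j] by (simp add: algebra_simps)
  also have "\<dots> \<in> lower_span"
  proof (intro lower_span.add)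
    show "?s * (e_unit a b * (e_unit i j * ?v)) \<in> lower_span"
      by (intro s lower_span_lower[OF Cons.IH[OF w] ab])
    show "(if j = a then e_unit i b * ?v else 0) \<in> lower_span"
      using Cons.IH[OF w] by (auto intro: lower_span.J J_0)
    show "- (?s * (if i = b then e_unit a j * ?v else 0)) \<in> lower_span"
      using Cons.IH[OF w] by (intro lower_span_uminus s) (auto intro: lower_span.J J_0)
  qed
  finally show ?case .
qed

lemma submodule_lower_span: "u * \<theta> \<in> lower_span"
proof -
  have mult: "e_unit i j * x \<in> lower_span" if "x \<in> lower_span" for x i j
    using that
  proof (induction rule: lower_span.induct)
    case (word w c)
    then show ?case
      using lower_span_scal[OF unit_uword, of w c] by (simp add: sc_left_commute)
  qed (auto simp: distrib_left intro: lower_span.intros J_mult)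
  show ?thesis
  proof (induction u rule: uea_induct)
    case (scal c)
    show ?case using lower_span.word[of "[]" c] by (simp add: uword_def lower_units_def)
  next
    case (mult i j x)
    then show ?case using \<open>\<And>x i j. x \<in> lower_span \<Longrightarrow> e_unit i j * x \<in> lower_span\<close> by (simp add: mult.assoc)
  qed (simp add: distrib_right lower_span.add)
qed

lemma weight_uword: "e_unit i i * (uword w * \<theta>) - scal (\<mu> i + of_int (uword_wt w i)) * (uword w * \<theta>) \<in> J"
proof (induction w)
  case Nil
  then show ?case using weight by (simp add: uword_def uword_wt_def)
next
  case (Cons x w)
  obtain a b where x: "x = (a, b)" by (cases x)
  let ?v = "uword w * \<theta>" and ?d = "of_bool (i = a) - of_bool (i = b) :: complex"
  have "e_unit i i * e_unit a b = e_unit a b * e_unit i i + scal ?d * e_unit a b"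
    unfolding even_commute[OF refl, of i a b] by (simp add: sc_1 sc_0 sc_uminus)
  then have "e_unit i i * (uword (x # w) * \<theta>) = e_unit a b * (e_unit i i * ?v) + scal ?d * (e_unit a b * ?v)"
    by (simp add: uword_Cons x mult.assoc[symmetric] distrib_right)
  moreover have "\<mu> i + of_int (uword_wt (x # w) i) = (\<mu> i + of_int (uword_wt w i)) + ?d"
    by (simp add: uword_wt_def x)
  ultimately have "e_unit i i * (uword (x # w) * \<theta>) - scal (\<mu> i + of_int (uword_wt (x # w) i)) * (uword (x # w) * \<theta>)
    = e_unit a b * (e_unit i i * ?v - scal (\<mu> i + of_int (uword_wt w i)) * ?v)"
    by (simp only: sc_add[of _ ?d] distrib_right) (simp add: uword_Cons x right_diff_distrib sc_left_commute)
  also have "\<dots> \<in> J" by (rule J_mult[OF Cons])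
  finally show ?case .
qed

lemma J_sum: "(\<And>a. a \<in> A \<Longrightarrow> f a \<in> J) \<Longrightarrow> sum f A \<in> J"
  by (induction A rule: infinite_finite_induct) (auto intro: J_0 J_add)

lemma casimir_singular: "casimir * \<theta> - scal (casimir_ev \<mu>) * \<theta> \<in> J"
proof -
  let ?e = "\<lambda>r s. e_unit (Inl r) (Inl s) :: ('m, 'n) uea"
  let ?f = "\<lambda>r s. if r = s then \<mu> (Inl r) ^ 2 else if r < s then \<mu> (Inl r) - \<mu> (Inl s) else 0"
  have "?e r s * ?e s r * \<theta> - scal (?f r s) * \<theta> \<in> J" for r s
  proof -
    consider "r = s" | "r < s" | "s < r" by force
    then show ?thesis
    proof cases
      case 1
      have "?e r r * (?e r r * \<theta> - scal (\<mu> (Inl r)) * \<theta>) + scal (\<mu> (Inl r)) * (?e r r * \<theta> - scal (\<mu> (Inl r)) * \<theta>) \<in> J"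
        using weight by (intro J_add J_mult)
      then show ?thesis
        using 1 sc_left_commute[of "?e r r" "\<mu> (Inl r)" \<theta>] by (simp add: right_diff_distrib power2_eq_square sc_mult mult.assoc)
    next
      case 2
      have "?e r s * ?e s r * \<theta> = ?e s r * (?e r s * \<theta>) + (?e r r * \<theta> - ?e s s * \<theta>)"
        unfolding even_commute[of "Inl r" "Inl s" "Inl s" "Inl r", simplified]
        by (simp add: distrib_right left_diff_distrib mult.assoc)
      then have "?e r s * ?e s r * \<theta> - scal (?f r s) * \<theta> = ?e s r * (?e r s * \<theta>)
        + ((?e r r * \<theta> - scal (\<mu> (Inl r)) * \<theta>) + - 1 * (?e s s * \<theta> - scal (\<mu> (Inl s)) * \<theta>))"
        using 2 less_imp_neq[OF 2] by (simp add: sc_diff left_diff_distrib)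
      also have "\<dots> \<in> J"
        using 2 by (intro J_add J_mult weight raise) simp
      finally show ?thesis .
    next
      case 3
      then show ?thesis
        using less_imp_neq[OF 3] less_not_sym[OF 3] J_mult[OF raise[of "Inl s" "Inl r"], of "?e r s"] by (simp add: sc_0 mult.assoc)
    qed
  qed
  then have "(\<Sum>r\<in>UNIV. \<Sum>s\<in>UNIV. ?e r s * ?e s r * \<theta> - scal (?f r s) * \<theta>) \<in> J"
    by (intro J_sum)
  then show ?thesis
    by (simp only: casimir_def casimir_ev_def sum_subtractf sum_distrib_right sc_sum)
qed

end

section \<open>Minimality and independence\<close>

lemma form_wt:
  fixes \<alpha> :: "('m::finite, 'n::finite) root"
  shows "form \<mu> (wt \<alpha>) = (if isl (fst \<alpha>) then \<mu> (fst \<alpha>) else - \<mu> (fst \<alpha>))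
    - (if isl (snd \<alpha>) then \<mu> (snd \<alpha>) else - \<mu> (snd \<alpha>))"
proof -
  have "(\<Sum>r\<in>UNIV. \<mu> (Inl r) * wt \<alpha> (Inl r)) =
    (\<Sum>r\<in>UNIV. (if Inl r = fst \<alpha> then \<mu> (Inl r) else 0) - (if Inl r = snd \<alpha> then \<mu> (Inl r) else 0))"
    by (intro sum.cong) (auto simp: wt_def)
  moreover have "(\<Sum>s\<in>UNIV. \<mu> (Inr s) * wt \<alpha> (Inr s)) =
    (\<Sum>s\<in>UNIV. (if Inr s = fst \<alpha> then \<mu> (Inr s) else 0) - (if Inr s = snd \<alpha> then \<mu> (Inr s) else 0))"
    by (intro sum.cong) (auto simp: wt_def)
  ultimately show ?thesis
    unfolding form_def sum_subtractf by (cases "fst \<alpha>"; cases "snd \<alpha>") auto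
qed

definition rho_shift :: "('m::{finite,linorder}, 'n::{finite,linorder}) weight \<Rightarrow> ('m, 'n) weight" where
  "rho_shift lam k = lam k + rho k"

lemma rho_shift_eq: "(\<lambda>k. lam k + rho k) = rho_shift lam"
  by (simp add: rho_shift_def fun_eq_iff)

lemma odd_pos_rootsE:
  assumes "\<gamma> \<in> odd_pos_roots" obtains r s where "\<gamma> = (Inl r, Inr s)"
proof (cases \<gamma>)
  case (Pair a b)
  with assms that show ?thesis
    by (cases a; cases b) (auto simp: odd_pos_roots_def even_pair_def pos_roots_def)
qed

lemma B_set_iff:
  fixes lam :: "('m::{finite,linorder}, 'n::{finite,linorder}) weight"
  shows "(Inl r, Inr s) \<in> B_set lam \<longleftrightarrow> rho_shift lam (Inl r) + rho_shift lam (Inr s) = 0"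
  by (simp add: B_set_def rho_shift_eq form_wt eq_neg_iff_add_eq_0 odd_pos_roots_def pos_roots_def even_pair_def)

lemma B_setE:
  assumes "\<gamma> \<in> B_set lam" obtains r s where "\<gamma> = (Inl r, Inr s)"
  using assms by (auto simp: B_set_def elim: odd_pos_rootsE)

lemma tri_left:
  fixes lam :: "('m::{finite,linorder}, 'n::{finite,linorder}) weight"
  assumes B: "(Inl r, Inr s) \<in> B_set lam" and r: "r < r'"
    and eq: "rho_shift lam (Inl r) = rho_shift lam (Inl r')"
  shows "tri lam (Inl r', Inr s) (Inl r, Inr s)"
proof -
  let ?\<alpha> = "(Inl r, Inl r') :: ('m, 'n) root"
  have co: "coroot ?\<alpha> = wt ?\<alpha>"
    using r by (simp add: coroot_def form_wt fun_eq_iff) (simp add: wt_def)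
  have "?\<alpha> \<in> even_pos_roots"
    using r by (simp add: even_pos_roots_def pos_roots_def even_pair_def)
  moreover have "form (\<lambda>k. lam k + rho k) (coroot ?\<alpha>) = 0"
    using eq by (simp add: rho_shift_eq co form_wt)
  moreover have "reflection ?\<alpha> (wt (Inl r, Inr s)) = wt (Inl r', Inr s)"
    using r unfolding reflection_def co form_wt by (auto simp: wt_def fun_eq_iff)
  ultimately show ?thesis
    using B eq unfolding tri_def by (auto simp: B_set_iff wt_def intro!: bexI[of _ ?\<alpha>])
qed

lemma tri_right:
  fixes lam :: "('m::{finite,linorder}, 'n::{finite,linorder}) weight"
  assumes B: "(Inl r, Inr s) \<in> B_set lam" and s: "s' < s"
    and eq: "rho_shift lam (Inr s) = rho_shift lam (Inr s')"
  shows "tri lam (Inl r, Inr s') (Inl r, Inr s)"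
proof -
  let ?\<alpha> = "(Inr s', Inr s) :: ('m, 'n) root"
  \<comment> \<open>On the second block the form is negative, so (\<alpha>, \<alpha>) = -2.\<close>
  have co: "coroot ?\<alpha> = (\<lambda>k. - wt ?\<alpha> k)"
    using s by (simp add: coroot_def form_wt fun_eq_iff) (simp add: wt_def)
  have co': "form \<mu> (coroot ?\<alpha>) = - form \<mu> (wt ?\<alpha>)" for \<mu>
    unfolding co by (simp add: form_def sum_negf)
  have "?\<alpha> \<in> even_pos_roots"
    using s by (simp add: even_pos_roots_def pos_roots_def even_pair_def)
  moreover have "form (\<lambda>k. lam k + rho k) (coroot ?\<alpha>) = 0"
    using eq by (simp add: rho_shift_eq co' form_wt)
  moreover have "reflection ?\<alpha> (wt (Inl r, Inr s)) = wt (Inl r, Inr s')"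
    using s unfolding reflection_def co' form_wt by (auto simp: wt_def fun_eq_iff)
  ultimately show ?thesis
    using B eq unfolding tri_def by (auto simp: B_set_iff wt_def intro!: bexI[of _ ?\<alpha>])
qed

lemma tri_cases:
  fixes lam :: "('m::{finite,linorder}, 'n::{finite,linorder}) weight"
  assumes "tri lam \<gamma>' \<gamma>"
  shows "snd \<gamma>' = snd \<gamma> \<and> fst \<gamma> \<prec> fst \<gamma>' \<or> fst \<gamma>' = fst \<gamma> \<and> snd \<gamma>' \<prec> snd \<gamma>"
proof -
  obtain \<alpha> where B: "\<gamma>' \<in> B_set lam" "\<gamma> \<in> B_set lam" and \<alpha>: "\<alpha> \<in> even_pos_roots"
    and wt: "\<And>k. wt \<gamma> k - wt \<gamma>' k = wt \<alpha> k"
    using assms unfolding tri_def by blast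
  obtain r s r' s' where \<gamma>: "\<gamma> = (Inl r, Inr s)" "\<gamma>' = (Inl r', Inr s')"
    using B by (metis B_setE)
  consider a b where "\<alpha> = (Inl a, Inl b)" "a < b" | a b where "\<alpha> = (Inr a, Inr b)" "a < b"
  proof (cases \<alpha>)
    case (Pair x y)
    then show ?thesis
      using \<alpha> that by (cases x; cases y) (auto simp: even_pos_roots_def pos_roots_def even_pair_def)
  qed
  then show ?thesis
  proof cases
    case 1
    then show ?thesis
      using wt[of "Inl a"] wt[of "Inl b"] wt[of "Inr s"] by (auto simp: \<gamma> wt_def of_bool_def split: if_splits)
  next
    case 2
    then show ?thesis
      using wt[of "Inr a"] wt[of "Inr b"] wt[of "Inl r"] by (auto simp: \<gamma> wt_def of_bool_def split: if_splits)
  qed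
qed

lemma not_lambda_minimal:
  assumes "\<not> lambda_minimal lam \<gamma>"
  obtains \<gamma>' where "tri lam \<gamma>' \<gamma>"
proof -
  obtain \<gamma>0 where "(tri lam)\<^sup>*\<^sup>* \<gamma>0 \<gamma>" "\<gamma>0 \<noteq> \<gamma>"
    using assms by (auto simp: lambda_minimal_def)
  then show ?thesis using that by (cases rule: rtranclp.cases) auto
qed

text \<open>If the values agreed, (r', s) and (r, s') would also be in B(\<lambda>), and whichever
  differs from (r, s) would lie strictly below it.\<close>

lemma lambda_minimal_values:
  fixes lam :: "('m::{finite,linorder}, 'n::{finite,linorder}) weight"
  assumes min: "lambda_minimal lam (Inl r, Inr s)" and B: "(Inl r, Inr s) \<in> B_set lam" "(Inl r', Inr s') \<in> B_set lam"
    and le: "r \<le> r'" "s' \<le> s" and ne: "(r', s') \<noteq> (r, s)"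
  shows "rho_shift lam (Inl r) \<noteq> rho_shift lam (Inl r')"
proof
  assume eq: "rho_shift lam (Inl r) = rho_shift lam (Inl r')"
  have eq': "rho_shift lam (Inr s) = rho_shift lam (Inr s')"
    using B eq unfolding B_set_iff by (metis add_left_cancel)
  have "\<gamma>' = (Inl r, Inr s)" if tri: "tri lam \<gamma>' (Inl r, Inr s)" for \<gamma>'
  proof -
    have "\<gamma>' \<in> B_set lam" using tri by (simp add: tri_def)
    then show ?thesis using min r_into_rtranclp[of "tri lam", OF tri] by (auto simp: lambda_minimal_def)
  qed
  then have "\<not> r < r'" "\<not> s' < s"
    using tri_left[OF B(1) _ eq] tri_right[OF B(1) _ eq'] by force+
  with le ne show False by auto
qed

lemma rho_Inl:
  fixes r :: "'m::{finite,linorder}"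
  shows "(rho :: ('m, 'n::{finite,linorder}) weight) (Inl r)
    = (of_nat (card {s. r < s}) - of_nat (card {s. s < r})) / 2 - of_nat (card (UNIV :: 'n set)) / 2"
proof -
  have sum: "(\<Sum>\<alpha>\<in>A. wt \<alpha> (Inl r)) = of_nat (card {\<alpha>\<in>A. fst \<alpha> = Inl r}) - of_nat (card {\<alpha>\<in>A. snd \<alpha> = Inl r})"
    for A :: "('m, 'n) root set"
    by (simp add: wt_def sum_subtractf of_bool_def sum.If_cases eq_commute[of "Inl r"] Int_def)
  have "{\<alpha> \<in> (even_pos_roots :: ('m, 'n) root set). fst \<alpha> = Inl r} = (\<lambda>s. (Inl r, Inl s)) ` {s. r < s}"
    by (auto simp: even_pos_roots_def pos_roots_def even_pair_def isl_def image_iff)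
  moreover have "{\<alpha> \<in> (even_pos_roots :: ('m, 'n) root set). snd \<alpha> = Inl r} = (\<lambda>s. (Inl s, Inl r)) ` {s. s < r}"
    by (auto simp: even_pos_roots_def pos_roots_def even_pair_def isl_def image_iff)
  moreover have "{\<alpha> \<in> (odd_pos_roots :: ('m, 'n) root set). fst \<alpha> = Inl r} = range (\<lambda>s. (Inl r, Inr s))"
  proof (intro set_eqI iffI)
    fix \<alpha> :: "('m, 'n) root" assume "\<alpha> \<in> {\<alpha> \<in> odd_pos_roots. fst \<alpha> = Inl r}"
    then show "\<alpha> \<in> range (\<lambda>s. (Inl r, Inr s))" by (auto elim: odd_pos_rootsE)
  qed (auto simp: odd_pos_roots_def pos_roots_def even_pair_def)
  moreover have "{\<alpha> \<in> (odd_pos_roots :: ('m, 'n) root set). snd \<alpha> = Inl r} = {}"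
    by (auto elim: odd_pos_rootsE)
  ultimately show ?thesis
    unfolding rho_def sum by (simp add: card_image inj_on_def)
qed

text \<open>Lowering the weight by \<epsilon>_r changes (\<mu>, \<mu> + 2 \<rho>_0) by 1 - 2 (\<mu>
  + \<rho>_0, \<epsilon>_r), and \<rho> is smaller than \<rho>_0 by n/2 at e_{r,r}.\<close>

lemma casimir_ev_diff:
  fixes lam :: "('m::{finite,linorder}, 'n::{finite,linorder}) weight"
  shows "casimir_ev (\<lambda>k. lam k - wt (Inl r, Inr s) k) - casimir_ev lam
    = 1 - of_nat (card (UNIV :: 'n set)) - 2 * rho_shift lam (Inl r)"
proof -
  let ?d = "\<lambda>a. of_bool (a = r) :: complex"
  let ?g = "\<lambda>a b. if a = b then (1 - 2 * lam (Inl r)) * of_bool (a = r)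
      else if a < b then ?d b - ?d a else 0"
  have "casimir_ev (\<lambda>k. lam k - wt (Inl r, Inr s) k) - casimir_ev lam = (\<Sum>a\<in>UNIV. \<Sum>b\<in>UNIV. ?g a b)"
    unfolding casimir_ev_def sum_subtractf[symmetric]
    by (intro sum.cong refl) (auto simp: wt_def power2_eq_square algebra_simps)
  also have "\<dots> = (\<Sum>a\<in>UNIV. \<Sum>b\<in>UNIV. (if a = b then (1 - 2 * lam (Inl r)) * ?d a else 0)
      + ((if b = r then of_bool (a < r) else 0) - (if a = r then of_bool (r < b) else 0)))"
    by (intro sum.cong refl) auto
  also have "\<dots> = (1 - 2 * lam (Inl r)) + ((\<Sum>a\<in>UNIV. of_bool (a < r)) - (\<Sum>b\<in>UNIV. of_bool (r < b)))"
  proof -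
    have 1: "(\<Sum>a\<in>UNIV. \<Sum>b\<in>UNIV. if a = b then (1 - 2 * lam (Inl r)) * ?d a else 0) = 1 - 2 * lam (Inl r)"
      by (simp add: of_bool_def flip: sum_distrib_left)
    have 2: "(\<Sum>a\<in>UNIV. \<Sum>b\<in>UNIV. if b = r then of_bool (a < r) else (0::complex)) = (\<Sum>a\<in>UNIV. of_bool (a < r))"
      by simp
    have 3: "(\<Sum>a\<in>UNIV. \<Sum>b\<in>UNIV. if a = r then of_bool (r < b) else (0::complex)) = (\<Sum>b\<in>UNIV. of_bool (r < b))"
      by (subst sum.swap) simp
    show ?thesis unfolding sum.distrib sum_subtractf 1 2 3 ..
  qed
  also have "\<dots> = (1 - 2 * lam (Inl r)) + (of_nat (card {a. a < r}) - of_nat (card {b. r < b}))"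
    by (simp add: of_bool_def sum.If_cases)
  also have "\<dots> = 1 - of_nat (card (UNIV :: 'n set)) - 2 * rho_shift lam (Inl r)"
  proof -
    have "(1 - 2 * l) + (x - y) = 1 - k - 2 * (l + ((y - x) / 2 - k / 2))" for l x y k :: complex
      by (simp add: field_simps)
    then show ?thesis unfolding rho_shift_def rho_Inl .
  qed
  finally show ?thesis .
qed

text \<open>The weight \<gamma>' - \<gamma> has total 0 on the first block, an initial segment of
  the indices; so no letter leaves it and all letters are even. The segments up to
  \<open>Inl r'\<close> and up to \<open>Inr s\<close> give the two inequalities.\<close>

lemma lower_word_orientation:
  fixes w :: "(('m::{finite,linorder} + 'n::{finite,linorder}) \<times> ('m + 'n)) list"
  assumes w: "lower_units w"
    and wt: "\<And>i. complex_of_int (uword_wt w i) = wt (Inl r', Inr s') i - wt (Inl r, Inr s) i"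
  shows "\<forall>(a, b)\<in>set w. isl a = isl b" "r \<le> r'" "s' \<le> s"
proof -
  have wt': "uword_wt w i = (of_bool (i = Inl r') - of_bool (i = Inr s')) - (of_bool (i = Inl r) - of_bool (i = Inr s))" for i
  proof -
    have "complex_of_int (uword_wt w i)
      = of_int ((of_bool (i = Inl r') - of_bool (i = Inr s')) - (of_bool (i = Inl r) - of_bool (i = Inr s)))"
      unfolding wt by (simp add: wt_def)
    then show ?thesis by (simp only: of_int_eq_iff)
  qed
  have sum: "(\<Sum>i\<in>D. uword_wt w i) = (of_bool (Inl r' \<in> D) - of_bool (Inr s' \<in> D)) - (of_bool (Inl r \<in> D) - of_bool (Inr s \<in> D))" for D
    unfolding wt' by (simp add: sum_subtractf of_bool_def)
  have lower: "b \<prec> a" if "(a, b) \<in> set w" for a b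
    using w that by (auto simp: lower_units_def)
  have left: "b \<in> range Inl" if "(a, b) \<in> set w" "a \<in> range Inl" for a b
    using lower[OF that(1)] that(2) by (cases b) auto
  have "(a \<in> range Inl) \<longleftrightarrow> (b \<in> range Inl)" if "(a, b) \<in> set w" for a b
    by (rule sum_uword_wt_down(2)[OF left _ that]) (auto simp: sum)
  then show "\<forall>(a, b)\<in>set w. isl a = isl b"
    by (force simp: isl_def image_iff)
  have down: "(\<Sum>i\<in>{i. i = k \<or> i \<prec> k}. uword_wt w i) \<le> 0" for k
    by (rule sum_uword_wt_down(1)) (use lower prec_trans in blast)
  show "r \<le> r'"
    using down[of "Inl r'"] unfolding sum by (auto simp: of_bool_def split: if_splits)
  show "s' \<le> s"
    using down[of "Inr s"] unfolding sum by (auto simp: of_bool_def split: if_splits)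
qed

lemma shapovalov_singular_vector:
  fixes lam :: "('m::{finite,linorder}, 'n::{finite,linorder}) weight"
  assumes "shapovalov rs \<gamma> \<theta>" "\<gamma> \<in> B_set lam" and J: "verma_ideal lam \<subseteq> J"
    "\<And>x y. x \<in> J \<Longrightarrow> y \<in> J \<Longrightarrow> x + y \<in> J" "\<And>x z. x \<in> J \<Longrightarrow> z * x \<in> J"
  shows "singular_vector J \<theta> (\<lambda>k. lam k - wt \<gamma> k)"
proof
  show "0 \<in> J" using J(1) verma_ideal_0 by blast
  show "e_unit i j * \<theta> \<in> J" if "i \<prec> j" for i j
    using shapovalov_singular[OF assms(1,2) that] J(1) by blast
  show "e_unit i i * \<theta> - scal (lam i - wt \<gamma> i) * \<theta> \<in> J" for i
  proof -
    interpret s: scalars "scal :: complex \<Rightarrow> ('m, 'n) uea" by (rule scalars_scal)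
    have eq: "e_unit i i * \<theta> - \<theta> * e_unit i i = scal (- wt \<gamma> i) * \<theta>"
      using assms(1) by (simp add: shapovalov_def)
    have "e_unit i i * \<theta> - scal (lam i - wt \<gamma> i) * \<theta>
      = (e_unit i i * \<theta> - \<theta> * e_unit i i - scal (- wt \<gamma> i) * \<theta>) + \<theta> * (e_unit i i - scal (lam i))"
      by (simp add: s.sc_diff s.sc_uminus algebra_simps s.sc_central[of "lam i" \<theta>])
    also have "\<dots> = \<theta> * (e_unit i i - scal (lam i))" by (simp add: eq)
    finally have "e_unit i i * \<theta> - scal (lam i - wt \<gamma> i) * \<theta> = \<theta> * (e_unit i i - scal (lam i))" .
    then show ?thesis
      using J(1,3) verma_ideal_diagonal by (metis subsetD)
  qed
qed (use J in auto)

theorem shapovalov_independent: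
  fixes lam :: "('m::{finite,linorder}, 'n::{finite,linorder}) weight"
  assumes rs: "distinct rs" "set rs = pos_roots"
    and \<theta>: "\<And>\<beta>. \<beta> \<in> odd_pos_roots \<Longrightarrow> shapovalov rs \<beta> (\<theta> \<beta>)"
    and B: "\<gamma> \<in> B_set lam" and min: "lambda_minimal lam \<gamma>"
  shows "independent_at \<theta> lam \<gamma>"
proof -
  have odd: "\<beta> \<in> odd_pos_roots" if "\<beta> \<in> B_set lam" for \<beta>
    using that by (simp add: B_set_def)
  obtain J where free_J: "free_gl scal eN (gl_dim TYPE('m + 'n)) (parN TYPE('m + 'n)) J" and J: "verma_ideal lam \<subseteq> J"
    by (rule free_ideal)
  interpret free_gl scal eN "gl_dim TYPE('m + 'n)" "parN TYPE('m + 'n)" J by (rule free_J)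
  have sing: "singular_vector J (\<theta> \<beta>) (\<lambda>k. lam k - wt \<beta> k)" if "\<beta> \<in> B_set lam" for \<beta>
    using that J J_add J_mult by (intro shapovalov_singular_vector[of rs] \<theta> odd)
  interpret \<gamma>: singular_vector J "\<theta> \<gamma>" "\<lambda>k. lam k - wt \<gamma> k"
    by (rule sing[OF B])
  \<comment> \<open>The separating family: the Casimir element at \<open>None\<close> and the
    diagonal units at \<open>Some i\<close>.\<close>
  define op :: "('m + 'n) option \<Rightarrow> ('m, 'n) uea" where
    "op a = (case a of None \<Rightarrow> casimir | Some i \<Rightarrow> e_unit i i)" for a
  define ev where "ev a = (case a of None \<Rightarrow> casimir_ev (\<lambda>k. lam k - wt \<gamma> k) | Some i \<Rightarrow> lam i - wt \<gamma> i)" for a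
  interpret eigenvector scal J op ev "\<theta> \<gamma>"
  proof
    have "e_unit i i * e_unit j j = (e_unit j j * e_unit i i :: ('m, 'n) uea)" for i j
      using even_commute[of i i j j] by auto
    then show "op a * op b = op b * op a" for a b
      by (cases a; cases b) (auto simp: op_def casimir_commute)
    show "op a * \<theta> \<gamma> - scal (ev a) * \<theta> \<gamma> \<in> J" for a
      by (cases a) (auto simp: op_def ev_def \<gamma>.casimir_singular \<gamma>.weight)
  qed (auto intro: J_add J_mult)
  have "u * \<theta> \<gamma>' \<in> separated" if \<gamma>': "\<gamma>' \<in> B_set lam" "\<gamma>' \<noteq> \<gamma>" for \<gamma>' u
  proof -
    interpret \<gamma>': singular_vector J "\<theta> \<gamma>'" "\<lambda>k. lam k - wt \<gamma>' k"
      by (rule sing[OF \<gamma>'(1)])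
    have words: "uword w * \<theta> \<gamma>' \<in> separated" if w: "lower_units w" for w
    \<comment> \<open>A word of the wrong weight is separated by some e_{i,i}. For the right weight
      the Casimir element has to do it.\<close>
    proof (cases "\<forall>i. lam i - wt \<gamma>' i + of_int (uword_wt w i) = lam i - wt \<gamma> i")
      case False
      then obtain i where "lam i - wt \<gamma>' i + of_int (uword_wt w i) \<noteq> ev (Some i)"
        by (auto simp: ev_def)
      then show ?thesis
        using \<gamma>'.weight_uword[of i w] by (intro separated_eigen[of "Some i"]) (auto simp: op_def)
    next
      case True
      obtain r s where rs: "\<gamma> = (Inl r, Inr s)" using B by (rule B_setE)
      obtain r' s' where rs': "\<gamma>' = (Inl r', Inr s')" using \<gamma>'(1) by (rule B_setE)
      have "complex_of_int (uword_wt w i) = wt (Inl r', Inr s') i - wt (Inl r, Inr s) i" for i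
      proof -
        have "(lam i - wt \<gamma>' i + of_int (uword_wt w i)) - (lam i - wt \<gamma>' i) = (lam i - wt \<gamma> i) - (lam i - wt \<gamma>' i)"
          using True by (simp only:)
        then show ?thesis by (simp add: rs rs')
      qed
      note or = lower_word_orientation[OF w this]
      have "rho_shift lam (Inl r) \<noteq> rho_shift lam (Inl r')"
        using min B \<gamma>' or(2,3) unfolding rs rs' by (intro lambda_minimal_values) auto
      then have ne: "casimir_ev (\<lambda>k. lam k - wt \<gamma>' k) \<noteq> ev None"
        using casimir_ev_diff[of lam r s] casimir_ev_diff[of lam r' s'] by (auto simp: ev_def rs rs')
      have "uword w * (casimir * \<theta> \<gamma>' - scal (casimir_ev (\<lambda>k. lam k - wt \<gamma>' k)) * \<theta> \<gamma>') \<in> J"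
        by (rule J_mult[OF \<gamma>'.casimir_singular])
      \<comment> \<open>All letters are even here, so the Casimir element passes through the word
        and keeps its eigenvalue on \<theta>_\<gamma>' v_\<lambda>.\<close>
      also have "uword w * (casimir * \<theta> \<gamma>' - scal (casimir_ev (\<lambda>k. lam k - wt \<gamma>' k)) * \<theta> \<gamma>')
        = op None * (uword w * \<theta> \<gamma>') - scal (casimir_ev (\<lambda>k. lam k - wt \<gamma>' k)) * (uword w * \<theta> \<gamma>')"
      proof -
        have "uword w * (casimir * \<theta> \<gamma>') = casimir * (uword w * \<theta> \<gamma>')"
          by (simp add: casimir_uword[OF or(1)] flip: mult.assoc)
        then show ?thesis by (simp add: op_def right_diff_distrib sc_left_commute)
      qed
      finally show ?thesis using ne by (rule separated_eigen)
    qed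
    have "x \<in> separated" if "x \<in> \<gamma>'.lower_span" for x
      using that by (induction rule: \<gamma>'.lower_span.induct) (auto intro: words separated_J separated_sc separated_add)
    then show ?thesis using \<gamma>'.submodule_lower_span by blast
  qed
  note sep = this
  have span: "\<exists>y\<in>separated. Y = vcoset lam y"
    if "Y \<in> vspan lam ((\<lambda>\<gamma>'. vact lam (\<theta> \<gamma>') (hwv lam)) ` (B_set lam - {\<gamma>}))" for Y
    using that
  proof (induction rule: vspan.induct)
    case zero
    then show ?case using separated_J[OF J_0] by blast
  next
    case (step X Y u)
    then obtain \<gamma>' y where "\<gamma>' \<in> B_set lam" "\<gamma>' \<noteq> \<gamma>" and X: "X = vcoset lam (\<theta> \<gamma>')"
        and y: "y \<in> separated" "Y = vcoset lam y"
      by (auto simp: hwv_def vact_vcoset)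
    then have "u * \<theta> \<gamma>' + y \<in> separated"
      by (intro separated_add sep)
    then show ?case
      by (auto simp: X y vact_vcoset vadd_vcoset)
  qed
  show ?thesis
    unfolding independent_at_def
  proof
    assume "vact lam (\<theta> \<gamma>) (hwv lam) \<in> vspan lam ((\<lambda>\<gamma>'. vact lam (\<theta> \<gamma>') (hwv lam)) ` (B_set lam - {\<gamma>}))"
    from span[OF this] obtain y where y: "y \<in> separated" "vcoset lam (\<theta> \<gamma>) = vcoset lam y"
      by (auto simp: hwv_def vact_vcoset)
    then have "\<theta> \<gamma> - y \<in> J"
      using J by (auto simp: vcoset_eq_iff)
    then have "(\<theta> \<gamma> - y) + y \<in> separated"
      by (rule separated_add[OF separated_J y(1)])
    then have "\<theta> \<gamma> \<in> J"
      by (intro eigenvector_separated) simp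
    have pos: "\<gamma> \<in> pos_roots" using odd[OF B] by (simp add: odd_pos_roots_def)
    \<comment> \<open>The chain of \<theta>_\<gamma> has a nonzero coefficient, so it cannot lie in
      \<open>J\<close>.\<close>
    obtain x c where x: "c \<noteq> 0" "chain scal eN (rank (snd \<gamma>)) (rank (fst \<gamma>)) x c" "\<theta> \<gamma> - x \<in> verma_ideal lam"
      using shapovalov_chain[OF rs \<theta>[OF odd[OF B]] pos free_J] by blast
    have "\<theta> \<gamma> - (\<theta> \<gamma> - x) \<in> J"
      by (rule J_diff[OF \<open>\<theta> \<gamma> \<in> J\<close> subsetD[OF J x(3)]])
    then show False
      using chain_in_J[OF _ x(2)] x(1) by simp
  qed
qed

theorem theorem6p4:
  fixes lam :: "('m::{finite,linorder}, 'n::{finite,linorder}) weight"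
    and \<gamma> :: "('m, 'n) root"
    and rs :: "('m, 'n) root list"
    and \<theta> :: "('m, 'n) root \<Rightarrow> ('m, 'n) uea"
  assumes "distinct rs" and "set rs = pos_roots"
    and "\<And>\<beta>. \<beta> \<in> odd_pos_roots \<Longrightarrow> shapovalov rs \<beta> (\<theta> \<beta>)"
    and "\<gamma> \<in> B_set lam"
  shows "independent_at \<theta> lam \<gamma> \<longleftrightarrow> lambda_minimal lam \<gamma>"
proof
  assume indep: "independent_at \<theta> lam \<gamma>"
  show "lambda_minimal lam \<gamma>"
  proof (rule ccontr)
    assume "\<not> lambda_minimal lam \<gamma>"
    then obtain \<gamma>' where tri: "tri lam \<gamma>' \<gamma>" by (rule not_lambda_minimal)
    then have B': "\<gamma>' \<in> B_set lam" by (simp add: tri_def)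
    note cases = tri_cases[OF tri]
    then have ne: "\<gamma>' \<noteq> \<gamma>" using prec_irrefl by auto
    have "shapovalov rs \<gamma> (\<theta> \<gamma>)" "shapovalov rs \<gamma>' (\<theta> \<gamma>')"
      using assms(3,4) B' by (auto simp: B_set_def)
    then obtain u where "\<theta> \<gamma> - u * \<theta> \<gamma>' \<in> verma_ideal lam"
      using shapovalov_dependent[OF assms(1,2) _ _ assms(4) B' cases] by blast
    then have "vact lam (\<theta> \<gamma>) (hwv lam) = vadd (vact lam u (vact lam (\<theta> \<gamma>') (hwv lam))) (vcoset lam 0)"
      by (simp add: hwv_def vact_vcoset vadd_vcoset vcoset_eq_iff)
    also have "\<dots> \<in> vspan lam ((\<lambda>\<gamma>'. vact lam (\<theta> \<gamma>') (hwv lam)) ` (B_set lam - {\<gamma>}))"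
      using B' ne by (intro vspan.step vspan.zero) auto
    finally show False using indep by (simp add: independent_at_def)
  qed
qed (use shapovalov_independent[OF assms] in blast)

end
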